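(* Let $m\geq 2$ and $d\geq 1$ be integers, let $s>\frac{(m-1)d}{2}+\frac12$, and let $\sigma$ be a (positive, finite) measure on $\mathbb{R}^{md}$ supported in the unit ball $\mathbb{B}^{md}(0,1)$ whose Fourier transform satisfies \[ |\widehat{\mathrm{d}\sigma}(\xi)|\lesssim (1+|\xi|)^{-s},\qquad \xi\in\mathbb{R}^{md}. \] For Schwartz functions $f_1,\dots,f_m$ on $\mathbb{R}^d$, writing $\mathrm{F}=(f_1,\dots,f_m)$ and $y=(y_1,\dots,y_m)\in(\mathbb{R}^d)^m$, define the local maximal function \[ \mathrm{M}_\sigma^{loc}(\mathrm{F})(x)=\sup_{1<t<2}\Big|\int \prod_{i=1}^m f_i(x-ty_i)\,\mathrm{d}\sigma(y)\Big|,\qquad x\in\mathbb{R}^d. \] Then there is a constant $C$ such that for every $p$ with $2/m\le p\le 2$, \[ \|\mathrm{M}_\sigma^{loc}(\mathrm{F})\|_{L^p(\mathbb{B}^d(0,1))}\le C\prod_{i=1}^m\|f_i\|_{L^2(\mathbb{R}^d)}, \] and moreover, for $p=2/m$, \[ \|\mathrm{M}_\sigma^{loc}(\mathrm{F})\|_{L^{2/m}(\mathbb{R}^d)}\le C\prod_{i=1}^m\|f_i\|_{L^2(\mathbb{R}^d)}. \]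
   Context: $\mathbb{B}^n(x,R)$ denotes the ball in $\mathbb{R}^n$ of radius $R$ centered at $x$. $\widehat{\mathrm{d}\sigma}$ is the Fourier transform of the measure $\sigma$ on $\mathbb{R}^{md}$. *)

theory Defs
  imports "HOL-Analysis.Analysis"
begin

definition fourier_measure :: "'a::euclidean_space measure \<Rightarrow> 'a \<Rightarrow> complex" where
  "fourier_measure \<sigma> \<xi> = (\<integral> y. cis (- 2 * pi * (y \<bullet> \<xi>)) \<partial>\<sigma>)"

definition dir_deriv :: "'a::euclidean_space \<Rightarrow> ('a \<Rightarrow> complex) \<Rightarrow> 'a \<Rightarrow> complex" where
  "dir_deriv v f x = frechet_derivative f (at x) v"

fun iter_dir_deriv :: "'a::euclidean_space list \<Rightarrow> ('a \<Rightarrow> complex) \<Rightarrow> 'a \<Rightarrow> complex" where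
  "iter_dir_deriv [] f = f"
| "iter_dir_deriv (v # vs) f = dir_deriv v (iter_dir_deriv vs f)"

definition schwartz :: "('a::euclidean_space \<Rightarrow> complex) \<Rightarrow> bool" where
  "schwartz f \<longleftrightarrow>
     (\<forall>vs x. iter_dir_deriv vs f differentiable (at x)) \<and>
     (\<forall>vs (N::nat). \<exists>C. \<forall>x. (1 + norm x) ^ N * norm (iter_dir_deriv vs f x) \<le> C)"

definition L2_norm_fun :: "('a::euclidean_space \<Rightarrow> complex) \<Rightarrow> real" where
  "L2_norm_fun f = sqrt (\<integral> x. (norm (f x))\<^sup>2 \<partial>lborel)"

text \<open>Real powers on ennreal (for exponents p > 0), infinity maps to infinity.\<close>
definition enn_powr :: "ennreal \<Rightarrow> real \<Rightarrow> ennreal" where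
  "enn_powr a p = (if a = \<infinity> then \<infinity> else ennreal (enn2real a powr p))"

definition Lp_norm_on :: "'a::euclidean_space set \<Rightarrow> real \<Rightarrow> ('a \<Rightarrow> ennreal) \<Rightarrow> ennreal" where
  "Lp_norm_on S p g = enn_powr (\<integral>\<^sup>+ x\<in>S. enn_powr (g x) p \<partial>lborel) (1 / p)"

definition max_loc :: "(real^'d^'m) measure \<Rightarrow> ('m \<Rightarrow> real^'d \<Rightarrow> complex) \<Rightarrow> real^'d \<Rightarrow> ennreal" where
  "max_loc \<sigma> F x = (SUP t\<in>{1<..<2::real}.
      ennreal (norm (\<integral> y. (\<Prod>i\<in>UNIV. F i (x - t *\<^sub>R (y $ i))) \<partial>\<sigma>)))"

end

theory Submission
  imports Defs "HOL-Probability.Probability"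
begin

text \<open>
  Write \<open>F = f\<^sub>1 \<otimes> \<dots> \<otimes> f\<^sub>m\<close> on \<open>\<real>\<^bsup>md\<^esup>\<close>, \<open>D x = (x, \<dots>, x)\<close> and \<open>L \<xi> = \<Sum>\<^sub>i \<xi>\<^sub>i\<close>, the adjoint of \<open>D\<close>.
  The average at scale \<open>t\<close> is the restriction to the diagonal of \<open>F\<close> with Fourier multiplier \<open>\<xi> \<mapsto> (d\<sigma>)^(t \<xi>)\<close>. For
  fixed \<open>t\<close>, Plancherel in \<open>x\<close> and Cauchy-Schwarz over the fibres \<open>L \<xi> = \<eta>\<close>, which have dimension
  \<open>(m - 1) d\<close>, give an \<open>L\<^sup>2\<close> bound as soon as the multiplier decays faster than \<open>|\<xi>|\<close> to the power
  \<open>- (m - 1) d / 2\<close>. The supremum over \<open>t\<close> costs half a derivative up to an epsilon: on a dyadic frequency piece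
  the values at \<open>t\<close> and at \<open>t + k h\<close>, \<open>1 \<le> k \<le> n\<close>, are related by an \<open>n\<close>-th difference, which is negligible when
  \<open>h\<close> is slightly below the inverse frequency, since \<open>\<sigma>\<close> lives in the unit ball. Averaging over \<open>h\<close>
  bounds the supremum by an \<open>L\<^sup>2\<close> norm in \<open>t\<close>.

  The resulting \<open>L\<^sup>2\<close> bound on balls of radius one involves only the restrictions of the \<open>f\<^sub>i\<close> to a ball of radius
  four. It self-improves to all \<open>p \<le> 2\<close> on such balls, and for \<open>p = 2 / m\<close> averaging over the centres of the balls
  gives the global estimate.
\<close>

subsection \<open>Gaussians and their Fourier transforms\<close>

text \<open>Put q = 2^(-j) for the scale of a frequency piece, and let a be slightly above (m - 1) d
  / 2. Decay of order a + 1/2 + 2 \<kappa> gives a factor q^(1 + 4 \<kappa>) in the squared L2 norm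
  at fixed t. Averaging over steps h up to about q^(1 + \<kappa>) costs q^(-1 - \<kappa>), summing
  the pieces by Cauchy-Schwarz costs q^(-\<kappa>), and q^(2 \<kappa>) remains. Decay is assumed for
  the transform of \<sigma> and not for its gradient; differences in t involve its values alone.
  Each order of differencing gains q^\<kappa>, so n is taken so large that n \<kappa> beats a weight
  of degree m d, which makes the error integral converge. This error is bounded uniformly in x
  rather than in L2, whence the estimates over balls. Gaussians serve as frequency cutoffs because
  their transforms are explicit and their differences telescope; a double zero at the origin (for j
  > 0) and rapid decay replace compact frequency support. Since integrability of the transform of F
  is not at hand, the pieces are summed through Gaussian smoothing and not by Fourier
  inversion.\<close>

lemma integral_lborel_prod:
  fixes f :: "'a::euclidean_space \<Rightarrow> real \<Rightarrow> 'b::{real_normed_field,banach,second_countable_topology}"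
  assumes "\<And>b. b \<in> Basis \<Longrightarrow> integrable lborel (f b)"
  shows "integrable lborel (\<lambda>x. \<Prod>b\<in>Basis. f b (x \<bullet> b))" (is ?I)
    and "(\<integral>x. (\<Prod>b\<in>Basis. f b (x \<bullet> b)) \<partial>lborel) = (\<Prod>b\<in>Basis. \<integral>x. f b x \<partial>lborel)" (is ?E)
proof -
  interpret product_sigma_finite "\<lambda>_::'a. lborel :: real measure"
    by standard
  have [measurable]: "b \<in> Basis \<Longrightarrow> f b \<in> borel_measurable borel" for b
    using assms[of b] by (auto simp: integrable_iff_bounded)
  have eq: "(\<Prod>b\<in>Basis. f b ((\<Sum>b\<in>Basis. x b *\<^sub>R b) \<bullet> b)) = (\<Prod>b\<in>Basis. f b (x b))" for x :: "'a \<Rightarrow> real"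
    by (intro prod.cong) (auto simp: inner_sum_left inner_Basis if_distrib cong: if_cong)
  show ?I
    by (subst lborel_eq) (use product_integrable_prod[of Basis f] assms in \<open>simp add: integrable_distr_eq eq\<close>)
  show ?E
    by (subst lborel_eq) (use product_integral_prod[of Basis f] assms in \<open>simp add: integral_distr eq\<close>)
qed

lemma nn_integral_lborel_affine:
  fixes f :: "'a::euclidean_space \<Rightarrow> ennreal"
  assumes [measurable]: "f \<in> borel_measurable borel" and "c \<noteq> 0"
  shows "(\<integral>\<^sup>+x. f x \<partial>lborel) = ennreal (\<bar>c\<bar> ^ DIM('a)) * (\<integral>\<^sup>+x. f (t + c *\<^sub>R x) \<partial>lborel)"
  by (subst lborel_affine[OF \<open>c \<noteq> 0\<close>, of t])
     (simp add: nn_integral_density nn_integral_distr nn_integral_cmult)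

lemma integral_lborel_affine:
  fixes f :: "'a::euclidean_space \<Rightarrow> 'b::{banach,second_countable_topology}"
  assumes [measurable]: "f \<in> borel_measurable borel" and "c \<noteq> 0"
  shows "(\<integral>x. f x \<partial>lborel) = (\<bar>c\<bar> ^ DIM('a)) *\<^sub>R (\<integral>x. f (t + c *\<^sub>R x) \<partial>lborel)"
  by (subst lborel_affine[OF \<open>c \<noteq> 0\<close>, of t])
     (simp add: integral_density integral_distr)

lemma integrable_lborel_affine:
  fixes f :: "'a::euclidean_space \<Rightarrow> 'b::{banach,second_countable_topology}"
  assumes f: "integrable lborel f" and "c \<noteq> 0"
  shows "integrable lborel (\<lambda>x. f (t + c *\<^sub>R x))"
proof -
  have [measurable]: "f \<in> borel_measurable borel" using f by auto
  have "(\<integral>\<^sup>+x. norm (f x) \<partial>lborel) = ennreal (\<bar>c\<bar> ^ DIM('a)) * (\<integral>\<^sup>+x. norm (f (t + c *\<^sub>R x)) \<partial>lborel)"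
    by (rule nn_integral_lborel_affine) (use assms in auto)
  moreover have "(\<integral>\<^sup>+x. norm (f x) \<partial>lborel) < \<infinity>"
    using f by (simp add: integrable_iff_bounded)
  ultimately have "(\<integral>\<^sup>+x. norm (f (t + c *\<^sub>R x)) \<partial>lborel) < \<infinity>"
    using \<open>c \<noteq> 0\<close> by (auto simp: ennreal_mult_less_top)
  then show ?thesis
    by (simp add: integrable_iff_bounded)
qed

lemma borel_measurable_cis [measurable (raw)]:
  "f \<in> borel_measurable M \<Longrightarrow> (\<lambda>x. cis (f x)) \<in> borel_measurable M"
  by (rule borel_measurable_continuous_on[of cis]) (intro continuous_intros)

lemma borel_measurable_cnj [measurable (raw)]:
  "f \<in> borel_measurable M \<Longrightarrow> (\<lambda>x. cnj (f x)) \<in> borel_measurable M"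
  by (rule borel_measurable_continuous_on[of cnj]) (intro continuous_intros)

lemma power2_norm_eq_sum_Basis: "(norm x)\<^sup>2 = (\<Sum>b\<in>Basis. (x \<bullet> b)\<^sup>2)"
  for x :: "'a::euclidean_space"
  by (subst power2_norm_eq_inner, subst euclidean_inner) (simp add: power2_eq_square)

lemma std_normal_density_cis:
  "integrable lborel (\<lambda>x. of_real (std_normal_density x) * cis (t * x))"
  "(\<integral>x. of_real (std_normal_density x) * cis (t * x) \<partial>lborel) = complex_of_real (exp (- t\<^sup>2 / 2))"
proof -
  show "integrable lborel (\<lambda>x. of_real (std_normal_density x) * cis (t * x))"
    by (rule Bochner_Integration.integrable_bound[of _ std_normal_density]) (auto simp: norm_mult)
  have "char std_normal_distribution t = (\<integral>x. of_real (std_normal_density x) * cis (t * x) \<partial>lborel)"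
    unfolding char_def
    by (subst integral_density) (auto simp: normal_density_nonneg scaleR_conv_of_real cis_conv_exp)
  then show "(\<integral>x. of_real (std_normal_density x) * cis (t * x) \<partial>lborel) = complex_of_real (exp (- t\<^sup>2 / 2))"
    by (simp add: char_std_normal_distribution)
qed

text \<open>The Fourier transform, with \<open>2 * pi\<close> in the phase, of the Gaussian
  \<open>exp (- (r * norm x)\<^sup>2 / 2)\<close>: a density of mass 1 that concentrates at 0 as
  \<open>r\<close> tends to 0.\<close>

definition gauss_kernel :: "real \<Rightarrow> 'a::euclidean_space \<Rightarrow> real" where
  "gauss_kernel r v = (sqrt (2 * pi) / r) ^ DIM('a) * exp (- (2 * pi * norm v / r)\<^sup>2 / 2)"

lemma gauss_kernel_measurable [measurable]: "gauss_kernel r \<in> borel_measurable borel"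
  unfolding gauss_kernel_def by measurable

lemma gauss_kernel_nonneg [simp]: "r > 0 \<Longrightarrow> gauss_kernel r v \<ge> 0"
  unfolding gauss_kernel_def by simp

lemma gauss_kernel_minus: "gauss_kernel r (x - y) = gauss_kernel r (y - x)"
  unfolding gauss_kernel_def by (simp add: norm_minus_commute)

lemma prod_std_normal_density:
  "(\<Prod>b\<in>Basis. std_normal_density (x \<bullet> b)) = (1 / sqrt (2 * pi)) ^ DIM('a) * exp (- (norm x)\<^sup>2 / 2)"
  for x :: "'a::euclidean_space"
  unfolding power2_norm_eq_sum_Basis
  by (simp add: std_normal_density_def prod.distrib exp_sum[symmetric] sum_negf sum_divide_distrib power_divide prod_dividef)

text \<open>The integrand splits over the coordinates into characteristic functions of the standard
  normal law; \<open>sqrt (2 * pi) ^ DIM('a)\<close> undoes the normalization of the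
  densities.\<close>

lemma gaussian_fourier:
  fixes v :: "'a::euclidean_space"
  shows "integrable lborel (\<lambda>x::'a. of_real (exp (- (norm x)\<^sup>2 / 2)) * cis (x \<bullet> v))"
   "(\<integral>x. of_real (exp (- (norm x)\<^sup>2 / 2)) * cis (x \<bullet> v) \<partial>lborel) =
     complex_of_real (sqrt (2 * pi) ^ DIM('a) * exp (- (norm v)\<^sup>2 / 2))"
proof -
  have cp: "cis (x \<bullet> v) = (\<Prod>b\<in>Basis. cis ((v \<bullet> b) * (x \<bullet> b)))" for x :: 'a
  proof -
    have "(\<Prod>b\<in>A. cis (g b)) = cis (\<Sum>b\<in>A. g b)" if "finite A" for A :: "'a set" and g
      using that by induction (auto simp: cis_mult)
    then show ?thesis
      by (subst euclidean_inner[of x v]) (simp add: mult.commute)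
  qed
  have e: "complex_of_real (exp (- (norm x)\<^sup>2 / 2)) * cis (x \<bullet> v) = 
     of_real (sqrt (2 * pi) ^ DIM('a)) * (\<Prod>b\<in>Basis. of_real (std_normal_density (x \<bullet> b)) * cis ((v \<bullet> b) * (x \<bullet> b)))" for x :: 'a
    unfolding prod.distrib cp of_real_prod[symmetric] prod_std_normal_density
    by (simp add: power_divide)
  note I = integral_lborel_prod[of "\<lambda>b x. of_real (std_normal_density x) * cis ((v \<bullet> b) * x)", OF std_normal_density_cis(1)]
  show "integrable lborel (\<lambda>x::'a. of_real (exp (- (norm x)\<^sup>2 / 2)) * cis (x \<bullet> v))"
    unfolding e using I(1) by (rule integrable_mult_right)
  show "(\<integral>x. of_real (exp (- (norm x)\<^sup>2 / 2)) * cis (x \<bullet> v) \<partial>lborel) =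
     complex_of_real (sqrt (2 * pi) ^ DIM('a) * exp (- (norm v)\<^sup>2 / 2))"
    unfolding e integral_mult_right_zero I(2) power2_norm_eq_sum_Basis[of v]
    by (simp add: std_normal_density_cis(2) of_real_prod[symmetric] exp_sum[symmetric] sum_negf sum_divide_distrib del: of_real_prod)
qed

lemma gauss_kernel_fourier:
  fixes v :: "'a::euclidean_space"
  assumes "r > 0"
  shows "integrable lborel (\<lambda>x::'a. of_real (exp (- (r * norm x)\<^sup>2 / 2)) * cis (2 * pi * (x \<bullet> v)))"
   "(\<integral>x. of_real (exp (- (r * norm x)\<^sup>2 / 2)) * cis (2 * pi * (x \<bullet> v)) \<partial>lborel) = complex_of_real (gauss_kernel r v)"
proof -
  define f where "f = (\<lambda>x::'a. of_real (exp (- (norm x)\<^sup>2 / 2)) * cis (x \<bullet> ((2 * pi / r) *\<^sub>R v)))"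
  have e: "f (0 + r *\<^sub>R x) = of_real (exp (- (r * norm x)\<^sup>2 / 2)) * cis (2 * pi * (x \<bullet> v))" for x
    using assms by (simp add: f_def mult.assoc)
  have fI: "integrable lborel f" and fE: "integral\<^sup>L lborel f = complex_of_real (sqrt (2 * pi) ^ DIM('a) * exp (- (norm ((2 * pi / r) *\<^sub>R v))\<^sup>2 / 2))"
    unfolding f_def by (rule gaussian_fourier)+
  show "integrable lborel (\<lambda>x::'a. of_real (exp (- (r * norm x)\<^sup>2 / 2)) * cis (2 * pi * (x \<bullet> v)))"
    using integrable_lborel_affine[OF fI, of r 0] assms unfolding e by simp
  have "integral\<^sup>L lborel f = (\<bar>r\<bar> ^ DIM('a)) *\<^sub>R (\<integral>x. f (0 + r *\<^sub>R x) \<partial>lborel)"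
    by (rule integral_lborel_affine) (use assms fI in auto)
  then have "(\<bar>r\<bar> ^ DIM('a)) *\<^sub>R (\<integral>x. f (0 + r *\<^sub>R x) \<partial>lborel) = (\<bar>r\<bar> ^ DIM('a)) *\<^sub>R complex_of_real (gauss_kernel r v)"
    using assms unfolding fE
    by (simp add: gauss_kernel_def power_divide scaleR_conv_of_real)
  then show "(\<integral>x. of_real (exp (- (r * norm x)\<^sup>2 / 2)) * cis (2 * pi * (x \<bullet> v)) \<partial>lborel) = complex_of_real (gauss_kernel r v)"
    unfolding e using assms by simp
qed

lemma gauss_weight_integrable:
  assumes "r > 0"
  shows "integrable lborel (\<lambda>x::'a::euclidean_space. exp (- (r * norm x)\<^sup>2 / 2))"
  using gauss_kernel_fourier(1)[OF assms, of "0::'a"] by (simp add: complex_of_real_integrable_eq)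

lemma gauss_kernel_scale:
  assumes "r > 0"
  shows "r ^ DIM('a) * gauss_kernel r (r *\<^sub>R v) = gauss_kernel 1 (v::'a::euclidean_space)"
  using assms by (simp add: gauss_kernel_def power_divide power_mult_distrib)

lemma gauss_kernel_integrable:
  assumes "r > 0"
  shows "integrable lborel (gauss_kernel r :: 'a::euclidean_space \<Rightarrow> real)"
  using gauss_weight_integrable[of "2 * pi / r", where 'a='a] assms
  unfolding gauss_kernel_def by simp

text \<open>The kernel is itself a Gaussian, with \<open>2 * pi / r\<close> in place of
  \<open>r\<close>, so its mass is given by the transform formula at the origin.\<close>

lemma gauss_kernel_integral:
  assumes "r > 0"
  shows "(\<integral>v. gauss_kernel r (v::'a::euclidean_space) \<partial>lborel) = 1"
proof -
  let ?r = "2 * pi / r"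
  have "complex_of_real (\<integral>v. gauss_kernel r (v::'a) \<partial>lborel) = of_real (sqrt (2 * pi) / r) ^ DIM('a) *
    (\<integral>x. of_real (exp (- (?r * norm (x::'a))\<^sup>2 / 2)) * cis (2 * pi * (x \<bullet> 0)) \<partial>lborel)"
    unfolding gauss_kernel_def
    by (simp add: integral_complex_of_real[symmetric] del: integral_complex_of_real)
  also have "\<dots> = of_real ((sqrt (2 * pi) / r) ^ DIM('a) * gauss_kernel ?r (0::'a))"
    by (subst gauss_kernel_fourier(2)) (use assms in auto)
  also have "(sqrt (2 * pi) / r) ^ DIM('a) * gauss_kernel ?r (0::'a) = 1"
    using assms by (simp add: gauss_kernel_def power_mult_distrib[symmetric] power_divide[symmetric])
  finally show ?thesis by simp
qed

lemma gauss_kernel_nn_integral: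
  assumes "r > 0"
  shows "(\<integral>\<^sup>+v. ennreal (gauss_kernel r (v::'a::euclidean_space)) \<partial>lborel) = 1"
  using gauss_kernel_integral[OF assms] gauss_kernel_integrable[OF assms] assms
  by (subst nn_integral_eq_integral) auto

lemma gauss_kernel_nn_integral_shift:
  assumes "r > 0"
  shows "(\<integral>\<^sup>+v. ennreal (gauss_kernel r (a - (v::'a::euclidean_space))) \<partial>lborel) = 1"
proof -
  have "(\<integral>\<^sup>+v. ennreal (gauss_kernel r (v::'a)) \<partial>lborel) = 
     ennreal (\<bar>-1\<bar> ^ DIM('a)) * (\<integral>\<^sup>+v. ennreal (gauss_kernel r (a + (-1) *\<^sub>R (v::'a))) \<partial>lborel)"
    by (rule nn_integral_lborel_affine) auto
  then show ?thesis using gauss_kernel_nn_integral[OF assms, where 'a='a] by simp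
qed

subsection \<open>Plancherel bounds\<close>

lemma (in pair_sigma_finite) integrable_pair_mult:
  fixes f g :: "_ \<Rightarrow> complex"
  assumes f: "integrable M1 f" and g: "integrable M2 g"
  shows "integrable (M1 \<Otimes>\<^sub>M M2) (\<lambda>p. f (fst p) * g (snd p))"
proof (rule Fubini_integrable)
  have [measurable]: "f \<in> borel_measurable M1" "g \<in> borel_measurable M2"
    using f g by auto
  show "(\<lambda>p. f (fst p) * g (snd p)) \<in> borel_measurable (M1 \<Otimes>\<^sub>M M2)"
    by measurable
qed (use f g in \<open>auto simp: norm_mult\<close>)

text \<open>Schur's test for the adjoint restriction operator \<open>K \<mapsto> \<integral> K(\<xi>) e(x \<bullet> L \<xi>) d\<xi>\<close>. The Gaussian
  weight \<open>exp (- (r |x|)\<^sup>2 / 2)\<close> makes the \<open>x\<close>-integral of the squared modulus absolutely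
  convergent; integrating in \<open>x\<close> first leaves the kernel \<open>gauss_kernel r (L \<xi> - L \<zeta>)\<close>.\<close>

lemma weighted_L2_le:
  fixes L :: "'b::euclidean_space \<Rightarrow> 'a::euclidean_space" and K :: "'b \<Rightarrow> complex"
    and \<Phi> w :: "'b \<Rightarrow> real"
  assumes [measurable]: "L \<in> borel_measurable borel" "\<Phi> \<in> borel_measurable borel" "w \<in> borel_measurable borel"
    and K: "integrable lborel K"
    and bound: "\<And>\<xi>. norm (K \<xi>) \<le> \<Phi> \<xi> * w \<xi>"
    and B: "\<And>\<eta>. (\<integral>\<^sup>+\<zeta>. ennreal ((w \<zeta>)\<^sup>2 * gauss_kernel r (\<eta> - L \<zeta>)) \<partial>lborel) \<le> B"
    and r: "r > 0"
  shows "(\<integral>\<^sup>+x. ennreal ((norm (\<integral>\<xi>. K \<xi> * cis (2 * pi * (x \<bullet> L \<xi>)) \<partial>lborel))\<^sup>2 * exp (- (r * norm x)\<^sup>2 / 2)) \<partial>lborel)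
     \<le> B * (\<integral>\<^sup>+\<xi>. ennreal ((\<Phi> \<xi>)\<^sup>2) \<partial>lborel)"
proof -
  have [measurable]: "K \<in> borel_measurable borel" using K by auto
  define P :: "('b \<times> 'b) measure" where "P = lborel \<Otimes>\<^sub>M lborel"
  define k where "k p = K (fst p) * cnj (K (snd p))" for p
  define D where "D p = L (fst p) - L (snd p)" for p
  define g where "g x = (\<integral>\<xi>. K \<xi> * cis (2 * pi * (x \<bullet> L \<xi>)) \<partial>lborel)" for x
  define E where "E x = exp (- (r * norm x)\<^sup>2 / 2)" for x :: 'a
  have [measurable]: "k \<in> borel_measurable P"
    unfolding k_def P_def by measurable
  have [measurable]: "D \<in> P \<rightarrow>\<^sub>M borel"
    unfolding D_def P_def by measurable
  have [measurable]: "E \<in> borel_measurable borel"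
    unfolding E_def by measurable
  interpret P: sigma_finite_measure P
    unfolding P_def lborel_prod by (rule sigma_finite_lborel)
  interpret LP: pair_sigma_finite "lborel :: 'a measure" P ..
  have kI: "integrable P k"
    unfolding P_def k_def by (rule lborel_pair.integrable_pair_mult) (use K in auto)
  have cisI: "integrable lborel (\<lambda>\<xi>. K \<xi> * cis (2 * pi * (x \<bullet> L \<xi>)))" for x
    by (rule Bochner_Integration.integrable_bound[OF K]) (auto simp: norm_mult)
  \<comment> \<open>The squared modulus is a double integral over pairs of frequencies. The two
    phases merge into a single phase linear in \<open>x\<close>, against which the Gaussian can be
    integrated explicitly.\<close>
  have kc: "(\<integral>p. k p * cis (2 * pi * (x \<bullet> D p)) \<partial>P) = of_real ((norm (g x))\<^sup>2)" for x
  proof -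
    have e: "k p * cis (2 * pi * (x \<bullet> D p)) =
      (K (fst p) * cis (2 * pi * (x \<bullet> L (fst p)))) * cnj (K (snd p) * cis (2 * pi * (x \<bullet> L (snd p))))" for p
    proof -
      have "cis (2 * pi * (x \<bullet> D p)) = cis (2 * pi * (x \<bullet> L (fst p))) * cis (- (2 * pi * (x \<bullet> L (snd p))))"
        unfolding cis_mult by (simp add: D_def inner_diff_right right_diff_distrib)
      then show ?thesis by (simp add: k_def cis_cnj)
    qed
    have "integral\<^sup>L P (\<lambda>p. k p * cis (2 * pi * (x \<bullet> D p))) =
       (\<integral>\<xi>. \<integral>\<zeta>. (K \<xi> * cis (2 * pi * (x \<bullet> L \<xi>))) * cnj (K \<zeta> * cis (2 * pi * (x \<bullet> L \<zeta>))) \<partial>lborel \<partial>lborel)"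
      unfolding e P_def
      using lborel_pair.integral_fst'[OF lborel_pair.integrable_pair_mult[OF cisI[of x] integrable_cnj[OF cisI[of x]]]] by simp
    also have "\<dots> = g x * cnj (g x)"
      by (simp add: g_def del: complex_cnj_mult)
    finally show ?thesis unfolding complex_norm_square .
  qed
  have EI: "integrable lborel (\<lambda>x. complex_of_real (E x))"
    using gauss_weight_integrable[OF r, where 'a='a] by (simp add: E_def)
  have TI: "integrable (lborel \<Otimes>\<^sub>M P) (\<lambda>(x, p). of_real (E x) * (k p * cis (2 * pi * (x \<bullet> D p))))"
    by (rule Bochner_Integration.integrable_bound[OF LP.integrable_pair_mult[OF EI kI]])
       (auto simp: norm_mult)
  have gx: "(\<lambda>x. \<integral>p. of_real (E x) * (k p * cis (2 * pi * (x \<bullet> D p))) \<partial>P) = (\<lambda>x. complex_of_real ((norm (g x))\<^sup>2 * E x))"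
    unfolding integral_mult_right_zero kc by (simp add: mult.commute)
  have px: "(\<lambda>p. \<integral>x. of_real (E x) * (k p * cis (2 * pi * (x \<bullet> D p))) \<partial>lborel) = (\<lambda>p. k p * of_real (gauss_kernel r (D p)))"
  proof
    fix p
    have "(\<integral>x. of_real (E x) * (k p * cis (2 * pi * (x \<bullet> D p))) \<partial>lborel) =
      (\<integral>x. k p * (of_real (E x) * cis (2 * pi * (x \<bullet> D p))) \<partial>lborel)"
      by (simp add: mult_ac)
    also have "\<dots> = k p * (\<integral>x. of_real (E x) * cis (2 * pi * (x \<bullet> D p)) \<partial>lborel)"
      by (rule integral_mult_right_zero)
    also have "\<dots> = k p * of_real (gauss_kernel r (D p))"
      unfolding E_def by (subst gauss_kernel_fourier(2)[OF r]) simp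
    finally show "(\<integral>x. of_real (E x) * (k p * cis (2 * pi * (x \<bullet> D p))) \<partial>lborel) = k p * of_real (gauss_kernel r (D p))" .
  qed
  have kgI: "integrable P (\<lambda>p. k p * of_real (gauss_kernel r (D p)))"
    unfolding px[symmetric] by (rule LP.integrable_snd[OF TI])
  have "(\<integral>x. \<integral>p. of_real (E x) * (k p * cis (2 * pi * (x \<bullet> D p))) \<partial>P \<partial>lborel) =
        (\<integral>p. \<integral>x. of_real (E x) * (k p * cis (2 * pi * (x \<bullet> D p))) \<partial>lborel \<partial>P)"
    by (rule LP.Fubini_integral[OF TI, symmetric])
  also note gx
  also note px
  finally have main: "complex_of_real (\<integral>x. (norm (g x))\<^sup>2 * E x \<partial>lborel) = (\<integral>p. k p * of_real (gauss_kernel r (D p)) \<partial>P)"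
    unfolding integral_complex_of_real .
  have "integrable lborel (\<lambda>x. \<integral>p. of_real (E x) * (k p * cis (2 * pi * (x \<bullet> D p))) \<partial>P)"
    by (rule LP.integrable_fst[OF TI])
  then have gI: "integrable lborel (\<lambda>x. (norm (g x))\<^sup>2 * E x)"
    unfolding gx complex_of_real_integrable_eq .
  have [measurable]: "(\<lambda>p. gauss_kernel r (D p)) \<in> borel_measurable P" by measurable
  have "(\<integral>\<^sup>+x. ennreal ((norm (g x))\<^sup>2 * E x) \<partial>lborel) = ennreal (\<integral>x. (norm (g x))\<^sup>2 * E x \<partial>lborel)"
    by (rule nn_integral_eq_integral[OF gI]) (auto simp: E_def)
  also have "\<dots> \<le> ennreal (norm (complex_of_real (\<integral>x. (norm (g x))\<^sup>2 * E x \<partial>lborel)))"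
    by (rule ennreal_leI) simp
  also have "\<dots> \<le> (\<integral>\<^sup>+p. norm (k p * of_real (gauss_kernel r (D p))) \<partial>P)"
    unfolding main by (rule integral_norm_bound_ennreal[OF kgI])
  also have "\<dots> \<le> (\<integral>\<^sup>+p. (\<lambda>(\<xi>,\<zeta>). ennreal (1/2) * (ennreal ((\<Phi> \<xi>)\<^sup>2) * ennreal ((w \<zeta>)\<^sup>2 * gauss_kernel r (L \<xi> - L \<zeta>)))
       + ennreal (1/2) * (ennreal ((\<Phi> \<zeta>)\<^sup>2) * ennreal ((w \<xi>)\<^sup>2 * gauss_kernel r (L \<zeta> - L \<xi>)))) p \<partial>P)"
  proof (intro nn_integral_mono, simp only: split_paired_all prod.case)
    fix \<xi> \<zeta> :: 'b
    let ?G = "gauss_kernel r (L \<xi> - L \<zeta>)"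
    have G: "?G \<ge> 0" using r by simp
    have half: "ennreal (1/2 * (a * b)) = ennreal (1/2) * (ennreal a * ennreal b)" if "0 \<le> a" "0 \<le> b" for a b
      using that by (subst ennreal_mult; (subst ennreal_mult)?) auto
    have "norm (K \<xi>) * norm (K \<zeta>) \<le> (\<Phi> \<xi> * w \<xi>) * (\<Phi> \<zeta> * w \<zeta>)"
      using bound[of \<xi>] bound[of \<zeta>] by (intro mult_mono) (auto intro: order_trans[OF norm_ge_zero])
    \<comment> \<open>The weights are exchanged before the arithmetic-geometric mean inequality, so
      that each resulting term has \<open>\<Phi>\<close> in one variable and \<open>w\<close> in the
      other; the integral of the latter against the kernel is what \<open>B\<close> bounds.\<close>
    also have "\<dots> = (\<Phi> \<xi> * w \<zeta>) * (\<Phi> \<zeta> * w \<xi>)" by simp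
    also have "\<dots> \<le> 1/2 * ((\<Phi> \<xi> * w \<zeta>)\<^sup>2 + (\<Phi> \<zeta> * w \<xi>)\<^sup>2)"
      using sum_squares_bound[of "\<Phi> \<xi> * w \<zeta>" "\<Phi> \<zeta> * w \<xi>"] by simp
    finally have "norm (K \<xi>) * norm (K \<zeta>) * ?G \<le> 1/2 * ((\<Phi> \<xi> * w \<zeta>)\<^sup>2 + (\<Phi> \<zeta> * w \<xi>)\<^sup>2) * ?G"
      using G by (rule mult_right_mono)
    then have "norm (k (\<xi>, \<zeta>) * of_real (gauss_kernel r (D (\<xi>, \<zeta>)))) \<le>
      1/2 * ((\<Phi> \<xi>)\<^sup>2 * ((w \<zeta>)\<^sup>2 * ?G)) + 1/2 * ((\<Phi> \<zeta>)\<^sup>2 * ((w \<xi>)\<^sup>2 * ?G))"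
      using G by (simp add: k_def D_def norm_mult power_mult_distrib algebra_simps)
    then have "ennreal (norm (k (\<xi>, \<zeta>) * of_real (gauss_kernel r (D (\<xi>, \<zeta>))))) \<le>
        ennreal (1/2 * ((\<Phi> \<xi>)\<^sup>2 * ((w \<zeta>)\<^sup>2 * ?G)) + 1/2 * ((\<Phi> \<zeta>)\<^sup>2 * ((w \<xi>)\<^sup>2 * ?G)))"
      by (rule ennreal_leI)
    also have "\<dots> = ennreal (1/2 * ((\<Phi> \<xi>)\<^sup>2 * ((w \<zeta>)\<^sup>2 * ?G))) + ennreal (1/2 * ((\<Phi> \<zeta>)\<^sup>2 * ((w \<xi>)\<^sup>2 * ?G)))"
      using G by (intro ennreal_plus) auto
    also have "\<dots> = ennreal (1/2) * (ennreal ((\<Phi> \<xi>)\<^sup>2) * ennreal ((w \<zeta>)\<^sup>2 * ?G)) + ennreal (1/2) * (ennreal ((\<Phi> \<zeta>)\<^sup>2) * ennreal ((w \<xi>)\<^sup>2 * ?G))"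
      using G by (simp only: half zero_le_power2 mult_nonneg_nonneg)
    finally show "ennreal (norm (k (\<xi>, \<zeta>) * of_real (gauss_kernel r (D (\<xi>, \<zeta>))))) \<le>
       ennreal (1/2) * (ennreal ((\<Phi> \<xi>)\<^sup>2) * ennreal ((w \<zeta>)\<^sup>2 * gauss_kernel r (L \<xi> - L \<zeta>)))
       + ennreal (1/2) * (ennreal ((\<Phi> \<zeta>)\<^sup>2) * ennreal ((w \<xi>)\<^sup>2 * gauss_kernel r (L \<zeta> - L \<xi>)))"
      unfolding gauss_kernel_minus[of r "L \<zeta>" "L \<xi>"] .
  qed
  also have "\<dots> = (\<integral>\<^sup>+\<xi>. \<integral>\<^sup>+\<zeta>. ennreal (1/2) * (ennreal ((\<Phi> \<xi>)\<^sup>2) * ennreal ((w \<zeta>)\<^sup>2 * gauss_kernel r (L \<xi> - L \<zeta>))) \<partial>lborel \<partial>lborel)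
       + (\<integral>\<^sup>+\<xi>. \<integral>\<^sup>+\<zeta>. ennreal (1/2) * (ennreal ((\<Phi> \<zeta>)\<^sup>2) * ennreal ((w \<xi>)\<^sup>2 * gauss_kernel r (L \<zeta> - L \<xi>))) \<partial>lborel \<partial>lborel)"
    unfolding P_def
    by (subst lborel.nn_integral_fst[symmetric]) (simp_all add: nn_integral_add)
  also have "(\<integral>\<^sup>+\<xi>. \<integral>\<^sup>+\<zeta>. ennreal (1/2) * (ennreal ((\<Phi> \<zeta>)\<^sup>2) * ennreal ((w \<xi>)\<^sup>2 * gauss_kernel r (L \<zeta> - L \<xi>))) \<partial>lborel \<partial>lborel)
     = (\<integral>\<^sup>+\<xi>. \<integral>\<^sup>+\<zeta>. ennreal (1/2) * (ennreal ((\<Phi> \<xi>)\<^sup>2) * ennreal ((w \<zeta>)\<^sup>2 * gauss_kernel r (L \<xi> - L \<zeta>))) \<partial>lborel \<partial>lborel)"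
    by (rule lborel_pair.Fubini') measurable
  also have "(\<integral>\<^sup>+\<xi>. \<integral>\<^sup>+\<zeta>. ennreal (1/2) * (ennreal ((\<Phi> \<xi>)\<^sup>2) * ennreal ((w \<zeta>)\<^sup>2 * gauss_kernel r (L \<xi> - L \<zeta>))) \<partial>lborel \<partial>lborel)
      \<le> (\<integral>\<^sup>+\<xi>. ennreal (1/2) * (ennreal ((\<Phi> \<xi>)\<^sup>2) * B) \<partial>lborel)"
    by (intro nn_integral_mono) (auto simp: nn_integral_cmult intro!: mult_left_mono B)
  also have "(\<integral>\<^sup>+\<xi>. ennreal (1/2) * (ennreal ((\<Phi> \<xi>)\<^sup>2) * B) \<partial>lborel) = ennreal (1/2) * (B * (\<integral>\<^sup>+\<xi>. ennreal ((\<Phi> \<xi>)\<^sup>2) \<partial>lborel))"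
    by (simp add: nn_integral_cmult nn_integral_multc mult.commute)
  finally have "(\<integral>\<^sup>+x. ennreal ((norm (g x))\<^sup>2 * E x) \<partial>lborel) \<le>
     ennreal (1/2) * (B * (\<integral>\<^sup>+\<xi>. ennreal ((\<Phi> \<xi>)\<^sup>2) \<partial>lborel)) + ennreal (1/2) * (B * (\<integral>\<^sup>+\<xi>. ennreal ((\<Phi> \<xi>)\<^sup>2) \<partial>lborel))"
    by (meson add_mono order_trans order_refl)
  also have "\<dots> = (ennreal (1/2) + ennreal (1/2)) * (B * (\<integral>\<^sup>+\<xi>. ennreal ((\<Phi> \<xi>)\<^sup>2) \<partial>lborel))"
    by (simp add: distrib_right)
  also have "ennreal (1/2) + ennreal (1/2) = 1"
    by (subst ennreal_plus[symmetric]) auto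
  finally show ?thesis by (simp add: g_def E_def)
qed

text \<open>Fatou's lemma along \<open>r = 1 / Suc n\<close> removes the Gaussian weight from
  \<open>weighted_L2_le\<close>; this is why \<open>B\<close> has to be uniform in
  \<open>r\<close>.\<close>

lemma L2_le:
  fixes L :: "'b::euclidean_space \<Rightarrow> 'a::euclidean_space" and K :: "'b \<Rightarrow> complex"
    and \<Phi> w :: "'b \<Rightarrow> real"
  assumes [measurable]: "L \<in> borel_measurable borel" "\<Phi> \<in> borel_measurable borel" "w \<in> borel_measurable borel"
    and K: "integrable lborel K"
    and bound: "\<And>\<xi>. norm (K \<xi>) \<le> \<Phi> \<xi> * w \<xi>"
    and B: "\<And>r \<eta>. r > 0 \<Longrightarrow> (\<integral>\<^sup>+\<zeta>. ennreal ((w \<zeta>)\<^sup>2 * gauss_kernel r (\<eta> - L \<zeta>)) \<partial>lborel) \<le> B"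
  shows "(\<integral>\<^sup>+x. ennreal ((norm (\<integral>\<xi>. K \<xi> * cis (2 * pi * (x \<bullet> L \<xi>)) \<partial>lborel))\<^sup>2) \<partial>lborel)
     \<le> B * (\<integral>\<^sup>+\<xi>. ennreal ((\<Phi> \<xi>)\<^sup>2) \<partial>lborel)"
proof -
  have [measurable]: "K \<in> borel_measurable borel" using K by auto
  define g where "g x = (\<integral>\<xi>. K \<xi> * cis (2 * pi * (x \<bullet> L \<xi>)) \<partial>lborel)" for x
  have [measurable]: "g \<in> borel_measurable borel" unfolding g_def by measurable
  let ?r = "\<lambda>n. inverse (real (Suc n))"
  let ?h = "\<lambda>n x. ennreal ((norm (g x))\<^sup>2 * exp (- (?r n * norm x)\<^sup>2 / 2))"
  have "(\<lambda>n. (norm (g x))\<^sup>2 * exp (- (?r n * norm x)\<^sup>2 / 2)) \<longlonglongrightarrow> (norm (g x))\<^sup>2 * exp (- (0 * norm x)\<^sup>2 / 2)" for x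
    by (intro tendsto_intros LIMSEQ_inverse_real_of_nat) auto
  then have h: "(\<lambda>n. ?h n x) \<longlonglongrightarrow> ennreal ((norm (g x))\<^sup>2)" for x
    by (intro tendsto_ennrealI) simp
  have "(\<integral>\<^sup>+x. ennreal ((norm (g x))\<^sup>2) \<partial>lborel) = (\<integral>\<^sup>+x. liminf (\<lambda>n. ?h n x) \<partial>lborel)"
    by (intro nn_integral_cong) (simp only: lim_imp_Liminf[OF trivial_limit_sequentially h])
  also have "\<dots> \<le> liminf (\<lambda>n. \<integral>\<^sup>+x. ?h n x \<partial>lborel)"
    by (rule nn_integral_liminf) measurable
  also have "\<dots> \<le> liminf (\<lambda>n. B * (\<integral>\<^sup>+\<xi>. ennreal ((\<Phi> \<xi>)\<^sup>2) \<partial>lborel))"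
    unfolding g_def
    by (intro Liminf_mono always_eventually allI weighted_L2_le[where w=w] K bound B) auto
  finally show ?thesis by (simp add: g_def Liminf_const)
qed

definition fourier :: "('a::euclidean_space \<Rightarrow> complex) \<Rightarrow> 'a \<Rightarrow> complex" where
  "fourier f \<xi> = (\<integral>x. f x * cis (- 2 * pi * (x \<bullet> \<xi>)) \<partial>lborel)"

lemma fourier_measurable [measurable]:
  assumes [measurable]: "f \<in> borel_measurable borel"
  shows "fourier f \<in> borel_measurable borel"
  unfolding fourier_def by measurable

lemma norm_fourier_le:
  "norm (fourier f \<xi>) \<le> (\<integral>x. norm (f x) \<partial>lborel)"
  unfolding fourier_def using integral_norm_bound[of lborel "\<lambda>x. f x * cis (- 2 * pi * (x \<bullet> \<xi>))"]
  by (simp add: norm_mult)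

text \<open>The inequality half of Plancherel's theorem: \<open>L2_le\<close> with
  \<open>L = uminus\<close> and \<open>w = 1\<close>, where \<open>B = 1\<close> is the mass of the
  kernel.\<close>

lemma fourier_L2_le:
  fixes f :: "'a::euclidean_space \<Rightarrow> complex"
  assumes "integrable lborel f"
  shows "(\<integral>\<^sup>+\<xi>. ennreal ((norm (fourier f \<xi>))\<^sup>2) \<partial>lborel) \<le> (\<integral>\<^sup>+x. ennreal ((norm (f x))\<^sup>2) \<partial>lborel)"
proof -
  have [measurable]: "f \<in> borel_measurable borel" using assms by auto
  have e: "fourier f \<xi> = (\<integral>x. f x * cis (2 * pi * (\<xi> \<bullet> (- x))) \<partial>lborel)" for \<xi>
    unfolding fourier_def by (simp add: inner_commute)
  have "(\<integral>\<^sup>+\<zeta>. ennreal (1\<^sup>2 * gauss_kernel r (\<eta> - - (\<zeta>::'a))) \<partial>lborel) \<le> 1" if "r > 0" for r and \<eta> :: 'a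
    using nn_integral_lborel_affine[of "gauss_kernel r" 1 \<eta>] gauss_kernel_nn_integral[OF that, where 'a='a] by simp
  then show ?thesis unfolding e
    using L2_le[of uminus "\<lambda>x. norm (f x)" "\<lambda>_. 1" f 1] assms by simp
qed

subsection \<open>Gaussian regularization and dyadic frequency pieces\<close>

text \<open>The Fourier inversion integral with Gaussian damping, which converges for every
  integrable \<open>f\<close>.\<close>

definition gauss_smooth :: "real \<Rightarrow> ('a::euclidean_space \<Rightarrow> complex) \<Rightarrow> 'a \<Rightarrow> complex" where
  "gauss_smooth r f z = (\<integral>\<xi>. fourier f \<xi> * of_real (exp (- (r * norm \<xi>)\<^sup>2 / 2)) * cis (2 * pi * (z \<bullet> \<xi>)) \<partial>lborel)"

lemma integrable_fourier_gauss:
  fixes f :: "'a::euclidean_space \<Rightarrow> complex"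
  assumes f: "integrable lborel f" and "r > 0"
  shows "integrable lborel (\<lambda>\<xi>. fourier f \<xi> * of_real (exp (- (r * norm \<xi>)\<^sup>2 / 2)))"
proof -
  have [measurable]: "f \<in> borel_measurable borel" using f by auto
  show ?thesis
  proof (rule Bochner_Integration.integrable_bound)
    show "integrable lborel (\<lambda>\<xi>::'a. (\<integral>x. norm (f x) \<partial>lborel) * exp (- (r * norm \<xi>)\<^sup>2 / 2))"
      using gauss_weight_integrable[OF \<open>r > 0\<close>, where 'a='a] by simp
  qed (auto simp: norm_mult intro!: mult_right_mono order_trans[OF norm_fourier_le])
qed

text \<open>By Fubini the damped inversion integral is a convolution with
  \<open>gauss_kernel r\<close>. The substitution \<open>x = z - r v\<close> then moves the
  dependence on \<open>r\<close> from the kernel into the argument of \<open>f\<close>, the form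
  suited to dominated convergence.\<close>

lemma gauss_smooth_conv:
  fixes f :: "'a::euclidean_space \<Rightarrow> complex"
  assumes f: "integrable lborel f" and r: "r > 0"
  shows "gauss_smooth r f z = (\<integral>v. f (z - r *\<^sub>R v) * of_real (gauss_kernel 1 v) \<partial>lborel)"
proof -
  have [measurable]: "f \<in> borel_measurable borel" using f by auto
  define E where "E \<xi> = complex_of_real (exp (- (r * norm \<xi>)\<^sup>2 / 2))" for \<xi> :: 'a
  have [measurable]: "E \<in> borel_measurable borel"
    unfolding E_def by measurable
  have EI: "integrable lborel E"
    unfolding E_def complex_of_real_integrable_eq by (rule gauss_weight_integrable[OF r])
  have I: "integrable (lborel \<Otimes>\<^sub>M lborel) (\<lambda>(\<xi>, x). f x * cis (- 2 * pi * (x \<bullet> \<xi>)) * E \<xi> * cis (2 * pi * (z \<bullet> \<xi>)))"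
    by (rule Bochner_Integration.integrable_bound[OF lborel_pair.integrable_pair_mult[OF EI f]])
       (auto simp: norm_mult)
  have "gauss_smooth r f z = (\<integral>\<xi>. \<integral>x. f x * cis (- 2 * pi * (x \<bullet> \<xi>)) * E \<xi> * cis (2 * pi * (z \<bullet> \<xi>)) \<partial>lborel \<partial>lborel)"
    unfolding gauss_smooth_def fourier_def E_def[symmetric] integral_mult_left_zero ..
  also have "\<dots> = (\<integral>x. \<integral>\<xi>. f x * cis (- 2 * pi * (x \<bullet> \<xi>)) * E \<xi> * cis (2 * pi * (z \<bullet> \<xi>)) \<partial>lborel \<partial>lborel)"
    by (rule lborel_pair.Fubini_integral[OF I, symmetric])
  also have "\<dots> = (\<integral>x. f x * of_real (gauss_kernel r (z - x)) \<partial>lborel)"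
  proof (intro Bochner_Integration.integral_cong refl)
    fix x
    have c: "cis (- 2 * pi * (x \<bullet> \<xi>)) * cis (2 * pi * (z \<bullet> \<xi>)) = cis (2 * pi * (\<xi> \<bullet> (z - x)))" for \<xi>
      unfolding cis_mult by (simp add: inner_commute inner_diff_right right_diff_distrib)
    have "a * b * c * d = a * (c * (b * d))" for a b c d :: complex
      by (simp only: mult_ac)
    then have e: "f x * cis (- 2 * pi * (x \<bullet> \<xi>)) * E \<xi> * cis (2 * pi * (z \<bullet> \<xi>)) = f x * (E \<xi> * cis (2 * pi * (\<xi> \<bullet> (z - x))))" for \<xi>
      unfolding c[symmetric] by blast
    show "(\<integral>\<xi>. f x * cis (- 2 * pi * (x \<bullet> \<xi>)) * E \<xi> * cis (2 * pi * (z \<bullet> \<xi>)) \<partial>lborel) = f x * of_real (gauss_kernel r (z - x))"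
      unfolding e integral_mult_right_zero using gauss_kernel_fourier(2)[OF r, of "z - x"] by (simp add: E_def)
  qed
  also have "\<dots> = (\<bar>- r\<bar> ^ DIM('a)) *\<^sub>R (\<integral>v. f (z + (- r) *\<^sub>R v) * of_real (gauss_kernel r (z - (z + (- r) *\<^sub>R v))) \<partial>lborel)"
    by (rule integral_lborel_affine) (use r in auto)
  also have "\<dots> = (\<integral>v. f (z - r *\<^sub>R v) * of_real (r ^ DIM('a) * gauss_kernel r (r *\<^sub>R v)) \<partial>lborel)"
    unfolding integral_scaleR_right[symmetric] using r by (simp add: scaleR_conv_of_real mult_ac)
  finally show ?thesis
    by (simp only: gauss_kernel_scale[OF r])
qed

lemma norm_gauss_smooth_le:
  fixes f :: "'a::euclidean_space \<Rightarrow> complex"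
  assumes f: "integrable lborel f" and r: "r > 0" and M: "\<And>x. norm (f x) \<le> M"
  shows "norm (gauss_smooth r f z) \<le> M"
proof -
  have [measurable]: "f \<in> borel_measurable borel" using f by auto
  have "norm (gauss_smooth r f z) \<le> (\<integral>v. M * gauss_kernel 1 (v::'a) \<partial>lborel)"
    unfolding gauss_smooth_conv[OF f r]
    using gauss_kernel_integrable[of 1, where 'a='a]
    by (intro order_trans[OF integral_norm_bound] integral_mono') (auto simp: norm_mult intro!: mult_right_mono M mult_nonneg_nonneg order_trans[OF norm_ge_zero M])
  also have "\<dots> = M"
    by (simp add: gauss_kernel_integral)
  finally show ?thesis .
qed

lemma gauss_smooth_tendsto:
  fixes f :: "'a::euclidean_space \<Rightarrow> complex"
  assumes f: "integrable lborel f" and M: "\<And>x. norm (f x) \<le> M" and cont: "continuous_on UNIV f"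
    and r: "\<And>n. r n > 0" "r \<longlonglongrightarrow> 0"
  shows "(\<lambda>n. gauss_smooth (r n) f z) \<longlonglongrightarrow> f z"
proof -
  have [measurable]: "f \<in> borel_measurable borel" using f by auto
  have "(\<lambda>n. \<integral>v. f (z - r n *\<^sub>R v) * of_real (gauss_kernel 1 v) \<partial>lborel) \<longlonglongrightarrow> (\<integral>v. f z * of_real (gauss_kernel 1 (v::'a)) \<partial>lborel)"
  proof (rule integral_dominated_convergence)
    show "integrable lborel (\<lambda>v. M * gauss_kernel 1 (v::'a))"
      using gauss_kernel_integrable[of 1, where 'a='a] by simp
    show "AE v in lborel. (\<lambda>n. f (z - r n *\<^sub>R v) * of_real (gauss_kernel 1 v)) \<longlonglongrightarrow> f z * of_real (gauss_kernel 1 v)"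
    proof (intro AE_I2 tendsto_intros)
      fix v
      have "(\<lambda>n. z - r n *\<^sub>R v) \<longlonglongrightarrow> z - 0 *\<^sub>R v"
        by (intro tendsto_intros r)
      then have "(\<lambda>n. z - r n *\<^sub>R v) \<longlonglongrightarrow> z" by simp
      moreover have "isCont f z"
        using cont by (simp add: continuous_on_eq_continuous_at)
      ultimately show "(\<lambda>n. f (z - r n *\<^sub>R v)) \<longlonglongrightarrow> f z"
        using isCont_tendsto_compose by blast
    qed
  qed (auto simp: norm_mult intro!: mult_right_mono M)
  moreover have "(\<integral>v. f z * of_real (gauss_kernel 1 (v::'a)) \<partial>lborel) = f z"
    by (simp add: gauss_kernel_integral)
  ultimately show ?thesis
    by (simp add: gauss_smooth_conv[OF f r(1)] gauss_kernel_integral)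
qed

text \<open>A telescoping partition made of differences of Gaussians of widths \<open>2 ^ j\<close>
  and \<open>2 ^ (j - 1)\<close>. For \<open>j > 0\<close> the bump has a double zero at the origin;
  together with the Gaussian decay this stands in for localization to frequencies of size
  \<open>2 ^ j\<close>.\<close>

definition dyadic_bump :: "nat \<Rightarrow> 'a::real_normed_vector \<Rightarrow> real" where
  "dyadic_bump j \<xi> = exp (- ((1/2) ^ j * norm \<xi>)\<^sup>2 / 2) - (if j = 0 then 0 else exp (- ((1/2) ^ (j - 1) * norm \<xi>)\<^sup>2 / 2))"

lemma dyadic_bump_measurable [measurable]: "dyadic_bump j \<in> borel_measurable borel"
  unfolding dyadic_bump_def by measurable

lemma sum_dyadic_bump: "(\<Sum>j\<le>J. dyadic_bump j \<xi>) = exp (- ((1/2) ^ J * norm \<xi>)\<^sup>2 / 2)"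
  by (induction J) (simp_all add: dyadic_bump_def)

lemma dyadic_bump_nonneg: "0 \<le> dyadic_bump j \<xi>"
proof (cases j)
  case (Suc i)
  have "((1/2) ^ Suc i * norm \<xi>)\<^sup>2 \<le> ((1/2) ^ i * norm \<xi>)\<^sup>2"
    by (intro power_mono mult_right_mono) auto
  then show ?thesis using Suc by (simp add: dyadic_bump_def)
qed (simp add: dyadic_bump_def)

lemma dyadic_bump_le_exp: "dyadic_bump j \<xi> \<le> exp (- ((1/2) ^ j * norm \<xi>)\<^sup>2 / 2)"
  by (simp add: dyadic_bump_def)

text \<open>For \<open>j > 0\<close> the bump is at most \<open>1 - exp (- y\<^sup>2 / 2)\<close>,
  hence at most both 1 and \<open>y\<^sup>2\<close>, with
  \<open>y = 2 * (1/2) ^ j * norm \<xi>\<close>; this gives \<open>y powr \<alpha>\<close> for every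
  \<alpha> up to 2, and \<open>2 powr \<alpha> \<le> 4\<close>. It converts surplus decay of order
  \<alpha> in a multiplier into a small factor at scale \<open>j\<close>.\<close>

lemma dyadic_bump_le_powr:
  assumes "0 \<le> \<alpha>" "\<alpha> \<le> 2"
  shows "dyadic_bump j \<xi> \<le> 4 * ((1/2) ^ j) powr \<alpha> * (1 + norm \<xi>) powr \<alpha>"
proof (cases j)
  case 0
  have "1 \<le> (1 + norm \<xi>) powr \<alpha>"
    using assms by (intro ge_one_powr_ge_zero) auto
  moreover have "dyadic_bump j \<xi> \<le> 1"
    using dyadic_bump_le_exp[of 0 \<xi>] 0 by (auto intro: order_trans)
  ultimately show ?thesis using 0 by simp
next
  case (Suc i)
  define y where "y = (1/2) ^ i * norm \<xi>"
  have y: "y \<ge> 0" by (simp add: y_def)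
  have "dyadic_bump j \<xi> \<le> 1 - exp (- y\<^sup>2 / 2)"
    by (simp add: dyadic_bump_def Suc y_def)
  also have "\<dots> \<le> y powr \<alpha>"
  proof (cases "y \<le> 1")
    case True
    have "1 - exp (- y\<^sup>2 / 2) \<le> y\<^sup>2 / 2"
      using exp_ge_add_one_self[of "- y\<^sup>2 / 2"] by simp
    also have "\<dots> \<le> y\<^sup>2" by simp
    also have "\<dots> \<le> y powr \<alpha>"
    proof (cases "y = 0")
      case False
      then have "y\<^sup>2 = y powr 2" using y by (simp add: powr_numeral)
      also have "\<dots> \<le> y powr \<alpha>" using True y False assms by (intro powr_mono') auto
      finally show ?thesis .
    qed simp
    finally show ?thesis .
  next
    case False
    have "1 - exp (- y\<^sup>2 / 2) \<le> 1" by simp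
    also have "\<dots> \<le> y powr \<alpha>"
      using False assms by (intro ge_one_powr_ge_zero) auto
    finally show ?thesis .
  qed
  also have "y powr \<alpha> \<le> (2 * (1/2) ^ j * (1 + norm \<xi>)) powr \<alpha>"
    using assms y by (intro powr_mono2) (auto simp: y_def Suc intro!: mult_left_mono)
  also have "\<dots> = 2 powr \<alpha> * ((1/2) ^ j) powr \<alpha> * (1 + norm \<xi>) powr \<alpha>"
    by (simp add: powr_mult)
  also have "\<dots> \<le> 4 * ((1/2) ^ j) powr \<alpha> * (1 + norm \<xi>) powr \<alpha>"
    using powr_mono[of \<alpha> 2 "2::real"] assms by (intro mult_right_mono) (auto simp: powr_numeral)
  finally show ?thesis .
qed

lemma power_le_fact_exp:
  fixes y :: real
  assumes "y \<ge> 0"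
  shows "y ^ k \<le> fact k * exp y"
proof -
  have "(\<Sum>i\<in>{k}. y ^ i /\<^sub>R fact i) \<le> exp y"
    unfolding exp_def using assms summable_exp_generic[of y]
    by (intro sum_le_suminf) auto
  then show ?thesis by (simp add: field_simps)
qed

text \<open>Gaussian decay traded for polynomial decay via \<open>u\<^sup>k \<le> k! e\<^sup>u\<close> with \<open>u = 1 + y\<close>
  and \<open>1 + y - y\<^sup>2/2 \<le> 3/2\<close>.\<close>

lemma exp_neg_square_le:
  fixes y :: real
  assumes "y \<ge> 0"
  shows "(1 + y) ^ k * exp (- y\<^sup>2 / 2) \<le> fact k * exp (3/2)"
proof -
  have "(1 + y) ^ k * exp (- y\<^sup>2 / 2) \<le> fact k * exp (1 + y) * exp (- y\<^sup>2 / 2)"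
    using assms by (intro mult_right_mono power_le_fact_exp) auto
  also have "\<dots> = fact k * exp (1 + y - y\<^sup>2 / 2)"
    by (simp only: mult.assoc exp_add[symmetric]) simp
  also have "1 + y - y\<^sup>2 / 2 \<le> 3/2"
    using zero_le_power2[of "y - 1"] by (simp add: power2_eq_square algebra_simps)
  finally show ?thesis by simp
qed

text \<open>With \<open>y = (1/2) ^ j * norm \<xi>\<close>, both \<open>norm \<xi>\<close> and
  \<open>1 + norm \<xi>\<close> are at most \<open>2 ^ j * (1 + y)\<close>; the Gaussian absorbs the
  powers of \<open>1 + y\<close> and only the powers of \<open>2 ^ j\<close> remain.\<close>

lemma dyadic_bump_le_decay:
  "dyadic_bump j \<xi> * norm \<xi> ^ n * (1 + norm \<xi>) ^ k \<le> fact (n + k) * exp (3/2) * 2 ^ (j * (n + k))"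
proof -
  define y where "y = (1/2) ^ j * norm \<xi>"
  have y: "y \<ge> 0" by (simp add: y_def)
  have n: "norm \<xi> \<le> 2 ^ j * (1 + y)"
    by (simp add: y_def algebra_simps power_one_over)
  have n1: "1 + norm \<xi> \<le> 2 ^ j * (1 + y)"
    by (simp add: y_def algebra_simps power_one_over)
  have "dyadic_bump j \<xi> * norm \<xi> ^ n * (1 + norm \<xi>) ^ k \<le> exp (- y\<^sup>2 / 2) * (2 ^ j * (1 + y)) ^ n * (2 ^ j * (1 + y)) ^ k"
    using dyadic_bump_le_exp[of j \<xi>] dyadic_bump_nonneg[of j \<xi>] n n1 y
    by (intro mult_mono power_mono) (auto simp: y_def)
  also have "\<dots> = 2 ^ (j * (n + k)) * ((1 + y) ^ (n + k) * exp (- y\<^sup>2 / 2))"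
    by (simp add: power_mult_distrib power_add power_mult mult_ac distrib_left)
  also have "\<dots> \<le> 2 ^ (j * (n + k)) * (fact (n + k) * exp (3/2))"
    by (intro mult_left_mono exp_neg_square_le y) auto
  finally show ?thesis by (simp add: mult_ac)
qed

subsection \<open>Averages over dilates of a measure with Fourier decay\<close>

text \<open>The budget of decay: \<open>a\<close> makes the fibre integrals of the squared weight
  finite, \<open>1/2\<close> pays for the supremum over dilations, and \<open>2 * \<kappa>\<close>
  is the surplus that makes the sum over scales converge. The bound
  \<open>\<kappa> \<le> 1/2\<close> keeps \<open>1/2 + 2 * \<kappa>\<close> in the range of
  \<open>dyadic_bump_le_powr\<close> and \<open>2 * \<kappa>\<close> below
  \<open>2 - \<kappa>\<close>. In \<open>fibre_bound\<close> the kernel plays the part of a smoothed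
  delta measure on the fibre of \<open>L\<close> over \<eta>, uniformly in its width.\<close>

locale decaying_average = finite_measure \<sigma>
  for \<sigma> :: "'b::euclidean_space measure" +
  fixes D :: "'a::euclidean_space \<Rightarrow> 'b" and L :: "'b \<Rightarrow> 'a" and A a \<kappa> B :: real
  assumes sets_\<sigma> [measurable_cong]: "sets \<sigma> = sets borel"
    and supp: "emeasure \<sigma> (UNIV - cball 0 1) = 0"
    and L_measurable [measurable]: "L \<in> borel_measurable borel"
    and adjoint: "\<And>x \<xi>. D x \<bullet> \<xi> = x \<bullet> L \<xi>"
    and decay: "\<And>\<xi>. norm (fourier_measure \<sigma> \<xi>) \<le> A * (1 + norm \<xi>) powr - (a + 1/2 + 2 * \<kappa>)"
    and a_nonneg: "0 \<le> a"
    and \<kappa>: "0 < \<kappa>" "\<kappa> \<le> 1/2"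
    and B_nonneg: "0 \<le> B"
    and fibre_bound: "\<And>r \<eta>. 0 < r \<Longrightarrow>
      (\<integral>\<^sup>+\<zeta>. ennreal (((1 + norm \<zeta>) powr - a)\<^sup>2 * gauss_kernel r (\<eta> - L \<zeta>)) \<partial>lborel) \<le> ennreal B"
begin

lemma fourier_measure_measurable [measurable]: "fourier_measure \<sigma> \<in> borel_measurable borel"
  unfolding fourier_measure_def by measurable

lemma space_\<sigma> [simp]: "space \<sigma> = UNIV"
  using sets_eq_imp_space_eq[OF sets_\<sigma>] by simp

lemma norm_fourier_measure_le: "norm (fourier_measure \<sigma> \<xi>) \<le> measure \<sigma> UNIV"
  unfolding fourier_measure_def
  using integral_norm_bound[of \<sigma> "\<lambda>y. cis (- 2 * pi * (y \<bullet> \<xi>))"] by simp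

lemma A_nonneg: "0 \<le> A"
  using order_trans[OF norm_ge_zero decay[of 0]] by simp

lemma AE_norm_le_1: "AE y in \<sigma>. norm y \<le> 1"
proof (rule AE_I[where N="UNIV - cball 0 1"])
  show "UNIV - cball 0 1 \<in> sets \<sigma>"
    unfolding sets_\<sigma> by measurable
qed (use supp in auto)

text \<open>The average of the \<open>j\<close>-th frequency part of \<open>F\<close> at scale
  \<open>t\<close>, written directly on the Fourier side and restricted to the image of
  \<open>D\<close>.\<close>

definition piece :: "('b \<Rightarrow> complex) \<Rightarrow> nat \<Rightarrow> real \<Rightarrow> 'a \<Rightarrow> complex" where
  "piece F j t x = (\<integral>\<xi>. fourier F \<xi> * of_real (dyadic_bump j \<xi>) * fourier_measure \<sigma> (t *\<^sub>R \<xi>) * cis (2 * pi * (x \<bullet> L \<xi>)) \<partial>lborel)"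

lemma piece_measurable [measurable]:
  assumes [measurable]: "F \<in> borel_measurable borel" "f \<in> borel_measurable M" "g \<in> borel_measurable M"
  shows "(\<lambda>p. piece F j (f p) (g p)) \<in> borel_measurable M"
  unfolding piece_def by measurable

lemma integrable_piece:
  assumes F: "integrable lborel F"
  shows "integrable lborel (\<lambda>\<xi>. fourier F \<xi> * of_real (dyadic_bump j \<xi>) * fourier_measure \<sigma> (t *\<^sub>R \<xi>) * cis (2 * pi * (x \<bullet> L \<xi>)))"
    and "integrable lborel (\<lambda>\<xi>. fourier F \<xi> * of_real (dyadic_bump j \<xi>) * fourier_measure \<sigma> (t *\<^sub>R \<xi>))"
proof -
  have [measurable]: "F \<in> borel_measurable borel" using F by auto
  have I: "integrable lborel (\<lambda>\<xi>. of_real (measure \<sigma> UNIV) * (fourier F \<xi> * of_real (exp (- ((1/2) ^ j * norm \<xi>)\<^sup>2 / 2))))"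
    by (intro integrable_mult_right integrable_fourier_gauss F) auto
  have b: "norm (fourier F \<xi>) * \<bar>dyadic_bump j \<xi>\<bar> * norm (fourier_measure \<sigma> (t *\<^sub>R \<xi>)) \<le>
     measure \<sigma> UNIV * (norm (fourier F \<xi>) * exp (- ((1/2) ^ j * norm \<xi>)\<^sup>2 / 2))" for \<xi>
  proof -
    have "norm (fourier F \<xi>) * \<bar>dyadic_bump j \<xi>\<bar> * norm (fourier_measure \<sigma> (t *\<^sub>R \<xi>)) \<le>
      (norm (fourier F \<xi>) * exp (- ((1/2) ^ j * norm \<xi>)\<^sup>2 / 2)) * measure \<sigma> UNIV"
      using dyadic_bump_nonneg[of j \<xi>] dyadic_bump_le_exp[of j \<xi>]
      by (intro mult_mono norm_fourier_measure_le) auto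
    then show ?thesis by (simp add: mult.commute)
  qed
  show "integrable lborel (\<lambda>\<xi>. fourier F \<xi> * of_real (dyadic_bump j \<xi>) * fourier_measure \<sigma> (t *\<^sub>R \<xi>) * cis (2 * pi * (x \<bullet> L \<xi>)))"
    by (rule Bochner_Integration.integrable_bound[OF I]) (use b in \<open>auto simp: norm_mult\<close>)
  show "integrable lborel (\<lambda>\<xi>. fourier F \<xi> * of_real (dyadic_bump j \<xi>) * fourier_measure \<sigma> (t *\<^sub>R \<xi>))"
    by (rule Bochner_Integration.integrable_bound[OF I]) (use b in \<open>auto simp: norm_mult\<close>)
qed

text \<open>Fubini: the adjoint relation turns the phase of \<open>D x\<close> into that of
  \<open>x \<bullet> L \<xi>\<close>, and the integral over \<open>y\<close> becomes the transform
  of \<sigma> at \<open>t *\<^sub>R \<xi>\<close>.\<close>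

lemma average_gauss_smooth:
  assumes F: "integrable lborel F" and r: "r > 0"
  shows "(\<integral>y. gauss_smooth r F (D x - t *\<^sub>R y) \<partial>\<sigma>) =
    (\<integral>\<xi>. fourier F \<xi> * of_real (exp (- (r * norm \<xi>)\<^sup>2 / 2)) * fourier_measure \<sigma> (t *\<^sub>R \<xi>) * cis (2 * pi * (x \<bullet> L \<xi>)) \<partial>lborel)"
proof -
  have [measurable]: "F \<in> borel_measurable borel" using F by auto
  define K where "K \<xi> = fourier F \<xi> * of_real (exp (- (r * norm \<xi>)\<^sup>2 / 2))" for \<xi>
  have [measurable]: "K \<in> borel_measurable borel"
    unfolding K_def by measurable
  have KI: "integrable lborel K"
    unfolding K_def by (rule integrable_fourier_gauss[OF F r])
  interpret S: pair_sigma_finite \<sigma> "lborel :: 'b measure" ..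
  have I: "integrable (\<sigma> \<Otimes>\<^sub>M lborel) (\<lambda>(y, \<xi>). K \<xi> * cis (2 * pi * ((D x - t *\<^sub>R y) \<bullet> \<xi>)))"
  proof (rule Bochner_Integration.integrable_bound)
    show "integrable (\<sigma> \<Otimes>\<^sub>M lborel) (\<lambda>p. 1 * K (snd p))"
      by (rule S.integrable_pair_mult) (use KI in auto)
  qed (auto simp: norm_mult)
  have "(\<integral>y. gauss_smooth r F (D x - t *\<^sub>R y) \<partial>\<sigma>) = (\<integral>y. \<integral>\<xi>. K \<xi> * cis (2 * pi * ((D x - t *\<^sub>R y) \<bullet> \<xi>)) \<partial>lborel \<partial>\<sigma>)"
    unfolding gauss_smooth_def K_def ..
  also have "\<dots> = (\<integral>\<xi>. \<integral>y. K \<xi> * cis (2 * pi * ((D x - t *\<^sub>R y) \<bullet> \<xi>)) \<partial>\<sigma> \<partial>lborel)"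
    by (rule S.Fubini_integral[OF I, symmetric])
  also have "\<dots> = (\<integral>\<xi>. K \<xi> * fourier_measure \<sigma> (t *\<^sub>R \<xi>) * cis (2 * pi * (x \<bullet> L \<xi>)) \<partial>lborel)"
  proof (intro Bochner_Integration.integral_cong refl)
    fix \<xi>
    have e: "cis (2 * pi * ((D x - t *\<^sub>R y) \<bullet> \<xi>)) = cis (2 * pi * (x \<bullet> L \<xi>)) * cis (- 2 * pi * (y \<bullet> (t *\<^sub>R \<xi>)))" for y
      unfolding cis_mult by (simp add: inner_diff_left adjoint right_diff_distrib)
    show "(\<integral>y. K \<xi> * cis (2 * pi * ((D x - t *\<^sub>R y) \<bullet> \<xi>)) \<partial>\<sigma>) = K \<xi> * fourier_measure \<sigma> (t *\<^sub>R \<xi>) * cis (2 * pi * (x \<bullet> L \<xi>))"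
      unfolding e integral_mult_right_zero fourier_measure_def by (simp only: mult_ac)
  qed
  finally show ?thesis by (simp add: K_def)
qed

lemma sum_pieces:
  assumes F: "integrable lborel F"
  shows "(\<Sum>j\<le>J. piece F j t x) = (\<integral>y. gauss_smooth ((1/2) ^ J) F (D x - t *\<^sub>R y) \<partial>\<sigma>)"
proof -
  have "(\<Sum>j\<le>J. piece F j t x) = (\<integral>\<xi>. (\<Sum>j\<le>J. fourier F \<xi> * of_real (dyadic_bump j \<xi>) * fourier_measure \<sigma> (t *\<^sub>R \<xi>) * cis (2 * pi * (x \<bullet> L \<xi>))) \<partial>lborel)"
    unfolding piece_def by (rule Bochner_Integration.integral_sum[symmetric]) (rule integrable_piece[OF F])
  also have "\<dots> = (\<integral>\<xi>. fourier F \<xi> * of_real (\<Sum>j\<le>J. dyadic_bump j \<xi>) * fourier_measure \<sigma> (t *\<^sub>R \<xi>) * cis (2 * pi * (x \<bullet> L \<xi>)) \<partial>lborel)"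
    by (simp add: sum_distrib_left sum_distrib_right)
  finally show ?thesis
    unfolding sum_dyadic_bump by (subst average_gauss_smooth[OF F]) auto
qed

lemma pieces_tendsto:
  assumes F: "integrable lborel F" and M: "\<And>z. norm (F z) \<le> M" and cont: "continuous_on UNIV F"
  shows "(\<lambda>J. \<Sum>j\<le>J. piece F j t x) \<longlonglongrightarrow> (\<integral>y. F (D x - t *\<^sub>R y) \<partial>\<sigma>)"
  unfolding sum_pieces[OF F]
proof (rule integral_dominated_convergence)
  have [measurable]: "F \<in> borel_measurable borel" using F by auto
  show "(\<lambda>y. F (D x - t *\<^sub>R y)) \<in> borel_measurable \<sigma>" by measurable
  show "(\<lambda>y. gauss_smooth ((1/2) ^ J) F (D x - t *\<^sub>R y)) \<in> borel_measurable \<sigma>" for J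
    unfolding gauss_smooth_def by measurable
  show "integrable \<sigma> (\<lambda>_. M)" by simp
  show "AE y in \<sigma>. (\<lambda>J. gauss_smooth ((1/2) ^ J) F (D x - t *\<^sub>R y)) \<longlonglongrightarrow> F (D x - t *\<^sub>R y)"
    by (intro AE_I2 gauss_smooth_tendsto[OF F M cont] LIMSEQ_power_zero) auto
  show "AE y in \<sigma>. norm (gauss_smooth ((1/2) ^ J) F (D x - t *\<^sub>R y)) \<le> M" for J
    by (intro AE_I2 norm_gauss_smooth_le[OF F _ M]) auto
qed

text \<open>The partial sums converge by Gaussian smoothing. The right side is an
  \<open>ennreal\<close> series, so no summability of the pieces has to be known at this
  point.\<close>

lemma norm_average_le_suminf:
  assumes F: "integrable lborel F" and M: "\<And>z. norm (F z) \<le> M" and cont: "continuous_on UNIV F"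
  shows "ennreal (norm (\<integral>y. F (D x - t *\<^sub>R y) \<partial>\<sigma>)) \<le> (\<Sum>j. ennreal (norm (piece F j t x)))"
proof (rule LIMSEQ_le_const2)
  show "(\<lambda>J. ennreal (norm (\<Sum>j\<le>J. piece F j t x))) \<longlonglongrightarrow> ennreal (norm (\<integral>y. F (D x - t *\<^sub>R y) \<partial>\<sigma>))"
    by (intro tendsto_ennrealI tendsto_norm pieces_tendsto[OF assms])
  have "ennreal (norm (\<Sum>j\<le>J. piece F j t x)) \<le> (\<Sum>j. ennreal (norm (piece F j t x)))" for J
  proof -
    have "ennreal (norm (\<Sum>j\<le>J. piece F j t x)) \<le> ennreal (\<Sum>j\<le>J. norm (piece F j t x))"
      by (intro ennreal_leI norm_sum)
    also have "\<dots> = (\<Sum>j\<le>J. ennreal (norm (piece F j t x)))"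
      by (rule sum_ennreal[symmetric]) auto
    also have "\<dots> \<le> (\<Sum>j. ennreal (norm (piece F j t x)))"
      by (intro sum_le_suminf) auto
    finally show ?thesis .
  qed
  then show "\<exists>N. \<forall>J\<ge>N. ennreal (norm (\<Sum>j\<le>J. piece F j t x)) \<le> (\<Sum>j. ennreal (norm (piece F j t x)))"
    by blast
qed

text \<open>As \<open>t \<ge> 1\<close>, dilation does not worsen the decay of the multiplier. Of
  the total order \<open>a + \<alpha>\<close>, the part \<open>\<alpha> = 1/2 + 2 * \<kappa>\<close>
  is spent on the factor \<open>((1/2) ^ j) powr \<alpha>\<close>, whose square appears in the
  bound, and the part \<open>a\<close> is left as the weight for \<open>fibre_bound\<close>.\<close>

lemma piece_L2:
  assumes F: "integrable lborel F" and t: "t \<ge> 1"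
  shows "(\<integral>\<^sup>+x. ennreal ((norm (piece F j t x))\<^sup>2) \<partial>lborel) \<le>
    ennreal (16 * A\<^sup>2 * B * ((1/2) ^ j) powr (1 + 4 * \<kappa>)) * (\<integral>\<^sup>+z. ennreal ((norm (F z))\<^sup>2) \<partial>lborel)"
proof -
  have [measurable]: "F \<in> borel_measurable borel" using F by auto
  define \<alpha> where "\<alpha> = 1/2 + 2 * \<kappa>"
  have \<alpha>: "0 \<le> \<alpha>" "\<alpha> \<le> 2" using \<kappa> by (auto simp: \<alpha>_def)
  define c where "c = 4 * A * ((1/2) ^ j) powr \<alpha>"
  define w where "w \<xi> = c * (1 + norm \<xi>) powr - a" for \<xi> :: 'b
  have c: "c \<ge> 0" using A_nonneg by (simp add: c_def)
  have c2: "c\<^sup>2 * B = 16 * A\<^sup>2 * B * ((1/2) ^ j) powr (1 + 4 * \<kappa>)"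
    by (simp add: c_def \<alpha>_def power_mult_distrib power2_eq_square[of "_ powr _"] flip: powr_add)
  have bound: "norm (fourier F \<xi> * of_real (dyadic_bump j \<xi>) * fourier_measure \<sigma> (t *\<^sub>R \<xi>)) \<le> norm (fourier F \<xi>) * w \<xi>" for \<xi>
  proof -
    have "norm \<xi> \<le> norm (t *\<^sub>R \<xi>)"
      using t mult_right_mono[of 1 t "norm \<xi>"] by simp
    then have "(1 + norm (t *\<^sub>R \<xi>)) powr - (a + \<alpha>) \<le> (1 + norm \<xi>) powr - (a + \<alpha>)"
      using a_nonneg \<alpha> by (intro powr_mono2') (auto intro: add_pos_nonneg)
    then have "norm (fourier_measure \<sigma> (t *\<^sub>R \<xi>)) \<le> A * (1 + norm \<xi>) powr - (a + \<alpha>)"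
      using decay[of "t *\<^sub>R \<xi>"] A_nonneg unfolding \<alpha>_def
      by (smt (verit) add.assoc mult_left_mono)
    then have "dyadic_bump j \<xi> * norm (fourier_measure \<sigma> (t *\<^sub>R \<xi>)) \<le>
       (4 * ((1/2) ^ j) powr \<alpha> * (1 + norm \<xi>) powr \<alpha>) * (A * (1 + norm \<xi>) powr - (a + \<alpha>))"
      using dyadic_bump_le_powr[OF \<alpha>, of j \<xi>] by (intro mult_mono) auto
    also have "\<dots> = c * ((1 + norm \<xi>) powr \<alpha> * (1 + norm \<xi>) powr - (a + \<alpha>))"
      by (simp add: c_def)
    also have "\<dots> = w \<xi>"
      by (simp add: w_def flip: powr_add)
    finally have "norm (fourier F \<xi>) * (dyadic_bump j \<xi> * norm (fourier_measure \<sigma> (t *\<^sub>R \<xi>))) \<le> norm (fourier F \<xi>) * w \<xi>"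
      by (rule mult_left_mono) auto
    then show ?thesis
      by (simp add: norm_mult dyadic_bump_nonneg mult.assoc)
  qed
  have "(\<integral>\<^sup>+x. ennreal ((norm (piece F j t x))\<^sup>2) \<partial>lborel) \<le> ennreal (c\<^sup>2 * B) * (\<integral>\<^sup>+\<xi>. ennreal ((norm (fourier F \<xi>))\<^sup>2) \<partial>lborel)"
    unfolding piece_def
  proof (rule L2_le[where w=w, OF _ _ _ integrable_piece(2)[OF F] bound])
    fix r :: real and \<eta> :: 'a
    assume r: "r > 0"
    have "(\<integral>\<^sup>+\<zeta>. ennreal ((w \<zeta>)\<^sup>2 * gauss_kernel r (\<eta> - L \<zeta>)) \<partial>lborel) =
      ennreal (c\<^sup>2) * (\<integral>\<^sup>+\<zeta>. ennreal (((1 + norm \<zeta>) powr - a)\<^sup>2 * gauss_kernel r (\<eta> - L \<zeta>)) \<partial>lborel)"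
      unfolding w_def using r
      by (subst nn_integral_cmult[symmetric]) (auto simp: power_mult_distrib mult.assoc simp flip: ennreal_mult)
    also have "\<dots> \<le> ennreal (c\<^sup>2) * ennreal B"
      by (intro mult_left_mono fibre_bound r) auto
    finally show "(\<integral>\<^sup>+\<zeta>. ennreal ((w \<zeta>)\<^sup>2 * gauss_kernel r (\<eta> - L \<zeta>)) \<partial>lborel) \<le> ennreal (c\<^sup>2 * B)"
      by (simp add: ennreal_mult B_nonneg)
  qed (auto simp: w_def[abs_def])
  also have "\<dots> \<le> ennreal (c\<^sup>2 * B) * (\<integral>\<^sup>+z. ennreal ((norm (F z))\<^sup>2) \<partial>lborel)"
    by (intro mult_left_mono fourier_L2_le F) auto
  finally show ?thesis unfolding c2 .
qed

end

subsection \<open>Differences in the dilation parameter\<close>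

lemma nn_integral_one_plus_abs_powr_finite:
  fixes q :: real
  assumes q: "q > 1"
  shows "(\<integral>\<^sup>+u. ennreal ((1 + \<bar>u\<bar>) powr - q) \<partial>lborel) < \<infinity>"
proof -
  have D: "((\<lambda>u. (1 + u) powr (1 - q) / (1 - q)) has_real_derivative (1 + u) powr - q) (at u)" if "u \<ge> 0" for u
    using that q by (auto intro!: derivative_eq_intros)
  have lim: "((\<lambda>u. (1 + u) powr (1 - q) / (1 - q)) \<longlongrightarrow> 0) at_top"
    using q by real_asymp
  have I: "(\<integral>\<^sup>+u. ennreal ((1 + u) powr - q) * indicator {0..} u \<partial>lborel) = ennreal (0 - (1 + 0) powr (1 - q) / (1 - q))"
    by (rule nn_integral_FTC_atLeast[OF _ D _ lim]) auto
  have "(\<integral>\<^sup>+u. ennreal ((1 + \<bar>u\<bar>) powr - q) \<partial>lborel) \<le>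
     (\<integral>\<^sup>+u. ennreal ((1 + u) powr - q) * indicator {0..} u + ennreal ((1 + (0 + (-1) * u)) powr - q) * indicator {0..} (0 + (-1) * u) \<partial>lborel)"
    by (intro nn_integral_mono) (auto simp: indicator_def)
  also have "\<dots> = (\<integral>\<^sup>+u. ennreal ((1 + u) powr - q) * indicator {0..} u \<partial>lborel) +
     (\<integral>\<^sup>+u. ennreal ((1 + (0 + (-1) * u)) powr - q) * indicator {0..} (0 + (-1) * u) \<partial>lborel)"
    by (rule nn_integral_add) auto
  also have "(\<integral>\<^sup>+u. ennreal ((1 + (0 + (-1) * u)) powr - q) * indicator {0..} (0 + (-1) * u) \<partial>lborel) =
      (\<integral>\<^sup>+u. ennreal ((1 + u) powr - q) * indicator {0..} u \<partial>lborel)"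
    by (subst nn_integral_real_affine[of "\<lambda>u. ennreal ((1 + u) powr - q) * indicator {0..} u" "-1" 0]) auto
  finally show ?thesis
    unfolding I by (rule le_less_trans) (simp add: less_top[symmetric])
qed

text \<open>\<open>norm x\<close> dominates every coordinate, so the exponent can be shared equally:
  the weight is at most a product of one-dimensional weights of exponent \<open>p / DIM('a)\<close>,
  which exceeds 1.\<close>

lemma nn_integral_one_plus_norm_powr_finite:
  assumes p: "p > real DIM('a)"
  shows "(\<integral>\<^sup>+x. ennreal ((1 + norm (x::'a::euclidean_space)) powr - p) \<partial>lborel) < \<infinity>"
proof -
  let ?q = "p / real DIM('a)"
  have q: "?q > 1" using p by simp
  have "(\<integral>\<^sup>+x. ennreal ((1 + norm (x::'a)) powr - p) \<partial>lborel) \<le> (\<integral>\<^sup>+x. (\<Prod>b\<in>Basis. ennreal ((1 + \<bar>(x::'a) \<bullet> b\<bar>) powr - ?q)) \<partial>lborel)"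
  proof (intro nn_integral_mono)
    fix x :: 'a
    have "(1 + norm x) powr - p = (\<Prod>b\<in>(Basis::'a set). (1 + norm x) powr - ?q)"
      by (simp add: powr_power add_nonneg_eq_0_iff)
    also have "\<dots> \<le> (\<Prod>b\<in>Basis. (1 + \<bar>x \<bullet> b\<bar>) powr - ?q)"
      using q p by (intro prod_mono conjI powr_mono2') (auto simp: Basis_le_norm intro: add_pos_nonneg)
    finally have "ennreal ((1 + norm x) powr - p) \<le> ennreal (\<Prod>b\<in>Basis. (1 + \<bar>x \<bullet> b\<bar>) powr - ?q)"
      by (rule ennreal_leI)
    also have "\<dots> = (\<Prod>b\<in>Basis. ennreal ((1 + \<bar>x \<bullet> b\<bar>) powr - ?q))"
      by (rule prod_ennreal[symmetric]) auto
    finally show "ennreal ((1 + norm x) powr - p) \<le> (\<Prod>b\<in>Basis. ennreal ((1 + \<bar>x \<bullet> b\<bar>) powr - ?q))" .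
  qed
  also have "\<dots> = (\<Prod>b\<in>(Basis::'a set). (\<integral>\<^sup>+u. ennreal ((1 + \<bar>u\<bar>) powr - ?q) \<partial>lborel))"
    by (rule nn_integral_lborel_prod) auto
  also have "\<dots> < \<infinity>"
    using nn_integral_one_plus_abs_powr_finite[OF q] by (simp add: power_less_top_ennreal)
  finally show ?thesis .
qed

lemma weighted_sum_square_le:
  fixes c b :: "nat \<Rightarrow> real"
  assumes "\<And>k. 0 \<le> c k"
  shows "(\<Sum>k\<le>n. c k * b k)\<^sup>2 \<le> (\<Sum>k\<le>n. c k) * (\<Sum>k\<le>n. c k * (b k)\<^sup>2)"
  using Cauchy_Schwarz_ineq_sum[of "\<lambda>k. sqrt (c k)" "\<lambda>k. sqrt (c k) * b k" "{..n}"] assms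
  by (simp add: power_mult_distrib mult.assoc[symmetric])

text \<open>Used with geometric \<open>c\<close>, so that squares of the pieces can be summed over
  scales at the cost of \<open>1 / c j\<close>.\<close>

lemma weighted_suminf_square_le:
  fixes f :: "nat \<Rightarrow> ennreal"
  assumes "\<And>j. 0 < c j"
  shows "(\<Sum>j. f j)\<^sup>2 \<le> (\<Sum>j. ennreal (c j)) * (\<Sum>j. ennreal (1 / c j) * (f j)\<^sup>2)"
proof -
  have "ennreal (sqrt (c j)) * (ennreal (1 / sqrt (c j)) * f j) = f j" for j
    using assms[of j] by (simp add: mult.assoc[symmetric] flip: ennreal_mult)
  moreover have "(ennreal (sqrt (c j)))\<^sup>2 = ennreal (c j)" "(ennreal (1 / sqrt (c j)) * f j)\<^sup>2 = ennreal (1 / c j) * (f j)\<^sup>2" for j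
    using assms[of j] by (simp_all add: power_mult_distrib power_divide ennreal_power)
  ultimately show ?thesis
    using Cauchy_Schwarz_nn_integral[of "\<lambda>j. ennreal (sqrt (c j))" "count_space UNIV" "\<lambda>j. ennreal (1 / sqrt (c j)) * f j"]
    by (simp add: nn_integral_count_space_nat)
qed

lemma norm_one_minus_cis_le: "norm (1 - cis \<theta>) \<le> \<bar>\<theta>\<bar>"
proof -
  have "norm (1 - cis \<theta>) = 2 * \<bar>sin (\<theta> / 2)\<bar>"
    using dist_exp_i_1[of \<theta>] by (simp add: cis_conv_exp norm_minus_commute)
  also have "\<dots> \<le> \<bar>\<theta>\<bar>"
    using abs_sin_x_le_abs_x[of "\<theta> / 2"] by simp
  finally show ?thesis .
qed

lemma SUP_square_le_ennreal:
  fixes f :: "'i \<Rightarrow> ennreal"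
  assumes "\<And>i. i \<in> I \<Longrightarrow> (f i)\<^sup>2 \<le> c" and "I \<noteq> {}"
  shows "(SUP i\<in>I. f i)\<^sup>2 \<le> c"
proof -
  have "f i * f k \<le> c" if "i \<in> I" "k \<in> I" for i k
  proof (cases "f i \<le> f k")
    case True
    then have "f i * f k \<le> (f k)\<^sup>2" by (simp add: power2_eq_square mult_right_mono)
    then show ?thesis using assms(1)[OF that(2)] by (rule order_trans)
  next
    case False
    then have "f i * f k \<le> (f i)\<^sup>2" by (simp add: power2_eq_square mult_left_mono)
    then show ?thesis using assms(1)[OF that(1)] by (rule order_trans)
  qed
  then show ?thesis
    unfolding power2_eq_square SUP_mult_right_ennreal SUP_mult_left_ennreal
    by (intro SUP_least)
qed

context decaying_average
begin

text \<open>The \<open>n\<close>-th difference in \<open>t\<close> carries the factor \<open>(1 - cis \<theta>)^n\<close> with \<open>\<theta> = - 2 \<pi> h (y \<bullet> \<xi>)\<close>.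
  This is how the compact support of \<open>\<sigma>\<close> enters: it replaces differentiation in \<open>t\<close>.\<close>

lemma fourier_measure_difference:
  "norm (\<Sum>k\<le>n. (-1) ^ k * of_nat (n choose k) * fourier_measure \<sigma> ((t + real k * h) *\<^sub>R \<xi>)) \<le>
    measure \<sigma> UNIV * (2 * pi * \<bar>h\<bar> * norm \<xi>) ^ n"
proof -
  define \<theta> where "\<theta> y = - 2 * pi * h * (y \<bullet> \<xi>)" for y
  have [measurable]: "\<theta> \<in> borel_measurable borel" unfolding \<theta>_def by measurable
  have I: "integrable \<sigma> (\<lambda>y. cis (f y))" if [measurable]: "f \<in> borel_measurable borel" for f
    by (rule integrable_const_bound[of _ 1]) auto
  have "(\<Sum>k\<le>n. (-1) ^ k * of_nat (n choose k) * fourier_measure \<sigma> ((t + real k * h) *\<^sub>R \<xi>)) =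
     (\<integral>y. (\<Sum>k\<le>n. (-1) ^ k * of_nat (n choose k) * cis (- 2 * pi * (y \<bullet> ((t + real k * h) *\<^sub>R \<xi>)))) \<partial>\<sigma>)"
    unfolding fourier_measure_def
    by (subst Bochner_Integration.integral_sum) (auto intro!: integrable_mult_right I)
  also have "\<dots> = (\<integral>y. cis (- 2 * pi * t * (y \<bullet> \<xi>)) * (1 - cis (\<theta> y)) ^ n \<partial>\<sigma>)"
  proof (intro Bochner_Integration.integral_cong refl)
    fix y
    have "cis (- 2 * pi * (y \<bullet> ((t + real k * h) *\<^sub>R \<xi>))) = cis (- 2 * pi * t * (y \<bullet> \<xi>)) * cis (\<theta> y) ^ k" for k
    proof -
      have "- 2 * pi * (y \<bullet> ((t + real k * h) *\<^sub>R \<xi>)) = - 2 * pi * t * (y \<bullet> \<xi>) + real k * \<theta> y"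
        by (simp add: \<theta>_def algebra_simps)
      then show ?thesis by (simp only: Complex.DeMoivre cis_mult)
    qed
    moreover have "(1 - cis (\<theta> y)) ^ n = (\<Sum>k\<le>n. of_nat (n choose k) * ((-1) ^ k * cis (\<theta> y) ^ k))"
      using binomial_ring[of "- cis (\<theta> y)" 1 n] by (simp add: power_minus[of "cis (\<theta> y)"])
    ultimately show "(\<Sum>k\<le>n. (-1) ^ k * of_nat (n choose k) * cis (- 2 * pi * (y \<bullet> ((t + real k * h) *\<^sub>R \<xi>)))) =
       cis (- 2 * pi * t * (y \<bullet> \<xi>)) * (1 - cis (\<theta> y)) ^ n"
      by (simp only: sum_distrib_left mult_ac)
  qed
  also have "norm \<dots> \<le> (\<integral>y. (2 * pi * \<bar>h\<bar> * norm \<xi>) ^ n \<partial>\<sigma>)"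
  proof (rule order_trans[OF integral_norm_bound], rule integral_mono_AE)
    have b: "AE y in \<sigma>. norm (cis (- 2 * pi * t * (y \<bullet> \<xi>)) * (1 - cis (\<theta> y)) ^ n) \<le> (2 * pi * \<bar>h\<bar> * norm \<xi>) ^ n"
      using AE_norm_le_1
    proof eventually_elim
      case (elim y)
      have "\<bar>y \<bullet> \<xi>\<bar> \<le> norm y * norm \<xi>" by (rule Cauchy_Schwarz_ineq2)
      also have "\<dots> \<le> norm \<xi>" using elim by (simp add: mult_left_le_one_le)
      finally have "\<bar>\<theta> y\<bar> \<le> 2 * pi * \<bar>h\<bar> * norm \<xi>"
        by (simp add: \<theta>_def abs_mult mult_left_mono)
      then have "norm (1 - cis (\<theta> y)) \<le> 2 * pi * \<bar>h\<bar> * norm \<xi>"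
        using norm_one_minus_cis_le order_trans by blast
      then show ?case by (simp add: norm_mult norm_power power_mono)
    qed
    show "AE y in \<sigma>. norm (cis (- 2 * pi * t * (y \<bullet> \<xi>)) * (1 - cis (\<theta> y)) ^ n) \<le> (2 * pi * \<bar>h\<bar> * norm \<xi>) ^ n"
      by (rule b)
    show "integrable \<sigma> (\<lambda>y. norm (cis (- 2 * pi * t * (y \<bullet> \<xi>)) * (1 - cis (\<theta> y)) ^ n))"
      by (rule integrable_const_bound[of _ "(2 * pi * \<bar>h\<bar> * norm \<xi>) ^ n"]) (use b in auto)
  qed simp
  also have "\<dots> = measure \<sigma> UNIV * (2 * pi * \<bar>h\<bar> * norm \<xi>) ^ n"
    by simp
  finally show ?thesis .
qed

text \<open>The modulus of an oscillatory integral is at most the integral of the modulus of its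
  symbol; the resulting bound depends neither on \<open>x\<close> nor on \<open>t\<close>.\<close>

lemma piece_difference:
  assumes F: "integrable lborel F"
  shows "ennreal (norm (\<Sum>k\<le>n. (-1) ^ k * of_nat (n choose k) * piece F j (t + real k * h) x)) \<le>
    (\<integral>\<^sup>+\<xi>. ennreal (norm (fourier F \<xi>) * (dyadic_bump j \<xi> * (measure \<sigma> UNIV * (2 * pi * \<bar>h\<bar> * norm \<xi>) ^ n))) \<partial>lborel)"
proof -
  have [measurable]: "F \<in> borel_measurable borel" using F by auto
  define G where "G k \<xi> = fourier F \<xi> * of_real (dyadic_bump j \<xi>) * fourier_measure \<sigma> ((t + real k * h) *\<^sub>R \<xi>) * cis (2 * pi * (x \<bullet> L \<xi>))" for k \<xi>
  have GI: "integrable lborel (G k)" for k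
    unfolding G_def by (rule integrable_piece(1)[OF F])
  have SI: "integrable lborel (\<lambda>\<xi>. \<Sum>k\<le>n. (-1) ^ k * of_nat (n choose k) * G k \<xi>)"
    by (intro Bochner_Integration.integrable_sum integrable_mult_right GI)
  have "(\<Sum>k\<le>n. (-1) ^ k * of_nat (n choose k) * piece F j (t + real k * h) x) = (\<integral>\<xi>. (\<Sum>k\<le>n. (-1) ^ k * of_nat (n choose k) * G k \<xi>) \<partial>lborel)"
    unfolding piece_def G_def[symmetric]
    by (subst Bochner_Integration.integral_sum) (auto intro!: integrable_mult_right GI)
  then have "ennreal (norm (\<Sum>k\<le>n. (-1) ^ k * of_nat (n choose k) * piece F j (t + real k * h) x)) \<le>
    (\<integral>\<^sup>+\<xi>. norm (\<Sum>k\<le>n. (-1) ^ k * of_nat (n choose k) * G k \<xi>) \<partial>lborel)"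
    using integral_norm_bound_ennreal[OF SI] by simp
  also have "\<dots> \<le> (\<integral>\<^sup>+\<xi>. ennreal (norm (fourier F \<xi>) * (dyadic_bump j \<xi> * (measure \<sigma> UNIV * (2 * pi * \<bar>h\<bar> * norm \<xi>) ^ n))) \<partial>lborel)"
  proof (intro nn_integral_mono ennreal_leI)
    fix \<xi>
    have "(\<Sum>k\<le>n. (-1) ^ k * of_nat (n choose k) * G k \<xi>) = fourier F \<xi> * of_real (dyadic_bump j \<xi>) *
       (\<Sum>k\<le>n. (-1) ^ k * of_nat (n choose k) * fourier_measure \<sigma> ((t + real k * h) *\<^sub>R \<xi>)) * cis (2 * pi * (x \<bullet> L \<xi>))"
      unfolding G_def sum_distrib_left sum_distrib_right by (simp only: mult_ac)
    then have "norm (\<Sum>k\<le>n. (-1) ^ k * of_nat (n choose k) * G k \<xi>) = norm (fourier F \<xi>) * (dyadic_bump j \<xi> *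
       norm (\<Sum>k\<le>n. (-1) ^ k * of_nat (n choose k) * fourier_measure \<sigma> ((t + real k * h) *\<^sub>R \<xi>)))"
      by (simp add: norm_mult dyadic_bump_nonneg mult.assoc)
    also have "\<dots> \<le> norm (fourier F \<xi>) * (dyadic_bump j \<xi> * (measure \<sigma> UNIV * (2 * pi * \<bar>h\<bar> * norm \<xi>) ^ n))"
      by (intro mult_left_mono fourier_measure_difference dyadic_bump_nonneg) auto
    finally show "norm (\<Sum>k\<le>n. (-1) ^ k * of_nat (n choose k) * G k \<xi>) \<le> norm (fourier F \<xi>) * (dyadic_bump j \<xi> * (measure \<sigma> UNIV * (2 * pi * \<bar>h\<bar> * norm \<xi>) ^ n))" .
  qed
  finally show ?thesis .
qed

end

section \<open>Size of the difference errors, and the supremum over dilations of one piece\<close>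

context decaying_average
begin

text \<open>A step of size at most \<open>q powr (1 + \<kappa>) / (2 * real n)\<close> satisfies
  \<open>2 * pi * \<bar>h\<bar> \<le> (pi / real n) * q powr (1 + \<kappa>)\<close>, the source of
  the second factor; the last one is the constant of \<open>dyadic_bump_le_decay\<close> with
  \<open>k = DIM('b)\<close>.\<close>

definition err_const :: "nat \<Rightarrow> real" where
  "err_const n = measure \<sigma> UNIV * (pi / real n) ^ n * (fact (n + DIM('b)) * exp (3/2))"

text \<open>The square of the weight has exponent twice the dimension and is integrable, so by
  Cauchy-Schwarz this quantity is controlled by the L2 norm of \<open>F\<close>.\<close>

definition fourier_tail :: "('b \<Rightarrow> complex) \<Rightarrow> ennreal" where
  "fourier_tail F = (\<integral>\<^sup>+\<xi>. ennreal (norm (fourier F \<xi>)) * ennreal ((1 + norm \<xi>) powr - real DIM('b)) \<partial>lborel)"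

lemma err_const_nonneg: "0 \<le> err_const n"
  by (simp add: err_const_def)

lemma fourier_tail_square_le:
  assumes F: "integrable lborel F"
  shows "(fourier_tail F)\<^sup>2 \<le> (\<integral>\<^sup>+z. ennreal ((norm (F z))\<^sup>2) \<partial>lborel) * (\<integral>\<^sup>+\<xi>. ennreal ((1 + norm (\<xi>::'b)) powr - (2 * real DIM('b))) \<partial>lborel)"
proof -
  have [measurable]: "F \<in> borel_measurable borel" using F by auto
  have "(fourier_tail F)\<^sup>2 \<le> (\<integral>\<^sup>+\<xi>. (ennreal (norm (fourier F \<xi>)))\<^sup>2 \<partial>lborel) *
      (\<integral>\<^sup>+\<xi>. (ennreal ((1 + norm (\<xi>::'b)) powr - real DIM('b)))\<^sup>2 \<partial>lborel)"
    unfolding fourier_tail_def by (rule Cauchy_Schwarz_nn_integral) auto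
  also have "\<dots> = (\<integral>\<^sup>+\<xi>. ennreal ((norm (fourier F \<xi>))\<^sup>2) \<partial>lborel) *
      (\<integral>\<^sup>+\<xi>. ennreal ((1 + norm (\<xi>::'b)) powr - (2 * real DIM('b))) \<partial>lborel)"
    by (simp add: ennreal_power power2_eq_square[of "_ powr _"] flip: powr_add)
  also have "\<dots> \<le> (\<integral>\<^sup>+z. ennreal ((norm (F z))\<^sup>2) \<partial>lborel) *
      (\<integral>\<^sup>+\<xi>. ennreal ((1 + norm (\<xi>::'b)) powr - (2 * real DIM('b))) \<partial>lborel)"
    by (intro mult_right_mono fourier_L2_le F) auto
  finally show ?thesis .
qed

text \<open>Count powers of \<open>q\<close>: the \<open>n\<close>-th power of the step yields
  \<open>n + n * \<kappa>\<close>, the bump against \<open>norm \<xi> ^ n\<close> and a weight of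
  degree \<open>DIM('b)\<close> costs \<open>n + DIM('b)\<close>, and
  \<open>n * \<kappa> \<ge> DIM('b) + 1\<close> leaves one power of \<open>q\<close>.\<close>

lemma difference_symbol_le:
  fixes j :: nat and \<xi> :: 'b
  defines "q \<equiv> (1/2 :: real) ^ j"
  assumes n: "n \<ge> 1" "real DIM('b) + 1 \<le> real n * \<kappa>"
    and h: "\<bar>h\<bar> \<le> q powr (1 + \<kappa>) / (2 * real n)"
  shows "dyadic_bump j \<xi> * (measure \<sigma> UNIV * (2 * pi * \<bar>h\<bar> * norm \<xi>) ^ n) \<le> err_const n * q * (1 + norm \<xi>) powr - real DIM('b)"
proof -
  let ?M = "DIM('b)"
  have q: "0 < q" "q \<le> 1" by (auto simp: q_def power_le_one)
  have "2 * pi * \<bar>h\<bar> \<le> (pi / real n) * q powr (1 + \<kappa>)"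
    using mult_left_mono[OF h, of "2 * pi"] n by (simp add: field_simps)
  then have "(2 * pi * \<bar>h\<bar>) ^ n \<le> ((pi / real n) * q powr (1 + \<kappa>)) ^ n"
    by (intro power_mono) auto
  also have "\<dots> = (pi / real n) ^ n * (q ^ n * q powr (real n * \<kappa>))"
  proof -
    have "(q powr (1 + \<kappa>)) ^ n = q ^ n * q powr (real n * \<kappa>)"
      using q by (simp add: power_mult_distrib powr_add powr_power mult.commute)
    then show ?thesis by (simp only: power_mult_distrib)
  qed
  also have "\<dots> \<le> (pi / real n) ^ n * (q ^ n * q ^ (?M + 1))"
    using powr_mono'[OF n(2), of q] q powr_realpow[of q "?M + 1"]
    by (intro mult_left_mono) (auto simp: add.commute)
  finally have h1: "(2 * pi * \<bar>h\<bar>) ^ n \<le> (pi / real n) ^ n * (q ^ n * q ^ (?M + 1))" .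
  have "dyadic_bump j \<xi> * norm \<xi> ^ n * (1 + norm \<xi>) ^ ?M \<le> fact (n + ?M) * exp (3/2) * 2 ^ (j * (n + ?M))"
    by (rule dyadic_bump_le_decay)
  then have b: "dyadic_bump j \<xi> * norm \<xi> ^ n \<le> fact (n + ?M) * exp (3/2) * (1 / q) ^ (n + ?M) * (1 + norm \<xi>) powr - real ?M"
  proof -
    have "(1 / q) ^ (n + ?M) = 2 ^ (j * (n + ?M))"
      unfolding q_def power_mult by (simp add: power_one_over)
    moreover have "(1 + norm \<xi>) powr - real ?M = 1 / (1 + norm \<xi>) ^ ?M" "(1 + norm \<xi>) ^ ?M > 0"
      by (auto simp: powr_minus_divide powr_realpow add_pos_nonneg)
    ultimately show ?thesis using \<open>_ \<le> fact (n + ?M) * exp (3/2) * 2 ^ (j * (n + ?M))\<close>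
      by (simp only: mult_1_right times_divide_eq_right pos_le_divide_eq)
  qed
  have "dyadic_bump j \<xi> * (measure \<sigma> UNIV * (2 * pi * \<bar>h\<bar> * norm \<xi>) ^ n) =
     measure \<sigma> UNIV * ((2 * pi * \<bar>h\<bar>) ^ n * (dyadic_bump j \<xi> * norm \<xi> ^ n))"
    by (simp add: power_mult_distrib)
  also have "\<dots> \<le> measure \<sigma> UNIV * (((pi / real n) ^ n * (q ^ n * q ^ (?M + 1))) *
     (fact (n + ?M) * exp (3/2) * (1 / q) ^ (n + ?M) * (1 + norm \<xi>) powr - real ?M))"
    using q dyadic_bump_nonneg[of j \<xi>] by (intro mult_left_mono mult_mono h1 b) auto
  also have "\<dots> = err_const n * (q ^ n * q ^ (?M + 1) * (1 / q) ^ (n + ?M)) * (1 + norm \<xi>) powr - real ?M"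
    by (simp add: err_const_def mult_ac)
  also have "q ^ n * q ^ (?M + 1) * (1 / q) ^ (n + ?M) = q"
    using q by (simp add: power_add power_one_over field_simps)
  finally show ?thesis .
qed

lemma piece_difference_le:
  fixes j :: nat
  defines "q \<equiv> (1/2 :: real) ^ j"
  assumes F: "integrable lborel F" and n: "n \<ge> 1" "real DIM('b) + 1 \<le> real n * \<kappa>"
    and h: "\<bar>h\<bar> \<le> q powr (1 + \<kappa>) / (2 * real n)"
  shows "ennreal (norm (\<Sum>k\<le>n. (-1) ^ k * of_nat (n choose k) * piece F j (t + real k * h) x)) \<le> ennreal (err_const n * q) * fourier_tail F"
proof -
  have [measurable]: "F \<in> borel_measurable borel" using F by auto
  have q: "0 < q" by (auto simp: q_def)
  have "ennreal (norm (\<Sum>k\<le>n. (-1) ^ k * of_nat (n choose k) * piece F j (t + real k * h) x)) \<le>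
    (\<integral>\<^sup>+\<xi>. ennreal (norm (fourier F \<xi>) * (dyadic_bump j \<xi> * (measure \<sigma> UNIV * (2 * pi * \<bar>h\<bar> * norm \<xi>) ^ n))) \<partial>lborel)"
    by (rule piece_difference[OF F])
  also have "\<dots> \<le> (\<integral>\<^sup>+\<xi>. ennreal (err_const n * q) * (ennreal (norm (fourier F \<xi>)) * ennreal ((1 + norm \<xi>) powr - real DIM('b))) \<partial>lborel)"
  proof (intro nn_integral_mono)
    fix \<xi> :: 'b
    have "norm (fourier F \<xi>) * (dyadic_bump j \<xi> * (measure \<sigma> UNIV * (2 * pi * \<bar>h\<bar> * norm \<xi>) ^ n)) \<le>
       norm (fourier F \<xi>) * (err_const n * q * (1 + norm \<xi>) powr - real DIM('b))"
      using difference_symbol_le[OF n h[unfolded q_def], of \<xi>] by (intro mult_left_mono) (auto simp: q_def)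
    also have "\<dots> = (err_const n * q) * (norm (fourier F \<xi>) * (1 + norm \<xi>) powr - real DIM('b))"
      by simp
    finally show "ennreal (norm (fourier F \<xi>) * (dyadic_bump j \<xi> * (measure \<sigma> UNIV * (2 * pi * \<bar>h\<bar> * norm \<xi>) ^ n))) \<le>
       ennreal (err_const n * q) * (ennreal (norm (fourier F \<xi>)) * ennreal ((1 + norm \<xi>) powr - real DIM('b)))"
      using q err_const_nonneg[of n] by (simp add: ennreal_leI flip: ennreal_mult)
  qed
  also have "\<dots> = ennreal (err_const n * q) * fourier_tail F"
    unfolding fourier_tail_def by (rule nn_integral_cmult) auto
  finally show ?thesis .
qed

text \<open>A bound on the \<open>n\<close>-th difference with step \<open>h\<close> controls \<open>piece F j t x\<close> by its values at
  \<open>t + k h\<close>; averaging over \<open>0 \<le> h \<le> h0\<close> turns the latter into an integral over \<open>[1, 3]\<close>.\<close>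

lemma piece_sup_le:
  fixes j :: nat
  defines "q \<equiv> (1/2 :: real) ^ j"
  assumes F: "integrable lborel F" and n: "n \<ge> 1" "real DIM('b) + 1 \<le> real n * \<kappa>"
    and t: "t \<in> {1<..<2}"
  shows "ennreal ((norm (piece F j t x))\<^sup>2) \<le> ennreal (4 ^ n) *
     (ennreal (2 * real n * q powr - (1 + \<kappa>)) * (\<integral>\<^sup>+u\<in>{1..3}. ennreal ((norm (piece F j u x))\<^sup>2) \<partial>lborel)
      + (ennreal (err_const n * q) * fourier_tail F)\<^sup>2)"
proof (cases "ennreal (err_const n * q) * fourier_tail F" rule: ennreal_cases)
  case top
  then show ?thesis by (simp add: power2_eq_square ennreal_mult_top)
next
  case (real e)
  have [measurable]: "F \<in> borel_measurable borel" using F by auto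
  have q: "0 < q" "q \<le> 1" by (auto simp: q_def power_le_one)
  \<comment> \<open>Up to a constant the largest step that \<open>piece_difference_le\<close>
    admits, and no larger than \<open>1 / n\<close>: then \<open>t + k h\<close> with
    \<open>k \<le> n\<close> stays in \<open>{1..3}\<close>.\<close>
  define h0 where "h0 = q powr (1 + \<kappa>) / (2 * real n)"
  have h0: "h0 > 0" using q n by (simp add: h0_def)
  have qk: "q powr (1 + \<kappa>) \<le> 1"
    using q \<kappa> by (intro powr_le1) auto
  have inv: "2 * real n * q powr - (1 + \<kappa>) = 1 / h0"
    unfolding h0_def powr_minus_divide by simp
  define I where "I = (\<integral>\<^sup>+u\<in>{1..3}. ennreal ((norm (piece F j u x))\<^sup>2) \<partial>lborel)"
  \<comment> \<open>Index 0 stores the bound \<open>e\<close> for the whole difference in place of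
    the value at \<open>t\<close>, which has been moved to the other side; the coefficients are then
    a full row of binomials with sum \<open>2 ^ n\<close>.\<close>
  define b where "b h k = (if k = 0 then e else norm (piece F j (t + real k * h) x))" for h k
  have b_meas [measurable]: "(\<lambda>h. b h k) \<in> borel_measurable borel" for k
    unfolding b_def by (cases "k = 0") auto
  have le: "norm (piece F j t x) \<le> (\<Sum>k\<le>n. real (n choose k) * b h k)" if h: "h \<in> {0..h0}" for h
  proof -
    let ?c = "\<lambda>k. (-1) ^ k * of_nat (n choose k) * piece F j (t + real k * h) x"
    have "ennreal (norm (\<Sum>k\<le>n. ?c k)) \<le> ennreal e"
      unfolding real(2)[symmetric] q_def by (rule piece_difference_le[OF F n]) (use h in \<open>auto simp: h0_def q_def\<close>)
    then have "norm (\<Sum>k\<le>n. ?c k) \<le> e"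
      using real(1) by simp
    moreover have "(\<Sum>k\<le>n. ?c k) = piece F j t x + (\<Sum>i<n. ?c (Suc i))"
      by (subst sum.atMost_shift) simp
    ultimately have "norm (piece F j t x) \<le> e + norm (\<Sum>i<n. ?c (Suc i))"
      using norm_triangle_ineq4[of "piece F j t x + (\<Sum>i<n. ?c (Suc i))" "\<Sum>i<n. ?c (Suc i)"] by simp
    also have "norm (\<Sum>i<n. ?c (Suc i)) \<le> (\<Sum>i<n. real (n choose Suc i) * b h (Suc i))"
      by (intro order_trans[OF norm_sum] sum_mono) (simp add: norm_mult norm_power b_def)
    also have "e + (\<Sum>i<n. real (n choose Suc i) * b h (Suc i)) = (\<Sum>k\<le>n. real (n choose k) * b h k)"
      by (subst sum.atMost_shift) (simp add: b_def)
    finally show ?thesis by simp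
  qed
  have sq: "ennreal ((norm (piece F j t x))\<^sup>2) \<le> (\<Sum>k\<le>n. ennreal (2 ^ n * real (n choose k)) * ennreal ((b h k)\<^sup>2))"
    if h: "h \<in> {0..h0}" for h
  proof -
    have "(norm (piece F j t x))\<^sup>2 \<le> (\<Sum>k\<le>n. real (n choose k) * b h k)\<^sup>2"
      using le[OF h] by (intro power_mono) auto
    also have "\<dots> \<le> (\<Sum>k\<le>n. real (n choose k)) * (\<Sum>k\<le>n. real (n choose k) * (b h k)\<^sup>2)"
      by (rule weighted_sum_square_le) simp
    also have "(\<Sum>k\<le>n. real (n choose k)) = 2 ^ n"
      using choose_row_sum[of n] by (metis of_nat_numeral of_nat_power of_nat_sum)
    also have "2 ^ n * (\<Sum>k\<le>n. real (n choose k) * (b h k)\<^sup>2) = (\<Sum>k\<le>n. 2 ^ n * real (n choose k) * (b h k)\<^sup>2)"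
      by (simp add: sum_distrib_left mult.assoc)
    finally have "ennreal ((norm (piece F j t x))\<^sup>2) \<le> ennreal (\<Sum>k\<le>n. 2 ^ n * real (n choose k) * (b h k)\<^sup>2)"
      by (rule ennreal_leI)
    also have "\<dots> = (\<Sum>k\<le>n. ennreal (2 ^ n * real (n choose k) * (b h k)\<^sup>2))"
      by (rule sum_ennreal[symmetric]) auto
    finally show ?thesis by (simp add: ennreal_mult)
  qed
  have term_le: "(\<integral>\<^sup>+h\<in>{0..h0}. ennreal ((b h k)\<^sup>2) \<partial>lborel) \<le> I + ennreal h0 * ennreal (e\<^sup>2)" if k: "k \<le> n" for k
  proof (cases "k = 0")
    case True
    then have "(\<integral>\<^sup>+h\<in>{0..h0}. ennreal ((b h k)\<^sup>2) \<partial>lborel) = ennreal h0 * ennreal (e\<^sup>2)"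
      using h0 by (simp add: b_def nn_integral_cmult_indicator) (simp add: mult.commute)
    then show ?thesis by simp
  next
    case False
    define \<psi> where "\<psi> u = ennreal ((norm (piece F j u x))\<^sup>2) * indicator {1..3} u" for u
    have [measurable]: "\<psi> \<in> borel_measurable borel" unfolding \<psi>_def by measurable
    have "(\<integral>\<^sup>+h\<in>{0..h0}. ennreal ((b h k)\<^sup>2) \<partial>lborel) \<le> (\<integral>\<^sup>+h. \<psi> (t + real k * h) \<partial>lborel)"
    proof (intro nn_integral_mono)
      fix h
      have "t + real k * h \<in> {1..3}" if h: "h \<in> {0..h0}"
      proof -
        have "real k * h \<le> real n * h0" using h k by (intro mult_mono) auto
        also have "\<dots> \<le> 1" using qk n by (simp add: h0_def)
        finally have "real k * h \<le> 1" .
        moreover have "0 \<le> real k * h" using h by (intro mult_nonneg_nonneg) auto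
        ultimately show ?thesis using t unfolding greaterThanLessThan_iff atLeastAtMost_iff by linarith
      qed
      then show "ennreal ((b h k)\<^sup>2) * indicator {0..h0} h \<le> \<psi> (t + real k * h)"
        using False by (auto simp: \<psi>_def b_def indicator_def)
    qed
    \<comment> \<open>The Jacobian \<open>k\<close> of the substitution \<open>u = t + k h\<close>
      is at least 1 and may be inserted for free.\<close>
    also have "\<dots> \<le> ennreal \<bar>real k\<bar> * (\<integral>\<^sup>+h. \<psi> (t + real k * h) \<partial>lborel)"
      using False mult_right_mono[of 1 "ennreal \<bar>real k\<bar>" "\<integral>\<^sup>+h. \<psi> (t + real k * h) \<partial>lborel"] by simp
    also have "\<dots> = I"
      unfolding I_def \<psi>_def[symmetric] by (rule nn_integral_real_affine[symmetric]) (use False in auto)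
    finally show ?thesis by (simp add: add_increasing2)
  qed
  have "ennreal h0 * ennreal ((norm (piece F j t x))\<^sup>2) = (\<integral>\<^sup>+h\<in>{0..h0}. ennreal ((norm (piece F j t x))\<^sup>2) \<partial>lborel)"
    using h0 by (simp add: nn_integral_cmult_indicator) (simp add: mult.commute)
  also have "\<dots> \<le> (\<integral>\<^sup>+h\<in>{0..h0}. (\<Sum>k\<le>n. ennreal (2 ^ n * real (n choose k)) * ennreal ((b h k)\<^sup>2)) \<partial>lborel)"
    by (intro nn_integral_mono) (use sq in \<open>auto simp: indicator_def\<close>)
  also have "\<dots> = (\<integral>\<^sup>+h. (\<Sum>k\<le>n. ennreal (2 ^ n * real (n choose k)) * (ennreal ((b h k)\<^sup>2) * indicator {0..h0} h)) \<partial>lborel)"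
    by (intro nn_integral_cong) (simp add: sum_distrib_right mult.assoc)
  also have "\<dots> = (\<Sum>k\<le>n. ennreal (2 ^ n * real (n choose k)) * (\<integral>\<^sup>+h\<in>{0..h0}. ennreal ((b h k)\<^sup>2) \<partial>lborel))"
    by (subst nn_integral_sum) (auto simp: nn_integral_cmult)
  also have "\<dots> \<le> (\<Sum>k\<le>n. ennreal (2 ^ n * real (n choose k)) * (I + ennreal h0 * ennreal (e\<^sup>2)))"
    by (intro sum_mono mult_left_mono term_le) auto
  also have "\<dots> = ennreal (\<Sum>k\<le>n. 2 ^ n * real (n choose k)) * (I + ennreal h0 * ennreal (e\<^sup>2))"
    unfolding sum_distrib_right[symmetric] by (subst sum_ennreal) auto
  \<comment> \<open>One factor \<open>2 ^ n\<close> comes from Cauchy-Schwarz, the other is the row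
    sum.\<close>
  also have "(\<Sum>k\<le>n. 2 ^ n * real (n choose k)) = 4 ^ n"
    using choose_row_sum[of n]
    by (simp flip: sum_distrib_left of_nat_sum) (simp flip: power_mult_distrib)
  finally have "ennreal (1 / h0) * (ennreal h0 * ennreal ((norm (piece F j t x))\<^sup>2)) \<le>
     ennreal (1 / h0) * (ennreal (4 ^ n) * (I + ennreal h0 * ennreal (e\<^sup>2)))"
    by (intro mult_left_mono) auto
  moreover have "ennreal (1 / h0) * (ennreal h0 * c) = c" for c
    using h0 by (simp add: mult.assoc[symmetric] flip: ennreal_mult)
  moreover have "ennreal (1 / h0) * (ennreal (4 ^ n) * (I + ennreal h0 * ennreal (e\<^sup>2))) =
     ennreal (4 ^ n) * (ennreal (1 / h0) * I + ennreal (1 / h0) * (ennreal h0 * ennreal (e\<^sup>2)))"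
    by (simp add: distrib_left mult_ac)
  ultimately have "ennreal ((norm (piece F j t x))\<^sup>2) \<le> ennreal (4 ^ n) * (ennreal (1 / h0) * I + ennreal (e\<^sup>2))"
    by simp
  then show ?thesis
    unfolding inv real(2) I_def by (simp add: ennreal_power real(1))
qed

end

subsection \<open>The local maximal estimate\<close>

context decaying_average
begin

text \<open>Only the difference errors use the ball, and only through its volume; the main part is
  integrated over the whole space. Hence \<open>C\<close> does not depend on \<open>x0\<close>,
  which the later averaging over centres relies on.\<close>

lemma local_maximal_L2:
  "\<exists>C\<ge>0. \<forall>(F :: 'b \<Rightarrow> complex) x0. integrable lborel F \<longrightarrow> (\<exists>M. \<forall>z. norm (F z) \<le> M) \<longrightarrow> continuous_on UNIV F \<longrightarrow>
     (\<integral>\<^sup>+x\<in>ball x0 1. (SUP t\<in>{1<..<2}. ennreal (norm (\<integral>y. F (D x - t *\<^sub>R y) \<partial>\<sigma>)))\<^sup>2 \<partial>lborel)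
       \<le> ennreal C * (\<integral>\<^sup>+z. ennreal ((norm (F z))\<^sup>2) \<partial>lborel)"
proof -
  \<comment> \<open>Each order of differencing gains \<open>(1/2) ^ j\<close> to the power \<kappa>;
    this many orders outweigh the polynomial weight and leave a full power of
    \<open>(1/2) ^ j\<close>.\<close>
  obtain n where n2: "real DIM('b) + 1 < real n * \<kappa>"
    using reals_Archimedean3[OF \<kappa>(1)] by blast
  have n1: "n \<ge> 1"
    using n2 by (cases n) auto
  have "(\<integral>\<^sup>+\<xi>. ennreal ((1 + norm (\<xi>::'b)) powr - (2 * real DIM('b))) \<partial>lborel) < \<infinity>"
    by (rule nn_integral_one_plus_norm_powr_finite) auto
  then obtain W where W: "(\<integral>\<^sup>+\<xi>. ennreal ((1 + norm (\<xi>::'b)) powr - (2 * real DIM('b))) \<partial>lborel) = ennreal W" "0 \<le> W"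
    by (cases "\<integral>\<^sup>+\<xi>. ennreal ((1 + norm (\<xi>::'b)) powr - (2 * real DIM('b))) \<partial>lborel" rule: ennreal_cases) auto
  define V where "V = unit_ball_vol (real DIM('a))"
  have V: "emeasure lborel (ball (x0::'a) 1) = ennreal V" "0 \<le> V" for x0
    by (simp_all add: V_def emeasure_ball)
  \<comment> \<open>\<open>p ^ j\<close> equals \<open>q j powr \<kappa>\<close>: the geometric
    weights for Cauchy-Schwarz over the scales.\<close>
  define p where "p = (1/2 :: real) powr \<kappa>"
  have p: "0 < p" "p < 1" using \<kappa> by (auto simp: p_def powr_def mult_less_0_iff)
  define q where "q j = (1/2 :: real) ^ j" for j :: nat
  have q: "0 < q j" "q j \<le> 1" for j by (auto simp: q_def power_le_one)
  have qp: "q j powr \<kappa> = p ^ j" for j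
    by (simp add: q_def p_def powr_power mult.commute flip: powr_realpow) (simp add: powr_powr mult.commute)
  \<comment> \<open>The bound for the integral of \<open>Q j\<close> over a unit ball, relative to
    the squared L2 norm of \<open>F\<close>: the inner factor 2 is the length of
    \<open>{1..3}\<close>, \<open>W\<close> comes from \<open>fourier_tail_square_le\<close>, and
    \<open>V\<close> is the volume of the ball.\<close>
  define X where "X j = 4 ^ n * (2 * real n * q j powr - (1 + \<kappa>) * (2 * (16 * A\<^sup>2 * B * q j powr (1 + 4 * \<kappa>))) + (err_const n * q j)\<^sup>2 * (W * V))" for j
  define K where "K = 4 ^ n * (64 * real n * A\<^sup>2 * B + (err_const n)\<^sup>2 * (W * V))"
  have X0: "0 \<le> X j" for j
    using B_nonneg W V by (simp add: X_def)
  have K0: "0 \<le> K"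
    using B_nonneg W V by (simp add: K_def)
  have XK: "1 / p ^ j * X j \<le> K * (p\<^sup>2) ^ j" for j
  proof -
    have e0: "1 / p ^ j = q j powr - \<kappa>"
      by (simp add: qp powr_minus_divide)
    have e1: "q j powr - \<kappa> * (q j powr - (1 + \<kappa>) * q j powr (1 + 4 * \<kappa>)) = (p\<^sup>2) ^ j"
    proof -
      have "q j powr - \<kappa> * (q j powr - (1 + \<kappa>) * q j powr (1 + 4 * \<kappa>)) = q j powr (\<kappa> + \<kappa>)"
        by (simp flip: powr_add)
      also have "\<dots> = (p\<^sup>2) ^ j"
        unfolding powr_add qp by (simp add: power2_eq_square power_mult_distrib)
      finally show ?thesis .
    qed
    \<comment> \<open>The error terms have room to spare: \<open>2 - \<kappa>\<close> exceeds
      \<open>2 * \<kappa>\<close>, so they obey the same geometric bound as the main terms.\<close>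
    have e2: "q j powr - \<kappa> * (q j)\<^sup>2 \<le> (p\<^sup>2) ^ j"
    proof -
      have "q j powr - \<kappa> * (q j)\<^sup>2 = q j powr (2 - \<kappa>)"
        using q(1)[of j] by (simp add: powr_diff powr_minus_divide powr_numeral)
      also have "\<dots> \<le> q j powr (\<kappa> + \<kappa>)"
        using q[of j] \<kappa> by (intro powr_mono') auto
      also have "\<dots> = (p\<^sup>2) ^ j"
        unfolding powr_add qp by (simp add: power2_eq_square power_mult_distrib)
      finally show ?thesis .
    qed
    have "1 / p ^ j * X j = 4 ^ n * (64 * real n * A\<^sup>2 * B * (q j powr - \<kappa> * (q j powr - (1 + \<kappa>) * q j powr (1 + 4 * \<kappa>)))
       + (err_const n)\<^sup>2 * (W * V) * (q j powr - \<kappa> * (q j)\<^sup>2))"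
      unfolding e0 X_def power_mult_distrib by algebra
    also have "\<dots> \<le> 4 ^ n * (64 * real n * A\<^sup>2 * B * (p\<^sup>2) ^ j + (err_const n)\<^sup>2 * (W * V) * (p\<^sup>2) ^ j)"
      unfolding e1 using W V by (intro mult_left_mono add_left_mono e2) auto
    also have "\<dots> = K * (p\<^sup>2) ^ j"
      by (simp add: K_def algebra_simps)
    finally show ?thesis .
  qed
  have S1: "(\<Sum>j. ennreal (p ^ j)) = ennreal (1 / (1 - p))"
    using p by (intro suminf_ennreal_eq geometric_sums) auto
  have S2: "(\<Sum>j. ennreal (K * (p\<^sup>2) ^ j)) = ennreal (K * (1 / (1 - p\<^sup>2)))"
    using p K0 by (intro suminf_ennreal_eq sums_mult geometric_sums) (auto simp: power_less_one_iff abs_square_less_1)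
  define C where "C = 1 / (1 - p) * (K * (1 / (1 - p\<^sup>2)))"
  have p2: "p\<^sup>2 < 1" using p by (simp add: power_less_one_iff)
  have C0: "0 \<le> C"
    using p p2 K0 by (simp add: C_def)
  have "(\<integral>\<^sup>+x\<in>ball x0 1. (SUP t\<in>{1<..<2}. ennreal (norm (\<integral>y. F (D x - t *\<^sub>R y) \<partial>\<sigma>)))\<^sup>2 \<partial>lborel)
       \<le> ennreal C * (\<integral>\<^sup>+z. ennreal ((norm (F z))\<^sup>2) \<partial>lborel)"
    if F: "integrable lborel F" and M: "\<And>z. norm (F z) \<le> M" and cont: "continuous_on UNIV F" for F :: "'b \<Rightarrow> complex" and M x0
  proof -
    have [measurable]: "F \<in> borel_measurable borel" using F by auto
    have ball_meas [measurable]: "ball x0 1 \<in> sets borel" by simp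
    define N where "N = (\<integral>\<^sup>+z. ennreal ((norm (F z))\<^sup>2) \<partial>lborel)"
    define I where "I j x = (\<integral>\<^sup>+u\<in>{1..3}. ennreal ((norm (piece F j u x))\<^sup>2) \<partial>lborel)" for j x
    have I_meas [measurable]: "I j \<in> borel_measurable borel" for j
      unfolding I_def by measurable
    define Q where "Q j x = ennreal (4 ^ n) * (ennreal (2 * real n * q j powr - (1 + \<kappa>)) * I j x
      + (ennreal (err_const n * q j) * fourier_tail F)\<^sup>2)" for j x
    have Q_meas [measurable]: "Q j \<in> borel_measurable borel" for j
      unfolding Q_def by measurable
    define R where "R x = (\<Sum>j. ennreal (p ^ j)) * (\<Sum>j. ennreal (1 / p ^ j) * Q j x)" for x
    have SR: "(SUP t\<in>{1<..<2}. ennreal (norm (\<integral>y. F (D x - t *\<^sub>R y) \<partial>\<sigma>)))\<^sup>2 \<le> R x" for x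
    proof (rule SUP_square_le_ennreal)
      fix t :: real assume t: "t \<in> {1<..<2}"
      have "(ennreal (norm (\<integral>y. F (D x - t *\<^sub>R y) \<partial>\<sigma>)))\<^sup>2 \<le> (\<Sum>j. ennreal (norm (piece F j t x)))\<^sup>2"
        by (intro power_mono norm_average_le_suminf[OF F M cont]) auto
      also have "\<dots> \<le> (\<Sum>j. ennreal (p ^ j)) * (\<Sum>j. ennreal (1 / p ^ j) * (ennreal (norm (piece F j t x)))\<^sup>2)"
        by (rule weighted_suminf_square_le) (use p in auto)
      also have "\<dots> \<le> R x"
        unfolding R_def
      proof (rule mult_left_mono, rule suminf_le)
        fix j
        have "(ennreal (norm (piece F j t x)))\<^sup>2 \<le> Q j x"
          using piece_sup_le[OF F n1 less_imp_le[OF n2] t, of j x] by (simp add: Q_def I_def q_def ennreal_power)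
        then show "ennreal (1 / p ^ j) * (ennreal (norm (piece F j t x)))\<^sup>2 \<le> ennreal (1 / p ^ j) * Q j x"
          by (rule mult_left_mono) auto
      qed auto
      finally show "(ennreal (norm (\<integral>y. F (D x - t *\<^sub>R y) \<partial>\<sigma>)))\<^sup>2 \<le> R x" .
    qed (auto intro: exI[of _ "3/2"])
    have Iint: "(\<integral>\<^sup>+x\<in>ball x0 1. I j x \<partial>lborel) \<le> ennreal (2 * (16 * A\<^sup>2 * B * q j powr (1 + 4 * \<kappa>))) * N" for j
    proof -
      let ?c = "16 * A\<^sup>2 * B * q j powr (1 + 4 * \<kappa>)"
      have c: "0 \<le> ?c" using B_nonneg by simp
      have "(\<integral>\<^sup>+x\<in>ball x0 1. I j x \<partial>lborel) \<le> (\<integral>\<^sup>+x. I j x \<partial>lborel)"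
        by (intro nn_integral_mono) (auto simp: indicator_def)
      \<comment> \<open>After the exchange of integrals, \<open>piece_L2\<close> applies at each
        fixed dilation \<open>u \<ge> 1\<close>.\<close>
      also have "\<dots> = (\<integral>\<^sup>+u. \<integral>\<^sup>+x. ennreal ((norm (piece F j u x))\<^sup>2) * indicator {1..3} u \<partial>lborel \<partial>lborel)"
        unfolding I_def by (rule lborel_pair.Fubini') measurable
      also have "\<dots> \<le> (\<integral>\<^sup>+u. (ennreal ?c * N) * indicator {1..3} (u::real) \<partial>lborel)"
      proof (intro nn_integral_mono)
        fix u :: real
        show "(\<integral>\<^sup>+x. ennreal ((norm (piece F j u x))\<^sup>2) * indicator {1..3} u \<partial>lborel) \<le> (ennreal ?c * N) * indicator {1..3} u"
          using piece_L2[OF F, of u j] by (auto simp: indicator_def N_def q_def)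
      qed
      also have "\<dots> = (ennreal ?c * N) * emeasure lborel {1..3::real}"
        by (rule nn_integral_cmult_indicator) auto
      also have "emeasure lborel {1..3::real} = ennreal 2"
        by simp
      also have "(ennreal ?c * N) * ennreal 2 = (ennreal 2 * ennreal ?c) * N"
        by (simp only: mult_ac)
      also have "ennreal 2 * ennreal ?c = ennreal (2 * ?c)"
        using c by (intro ennreal_mult[symmetric]) auto
      finally show ?thesis .
    qed
    have Qint: "(\<integral>\<^sup>+x\<in>ball x0 1. Q j x \<partial>lborel) \<le> ennreal (X j) * N" for j
    proof -
      define c1 where "c1 = 2 * real n * q j powr - (1 + \<kappa>)"
      define c2 where "c2 = 2 * (16 * A\<^sup>2 * B * q j powr (1 + 4 * \<kappa>))"
      define c3 where "c3 = (err_const n * q j)\<^sup>2"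
      define e where "e = ennreal (err_const n * q j) * fourier_tail F"
      have c: "0 \<le> c1" "0 \<le> c2" "0 \<le> c3" using B_nonneg by (auto simp: c1_def c2_def c3_def)
      have "0 \<le> err_const n * q j" using err_const_nonneg[of n] q(1)[of j] by simp
      then have "e\<^sup>2 = ennreal c3 * (fourier_tail F)\<^sup>2"
        by (simp only: e_def c3_def power_mult_distrib[of "ennreal _"] ennreal_power)
      also have "\<dots> \<le> ennreal c3 * (N * ennreal W)"
        using fourier_tail_square_le[OF F] unfolding W N_def by (intro mult_left_mono) auto
      finally have e: "e\<^sup>2 \<le> ennreal c3 * (N * ennreal W)" .
      have Q: "Q j x = ennreal (4 ^ n) * (ennreal c1 * I j x + e\<^sup>2)" for x
        by (simp only: Q_def c1_def e_def)
      have "(\<integral>\<^sup>+x\<in>ball x0 1. Q j x \<partial>lborel) = (\<integral>\<^sup>+x. ennreal (4 ^ n) * (ennreal c1 * (I j x * indicator (ball x0 1) x) + e\<^sup>2 * indicator (ball x0 1) x) \<partial>lborel)"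
        by (simp only: Q distrib_right mult.assoc)
      also have "\<dots> = ennreal (4 ^ n) * (ennreal c1 * (\<integral>\<^sup>+x\<in>ball x0 1. I j x \<partial>lborel) + e\<^sup>2 * ennreal V)"
      proof -
        have lin: "(\<integral>\<^sup>+x. a * (b * f x + g x) \<partial>lborel) = a * (b * (\<integral>\<^sup>+x. f x \<partial>lborel) + (\<integral>\<^sup>+x. g x \<partial>lborel))"
          if [measurable]: "f \<in> borel_measurable borel" "g \<in> borel_measurable borel" for a b and f g :: "'a \<Rightarrow> ennreal"
          by (simp add: nn_integral_cmult nn_integral_add)
        have "(\<integral>\<^sup>+x. e\<^sup>2 * indicator (ball x0 1) x \<partial>lborel) = e\<^sup>2 * ennreal V"
          unfolding V(1)[of x0, symmetric] by (rule nn_integral_cmult_indicator) auto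
        moreover have "(\<lambda>x. I j x * indicator (ball x0 1) x) \<in> borel_measurable borel"
          by (intro borel_measurable_times_ennreal borel_measurable_indicator I_meas ball_meas)
        moreover have "(\<lambda>x. e\<^sup>2 * indicator (ball x0 1) x) \<in> borel_measurable borel"
          by (intro borel_measurable_times_ennreal borel_measurable_indicator borel_measurable_const ball_meas)
        ultimately show ?thesis
          by (simp only: lin)
      qed
      also have "\<dots> \<le> ennreal (4 ^ n) * (ennreal c1 * (ennreal c2 * N) + (ennreal c3 * (N * ennreal W)) * ennreal V)"
        by (intro mult_left_mono add_mono mult_right_mono Iint[of j, folded c2_def] e) auto
      also have "\<dots> = ennreal (4 ^ n) * (ennreal c1 * ennreal c2 + ennreal c3 * (ennreal W * ennreal V)) * N"
        by (simp only: distrib_left distrib_right mult_ac)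
      also have "ennreal c1 * ennreal c2 + ennreal c3 * (ennreal W * ennreal V) = ennreal (c1 * c2 + c3 * (W * V))"
        using c W V by (simp add: ennreal_mult)
      also have "ennreal (4 ^ n) * ennreal (c1 * c2 + c3 * (W * V)) = ennreal (4 ^ n * (c1 * c2 + c3 * (W * V)))"
        using c W V by (intro ennreal_mult[symmetric]) auto
      also have "4 ^ n * (c1 * c2 + c3 * (W * V)) = X j"
        by (simp only: X_def c1_def c2_def c3_def)
      finally show ?thesis .
    qed
    have "(\<integral>\<^sup>+x\<in>ball x0 1. (SUP t\<in>{1<..<2}. ennreal (norm (\<integral>y. F (D x - t *\<^sub>R y) \<partial>\<sigma>)))\<^sup>2 \<partial>lborel) \<le> (\<integral>\<^sup>+x\<in>ball x0 1. R x \<partial>lborel)"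
      by (intro nn_integral_mono mult_right_mono SR) auto
    also have "\<dots> = (\<integral>\<^sup>+x. (\<Sum>j. ennreal (p ^ j)) * (\<Sum>j. ennreal (1 / p ^ j) * (Q j x * indicator (ball x0 1) x)) \<partial>lborel)"
      by (intro nn_integral_cong) (simp add: R_def mult.assoc[symmetric])
    also have "\<dots> = (\<Sum>j. ennreal (p ^ j)) * (\<Sum>j. ennreal (1 / p ^ j) * (\<integral>\<^sup>+x\<in>ball x0 1. Q j x \<partial>lborel))"
      by (simp add: nn_integral_cmult nn_integral_suminf)
    also have "\<dots> \<le> ennreal (1 / (1 - p)) * (\<Sum>j. ennreal (K * (p\<^sup>2) ^ j) * N)"
      unfolding S1
    proof (rule mult_left_mono, rule suminf_le)
      fix j
      have "ennreal (1 / p ^ j) * (\<integral>\<^sup>+x\<in>ball x0 1. Q j x \<partial>lborel) \<le> ennreal (1 / p ^ j) * (ennreal (X j) * N)"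
        by (intro mult_left_mono Qint) auto
      also have "\<dots> = ennreal (1 / p ^ j * X j) * N"
        using p X0[of j] by (subst ennreal_mult) (auto simp only: mult.assoc zero_le_divide_1_iff zero_le_power less_imp_le)
      also have "\<dots> \<le> ennreal (K * (p\<^sup>2) ^ j) * N"
        by (intro mult_right_mono ennreal_leI XK) auto
      finally show "ennreal (1 / p ^ j) * (\<integral>\<^sup>+x\<in>ball x0 1. Q j x \<partial>lborel) \<le> ennreal (K * (p\<^sup>2) ^ j) * N" .
    qed auto
    also have "\<dots> = ennreal (1 / (1 - p)) * (ennreal (K * (1 / (1 - p\<^sup>2))) * N)"
      unfolding ennreal_suminf_multc S2 ..
    also have "\<dots> = ennreal C * N"
      unfolding C_def using p p2 K0 by (subst ennreal_mult) (auto simp: mult.assoc)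
    finally show ?thesis unfolding N_def .
  qed
  with C0 show ?thesis by blast
qed

end

subsection \<open>Product structure of Lebesgue measure on vectors\<close>

lemma prod_Basis_vec: "(\<Prod>b\<in>(Basis :: ('a::euclidean_space ^ 'm) set). g b) = (\<Prod>i\<in>UNIV. \<Prod>u\<in>Basis. g (axis i u))"
proof -
  have "(\<Prod>b\<in>(\<Union>i\<in>UNIV. axis i ` (Basis :: 'a set)). g b) = (\<Prod>i\<in>UNIV. \<Prod>b\<in>axis i ` (Basis :: 'a set). g b)"
    by (rule prod.UNION_disjoint) (auto simp: axis_eq_axis)
  also have "\<dots> = (\<Prod>i\<in>UNIV. \<Prod>u\<in>Basis. g (axis i u))"
    by (intro prod.cong refl, subst prod.reindex) (auto simp: inj_on_def axis_eq_axis)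
  also have "(\<Union>i\<in>UNIV. axis i ` (Basis :: 'a set)) = Basis"
    by (auto simp: Basis_vec_def)
  finally show ?thesis .
qed

lemma measurable_vec_lambda [measurable]:
  "(\<lambda>f. \<chi> i. f i) \<in> PiM UNIV (\<lambda>_::'m::finite. lborel :: 'a::euclidean_space measure) \<rightarrow>\<^sub>M borel"
proof (subst borel_measurable_euclidean_space, rule ballI)
  fix b :: "'a ^ 'm" assume "b \<in> Basis"
  then obtain i u where b: "b = axis i u" by (auto simp: Basis_vec_def)
  show "(\<lambda>f. (\<chi> i. f i) \<bullet> b) \<in> borel_measurable (PiM UNIV (\<lambda>_::'m. lborel :: 'a measure))"
    unfolding b inner_axis by simp
qed

text \<open>Lebesgue measure is determined by its values on boxes, and boxes of vectors are products
  of boxes because the basis consists of the vectors \<open>axis i u\<close>.\<close>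

lemma lborel_vec:
  "lborel = distr (PiM UNIV (\<lambda>_::'m::finite. lborel :: 'a::euclidean_space measure)) borel (\<lambda>f. \<chi> i. f i)"
proof (rule lborel_eqI)
  interpret finite_product_sigma_finite "\<lambda>_::'m. lborel :: 'a measure" UNIV
    by standard auto
  fix l u :: "'a ^ 'm"
  assume lu: "\<And>b. b \<in> Basis \<Longrightarrow> l \<bullet> b \<le> u \<bullet> b"
  have lui: "l $ i \<bullet> b \<le> u $ i \<bullet> b" if "b \<in> Basis" for i b
    using lu[of "axis i b"] that by (auto simp: inner_axis Basis_vec_def)
  have "(\<lambda>f. \<chi> i. f i) -` box l u \<inter> space (PiM UNIV (\<lambda>_::'m. lborel :: 'a measure)) = PiE UNIV (\<lambda>i. box (l $ i) (u $ i))"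
    by (auto simp: space_PiM box_def Basis_vec_def inner_axis)
  then have "emeasure (distr (PiM UNIV (\<lambda>_::'m. lborel :: 'a measure)) borel (\<lambda>f. \<chi> i. f i)) (box l u) =
     emeasure (PiM UNIV (\<lambda>_::'m. lborel :: 'a measure)) (PiE UNIV (\<lambda>i. box (l $ i) (u $ i)))"
    by (subst emeasure_distr) auto
  also have "\<dots> = (\<Prod>i\<in>UNIV. emeasure lborel (box (l $ i) (u $ i)))"
    by (rule measure_times) auto
  also have "\<dots> = (\<Prod>i\<in>UNIV. ennreal (\<Prod>b\<in>Basis. (u $ i - l $ i) \<bullet> b))"
    using lui by (simp add: emeasure_lborel_box)
  also have "\<dots> = ennreal (\<Prod>i\<in>UNIV. \<Prod>b\<in>Basis. (u $ i - l $ i) \<bullet> b)"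
    using lui by (intro prod_ennreal prod_nonneg) (auto simp: inner_diff_left)
  also have "(\<Prod>i\<in>UNIV. \<Prod>b\<in>Basis. (u $ i - l $ i) \<bullet> b) = (\<Prod>b\<in>Basis. (u - l) \<bullet> b)"
    by (simp add: prod_Basis_vec inner_axis)
  finally show "emeasure (distr (PiM UNIV (\<lambda>_::'m. lborel :: 'a measure)) borel (\<lambda>f. \<chi> i. f i)) (box l u) = ennreal (\<Prod>b\<in>Basis. (u - l) \<bullet> b)" .
qed simp

lemma borel_measurable_vec_nth [measurable (raw)]:
  fixes f :: "'b \<Rightarrow> 'a::euclidean_space ^ 'm"
  shows "f \<in> borel_measurable M \<Longrightarrow> (\<lambda>x. f x $ i) \<in> borel_measurable M"
  by (rule borel_measurable_continuous_on[of "\<lambda>z. z $ i"]) (intro continuous_intros)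

lemma nn_integral_lborel_vec:
  assumes [measurable]: "f \<in> borel_measurable borel"
  shows "(\<integral>\<^sup>+z. f (z :: 'a::euclidean_space ^ 'm) \<partial>lborel) = (\<integral>\<^sup>+x. f (\<chi> i. x i) \<partial>PiM UNIV (\<lambda>_::'m. lborel))"
  by (subst lborel_vec, subst nn_integral_distr) auto

lemma nn_integral_lborel_vec_prod:
  fixes f :: "'m::finite \<Rightarrow> 'a::euclidean_space \<Rightarrow> ennreal"
  assumes [measurable]: "\<And>i. f i \<in> borel_measurable borel"
  shows "(\<integral>\<^sup>+z. (\<Prod>i\<in>UNIV. f i (z $ i)) \<partial>lborel) = (\<Prod>i\<in>UNIV. \<integral>\<^sup>+v. f i v \<partial>lborel)"
proof -
  interpret product_sigma_finite "\<lambda>_::'m. lborel :: 'a measure"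
    by standard
  show ?thesis
    by (subst nn_integral_lborel_vec) (auto simp: product_nn_integral_prod)
qed

text \<open>Integrating first in the component \<open>z $ i0\<close> uses up the mass of the kernel; the weight is bounded
  by a product over the remaining \<open>m - 1\<close> components.\<close>

lemma fibre_integral_le:
  fixes a :: real
  assumes m: "CARD('m::finite) \<ge> 2"
    and a: "a > real ((CARD('m) - 1) * DIM('a::euclidean_space)) / 2"
  shows "\<exists>B\<ge>0. \<forall>r>0. \<forall>\<eta>. (\<integral>\<^sup>+z. ennreal (((1 + norm z) powr - a)\<^sup>2 * gauss_kernel r (\<eta> - (\<Sum>i\<in>UNIV. (z :: 'a ^ 'm) $ i))) \<partial>lborel) \<le> ennreal B"
proof -
  interpret product_sigma_finite "\<lambda>_::'m. lborel :: 'a measure"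
    by standard
  obtain i0 :: 'm where True by blast
  define J where "J = UNIV - {i0}"
  have J: "finite J" "i0 \<notin> J" "insert i0 J = UNIV" "card J = CARD('m) - 1" "J \<noteq> {}"
  proof -
    show "card J = CARD('m) - 1" by (simp add: J_def)
    with m show "J \<noteq> {}" by fastforce
  qed (auto simp: J_def)
  define c where "c = real (card J)"
  have c: "c > 0" using J(1,5) by (simp add: c_def card_gt_0_iff)
  \<comment> \<open>The exponent \<open>2 * a\<close> of the squared weight is shared equally among
    the \<open>m - 1\<close> free components; the hypothesis on \<open>a\<close> says exactly that
    each share exceeds the dimension.\<close>
  define q where "q = 2 * a / c"
  have q: "q > real DIM('a)"
    using a c J(4) by (simp add: q_def c_def field_simps)
  have "(\<integral>\<^sup>+v. ennreal ((1 + norm (v::'a)) powr - q) \<partial>lborel) < \<infinity>"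
    by (rule nn_integral_one_plus_norm_powr_finite[OF q])
  then obtain W where W: "(\<integral>\<^sup>+v. ennreal ((1 + norm (v::'a)) powr - q) \<partial>lborel) = ennreal W" "0 \<le> W"
    by (cases "\<integral>\<^sup>+v. ennreal ((1 + norm (v::'a)) powr - q) \<partial>lborel" rule: ennreal_cases) auto
  have weight: "((1 + norm z) powr - a)\<^sup>2 \<le> (\<Prod>i\<in>J. (1 + norm (z $ i)) powr - q)" for z :: "'a ^ 'm"
  proof -
    have "((1 + norm z) powr - a)\<^sup>2 = (1 + norm z) powr - (2 * a)"
      by (simp add: power2_eq_square flip: powr_add)
    also have "\<dots> = (\<Prod>i\<in>J. (1 + norm z) powr - q)"
      using c by (simp add: q_def c_def powr_power add_nonneg_eq_0_iff J(5))
    also have "\<dots> \<le> (\<Prod>i\<in>J. (1 + norm (z $ i)) powr - q)"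
      using q by (intro prod_mono conjI powr_mono2') (auto simp: Finite_Cartesian_Product.norm_nth_le intro: add_pos_nonneg order_trans[OF of_nat_0_le_iff])
    finally show ?thesis .
  qed
  have "(\<integral>\<^sup>+z. ennreal (((1 + norm z) powr - a)\<^sup>2 * gauss_kernel r (\<eta> - (\<Sum>i\<in>UNIV. (z :: 'a ^ 'm) $ i))) \<partial>lborel) \<le> ennreal (W ^ card J)"
    if r: "r > 0" for r \<eta>
  proof -
    let ?g = "\<lambda>v. ennreal (gauss_kernel r v)"
    let ?w = "\<lambda>v::'a. ennreal ((1 + norm v) powr - q)"
    have "(\<integral>\<^sup>+z. ennreal (((1 + norm z) powr - a)\<^sup>2 * gauss_kernel r (\<eta> - (\<Sum>i\<in>UNIV. (z :: 'a ^ 'm) $ i))) \<partial>lborel) \<le>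
      (\<integral>\<^sup>+z. (\<Prod>i\<in>J. ?w (z $ i)) * ?g (\<eta> - (\<Sum>i\<in>UNIV. (z :: 'a ^ 'm) $ i)) \<partial>lborel)"
    proof (intro nn_integral_mono)
      fix z :: "'a ^ 'm"
      have "ennreal (((1 + norm z) powr - a)\<^sup>2 * gauss_kernel r (\<eta> - (\<Sum>i\<in>UNIV. z $ i))) \<le>
         ennreal ((\<Prod>i\<in>J. (1 + norm (z $ i)) powr - q) * gauss_kernel r (\<eta> - (\<Sum>i\<in>UNIV. z $ i)))"
        using r by (intro ennreal_leI mult_right_mono weight) auto
      also have "\<dots> = (\<Prod>i\<in>J. ?w (z $ i)) * ?g (\<eta> - (\<Sum>i\<in>UNIV. z $ i))"
        using r by (simp add: ennreal_mult prod_nonneg prod_ennreal)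
      finally show "ennreal (((1 + norm z) powr - a)\<^sup>2 * gauss_kernel r (\<eta> - (\<Sum>i\<in>UNIV. z $ i))) \<le>
         (\<Prod>i\<in>J. ?w (z $ i)) * ?g (\<eta> - (\<Sum>i\<in>UNIV. z $ i))" .
    qed
    also have "\<dots> = (\<integral>\<^sup>+x. (\<Prod>i\<in>J. ?w (x i)) * ?g (\<eta> - (\<Sum>i\<in>UNIV. x i)) \<partial>PiM (insert i0 J) (\<lambda>_. lborel))"
      by (subst nn_integral_lborel_vec) (auto simp: J(3))
    also have "\<dots> = (\<integral>\<^sup>+x. \<integral>\<^sup>+y. (\<Prod>i\<in>J. ?w ((x(i0 := y)) i)) * ?g (\<eta> - (\<Sum>i\<in>UNIV. (x(i0 := y)) i)) \<partial>lborel \<partial>PiM J (\<lambda>_. lborel))"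
      by (subst product_nn_integral_insert[OF J(1,2)]) (auto simp: J(3))
    also have "\<dots> = (\<integral>\<^sup>+x. (\<Prod>i\<in>J. ?w (x i)) \<partial>PiM J (\<lambda>_. lborel))"
    proof (intro nn_integral_cong)
      fix x :: "'m \<Rightarrow> 'a"
      have p: "(\<Prod>i\<in>J. ?w ((x(i0 := y)) i)) = (\<Prod>i\<in>J. ?w (x i))" for y
        using J(2) by (intro prod.cong) auto
      have s: "\<eta> - (\<Sum>i\<in>UNIV. (x(i0 := y)) i) = (\<eta> - (\<Sum>i\<in>J. x i)) - y" for y
      proof -
        have "(\<Sum>i\<in>UNIV. (x(i0 := y)) i) = y + (\<Sum>i\<in>J. (x(i0 := y)) i)"
          using J(1,2) by (subst J(3)[symmetric]) simp
        also have "(\<Sum>i\<in>J. (x(i0 := y)) i) = (\<Sum>i\<in>J. x i)"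
          using J(2) by (intro sum.cong) auto
        finally show ?thesis by simp
      qed
      show "(\<integral>\<^sup>+y. (\<Prod>i\<in>J. ?w ((x(i0 := y)) i)) * ?g (\<eta> - (\<Sum>i\<in>UNIV. (x(i0 := y)) i)) \<partial>lborel) = (\<Prod>i\<in>J. ?w (x i))"
        unfolding p s by (simp add: nn_integral_cmult gauss_kernel_nn_integral_shift[OF r])
    qed
    also have "\<dots> = ennreal (W ^ card J)"
      using W(2) by (subst product_nn_integral_prod[OF J(1)]) (auto simp: W(1) ennreal_power)
    finally show ?thesis .
  qed
  then show ?thesis
    using W(2) by (intro exI[of _ "W ^ card J"]) auto
qed

text \<open>A crude arithmetic-geometric mean inequality: each of the \<open>CARD('m)\<close>
  factors is at most the corresponding power of the whole sum.\<close>

lemma prod_powr_le_sum: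
  fixes b :: "'m::finite \<Rightarrow> real"
  assumes "\<And>i. 0 \<le> b i"
  shows "(\<Prod>i\<in>UNIV. b i powr (1 / real CARD('m))) \<le> (\<Sum>i\<in>UNIV. b i)"
proof -
  have "(\<Prod>i\<in>UNIV. b i powr (1 / real CARD('m))) \<le> (\<Prod>i\<in>(UNIV::'m set). (\<Sum>i\<in>UNIV. b i) powr (1 / real CARD('m)))"
    using assms by (intro prod_mono conjI powr_mono2) (auto intro: member_le_sum)
  also have "\<dots> = (\<Sum>i\<in>UNIV. b i)"
    using assms by (cases "(\<Sum>i\<in>UNIV. b i) = 0") (auto simp: powr_power sum_nonneg)
  finally show ?thesis .
qed

subsection \<open>From square-integral bounds to other exponents\<close>

lemma schwartz_continuous:
  assumes "schwartz f"
  shows "continuous_on UNIV f"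
proof -
  have "iter_dir_deriv [] f differentiable (at x)" for x
    using assms unfolding schwartz_def by blast
  then show ?thesis
    by (auto simp: continuous_on_eq_continuous_at differentiable_imp_continuous_within)
qed

lemma schwartz_decay:
  assumes "schwartz f"
  shows "\<exists>C. \<forall>x. (1 + norm x) ^ N * norm (f x) \<le> C"
proof -
  have "\<exists>C. \<forall>x. (1 + norm x) ^ N * norm (iter_dir_deriv [] f x) \<le> C"
    using assms unfolding schwartz_def by blast
  then show ?thesis by simp
qed

lemma L2_norm_fun_nonneg: "0 \<le> L2_norm_fun f"
  unfolding L2_norm_fun_def by simp

text \<open>\<open>L2_norm_fun\<close> is built on the Bochner integral, which is 0 by default for
  non-integrable functions, so integrability has to be shown. Decay of order \<open>DIM('a)\<close>
  is enough, as squaring doubles the exponent.\<close>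

lemma schwartz_L2:
  fixes f :: "'a::euclidean_space \<Rightarrow> complex"
  assumes f: "schwartz f"
  shows "(\<integral>\<^sup>+x. ennreal ((norm (f x))\<^sup>2) \<partial>lborel) = ennreal ((L2_norm_fun f)\<^sup>2)"
proof -
  have [measurable]: "f \<in> borel_measurable borel"
    by (intro borel_measurable_continuous_onI schwartz_continuous f)
  obtain C where C: "\<And>x. (1 + norm x) ^ DIM('a) * norm (f x) \<le> C"
    using schwartz_decay[OF f] by blast
  have b: "(norm (f x))\<^sup>2 \<le> C\<^sup>2 * (1 + norm x) powr - (2 * real DIM('a))" for x
  proof -
    have pos: "0 < 1 + norm x" by (simp add: add_pos_nonneg)
    then have "norm (f x) \<le> C * (1 + norm x) powr - real DIM('a)"
      using C[of x] by (simp add: powr_minus_divide powr_realpow pos_le_divide_eq mult.commute)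
    then have "(norm (f x))\<^sup>2 \<le> (C * (1 + norm x) powr - real DIM('a))\<^sup>2"
      by (intro power_mono) auto
    also have "\<dots> = C\<^sup>2 * (1 + norm x) powr - (2 * real DIM('a))"
      by (simp add: power_mult_distrib power2_eq_square[of "_ powr _"] flip: powr_add)
    finally show ?thesis .
  qed
  have "(\<integral>\<^sup>+x. ennreal ((norm (f x))\<^sup>2) \<partial>lborel) \<le> (\<integral>\<^sup>+x. ennreal (C\<^sup>2) * ennreal ((1 + norm (x::'a)) powr - (2 * real DIM('a))) \<partial>lborel)"
    using b by (intro nn_integral_mono) (auto simp: ennreal_leI simp flip: ennreal_mult)
  also have "\<dots> = ennreal (C\<^sup>2) * (\<integral>\<^sup>+x. ennreal ((1 + norm (x::'a)) powr - (2 * real DIM('a))) \<partial>lborel)"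
    by (rule nn_integral_cmult) auto
  also have "\<dots> < \<infinity>"
    using nn_integral_one_plus_norm_powr_finite[of "2 * real DIM('a)", where 'a='a] by (simp add: ennreal_mult_less_top)
  finally have "integrable lborel (\<lambda>x. (norm (f x))\<^sup>2)"
    by (simp add: integrable_iff_bounded)
  then have "(\<integral>\<^sup>+x. ennreal ((norm (f x))\<^sup>2) \<partial>lborel) = ennreal (\<integral>x. (norm (f x))\<^sup>2 \<partial>lborel)"
    by (rule nn_integral_eq_integral) auto
  then show ?thesis
    by (simp add: L2_norm_fun_def)
qed

lemma enn_powr_mono:
  assumes "a \<le> b" "0 \<le> p"
  shows "enn_powr a p \<le> enn_powr b p"
proof (cases "b = \<infinity>")
  case False
  then have "a \<noteq> \<infinity>" using assms(1) by (auto simp: top_unique)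
  moreover have "enn2real a \<le> enn2real b"
    using assms(1) False by (intro enn2real_mono) (auto simp: less_top)
  ultimately show ?thesis
    using False assms(2) by (auto simp: enn_powr_def intro!: ennreal_leI powr_mono2)
qed (simp add: enn_powr_def)

lemma enn_powr_ennreal: "0 \<le> r \<Longrightarrow> enn_powr (ennreal r) p = ennreal (r powr p)"
  by (simp add: enn_powr_def)

lemma enn_powr_measurable [measurable (raw)]:
  "f \<in> borel_measurable M \<Longrightarrow> (\<lambda>x. enn_powr (f x) p) \<in> borel_measurable M"
proof (rule measurable_compose[of f])
  show "(\<lambda>a. enn_powr a p) \<in> borel_measurable borel"
    unfolding enn_powr_def by (rule measurable_If) auto
qed

lemma powr_le_one_plus:
  fixes u :: real
  assumes "0 \<le> u" "0 \<le> c" "c \<le> 1"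
  shows "u powr c \<le> 1 + u"
proof (cases "u \<le> 1")
  case True
  then have "u powr c \<le> 1" using assms by (intro powr_le1) auto
  then show ?thesis using assms by simp
next
  case False
  then have "u powr c \<le> u powr 1" using assms by (intro powr_mono) auto
  then show ?thesis using False by simp
qed

text \<open>Young's inequality \<open>(g / \<lambda>) powr p \<le> 1 + (g / \<lambda>)\<^sup>2\<close> with \<open>\<lambda> = sqrt k\<close> replaces Hoelder's inequality.\<close>

lemma nn_integral_ball_powr_le:
  fixes g :: "'a::euclidean_space \<Rightarrow> ennreal"
  assumes [measurable]: "g \<in> borel_measurable borel"
    and p: "0 < p" "p \<le> 2" and k: "0 \<le> k"
    and L2: "(\<integral>\<^sup>+x\<in>ball x0 1. (g x)\<^sup>2 \<partial>lborel) \<le> ennreal k"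
  shows "(\<integral>\<^sup>+x\<in>ball x0 1. enn_powr (g x) p \<partial>lborel) \<le> ennreal ((1 + unit_ball_vol (real DIM('a))) * k powr (p / 2))"
proof -
  let ?V = "unit_ball_vol (real DIM('a))"
  have V: "emeasure lborel (ball x0 1) = ennreal ?V" "0 \<le> ?V"
    by (simp_all add: emeasure_ball)
  have ball [measurable]: "ball x0 1 \<in> sets borel" by simp
  show ?thesis
  proof (cases "k = 0")
    \<comment> \<open>The normalization by \<open>sqrt k\<close> is impossible here, but then
      \<open>g\<close> vanishes almost everywhere on the ball.\<close>
    case True
    then have "(\<integral>\<^sup>+x\<in>ball x0 1. (g x)\<^sup>2 \<partial>lborel) = 0"
      using L2 by simp
    moreover have "(\<lambda>x. (g x)\<^sup>2 * indicator (ball x0 1) x) \<in> borel_measurable lborel"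
      using ball by auto
    ultimately have "AE x in lborel. (g x)\<^sup>2 * indicator (ball x0 1) x = 0"
      by (simp add: nn_integral_0_iff_AE)
    then have "(\<integral>\<^sup>+x\<in>ball x0 1. enn_powr (g x) p \<partial>lborel) = (\<integral>\<^sup>+x. 0 \<partial>(lborel :: 'a measure))"
      by (intro nn_integral_cong_AE) (auto elim!: eventually_mono simp: enn_powr_def indicator_def split: if_splits)
    then show ?thesis by simp
  next
    case False
    with k have k: "k > 0" by simp
    have point: "enn_powr (g x) p \<le> ennreal (k powr (p / 2)) * (1 + ennreal (1 / k) * (g x)\<^sup>2)" for x
    proof (cases "g x" rule: ennreal_cases)
      case (real r)
      have "r powr p = (r powr 2) powr (p / 2)"
        unfolding powr_powr by simp
      also have "r powr 2 = k * (r\<^sup>2 / k)"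
        using real k by (cases "r = 0") (simp_all add: powr_numeral)
      also have "(k * (r\<^sup>2 / k)) powr (p / 2) = k powr (p / 2) * (r\<^sup>2 / k) powr (p / 2)"
        using k by (subst powr_mult) auto
      also have "\<dots> \<le> k powr (p / 2) * (1 + r\<^sup>2 / k)"
        using p k by (intro mult_left_mono powr_le_one_plus) auto
      finally have "ennreal (r powr p) \<le> ennreal (k powr (p / 2) * (1 + r\<^sup>2 / k))"
        by (rule ennreal_leI)
      also have "\<dots> = ennreal (k powr (p / 2)) * (1 + ennreal (1 / k) * (ennreal r)\<^sup>2)"
      proof -
        have "ennreal (1 + r\<^sup>2 / k) = 1 + ennreal (1 / k) * ennreal (r\<^sup>2)"
          using k by (simp flip: ennreal_mult ennreal_1 ennreal_plus)
        then show ?thesis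
          using k real by (simp add: ennreal_mult ennreal_power)
      qed
      finally show ?thesis
        unfolding real(2) enn_powr_ennreal[OF real(1)] .
    next
      case top
      then show ?thesis
        using k by (simp add: enn_powr_def power2_eq_square ennreal_mult_top ennreal_mult_eq_top_iff)
    qed
    have "(\<integral>\<^sup>+x\<in>ball x0 1. enn_powr (g x) p \<partial>lborel) \<le>
       (\<integral>\<^sup>+x. ennreal (k powr (p / 2)) * (indicator (ball x0 1) x + ennreal (1 / k) * ((g x)\<^sup>2 * indicator (ball x0 1) x)) \<partial>lborel)"
      by (intro nn_integral_mono) (use point in \<open>auto simp: indicator_def\<close>)
    also have "\<dots> = ennreal (k powr (p / 2)) * (emeasure lborel (ball x0 1) + ennreal (1 / k) * (\<integral>\<^sup>+x\<in>ball x0 1. (g x)\<^sup>2 \<partial>lborel))"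
    proof -
      have m: "(\<lambda>x. (g x)\<^sup>2 * indicator (ball x0 1) x) \<in> borel_measurable borel"
        using ball by auto
      have lin: "(\<integral>\<^sup>+x. a * (f x + b * h x) \<partial>lborel) = a * ((\<integral>\<^sup>+x. f x \<partial>lborel) + b * (\<integral>\<^sup>+x. h x \<partial>lborel))"
        if [measurable]: "f \<in> borel_measurable borel" "h \<in> borel_measurable borel" for a b and f h :: "'a \<Rightarrow> ennreal"
        by (simp add: nn_integral_cmult nn_integral_add)
      show ?thesis
        using m ball by (simp only: lin borel_measurable_indicator) simp
    qed
    also have "\<dots> \<le> ennreal (k powr (p / 2)) * (ennreal ?V + ennreal (1 / k) * ennreal k)"
      unfolding V by (intro mult_left_mono add_left_mono L2) auto
    also have "\<dots> = ennreal ((1 + ?V) * k powr (p / 2))"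
      using k V(2) by (simp add: mult.commute add.commute flip: ennreal_mult ennreal_plus ennreal_1)
    finally show ?thesis .
  qed
qed

section \<open>Measurability and localization of the maximal function\<close>

text \<open>The supremum is over uncountably many \<open>t\<close>, so measurability comes from
  lower semicontinuity: each average is continuous in \<open>x\<close> by dominated convergence, and
  strict superlevel sets of the supremum are unions of open sets.\<close>

lemma max_loc_measurable:
  fixes F :: "'m::finite \<Rightarrow> real ^ 'd \<Rightarrow> complex"
  assumes fin: "finite_measure \<sigma>" and sets: "sets \<sigma> = sets borel"
    and cont: "\<And>i. continuous_on UNIV (F i)" and bdd: "\<And>i. \<exists>M. \<forall>x. norm (F i x) \<le> M"
  shows "max_loc \<sigma> F \<in> borel_measurable borel"
proof -
  interpret finite_measure \<sigma> by fact
  note [measurable_cong] = sets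
  have [measurable]: "F i \<in> borel_measurable borel" for i
    by (intro borel_measurable_continuous_onI cont)
  obtain M where M: "\<And>i x. norm (F i x) \<le> M i"
    using bdd by metis
  define g where "g t x = (\<integral>y. (\<Prod>i\<in>UNIV. F i (x - t *\<^sub>R (y $ i))) \<partial>\<sigma>)" for t x
  have "isCont (g t) x" for t x
    unfolding continuous_at_sequentially comp_def
  proof (intro allI impI)
    fix u assume u: "u \<longlonglongrightarrow> x"
    show "(\<lambda>n. g t (u n)) \<longlonglongrightarrow> g t x"
      unfolding g_def
    proof (rule integral_dominated_convergence)
      show "integrable \<sigma> (\<lambda>_. \<Prod>i\<in>UNIV. M i)" by simp
      show "AE y in \<sigma>. (\<lambda>n. \<Prod>i\<in>UNIV. F i (u n - t *\<^sub>R (y $ i))) \<longlonglongrightarrow> (\<Prod>i\<in>UNIV. F i (x - t *\<^sub>R (y $ i)))"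
      proof (intro AE_I2 tendsto_prod)
        fix y i
        have "isCont (F i) (x - t *\<^sub>R (y $ i))"
          using cont[of i] by (simp add: continuous_on_eq_continuous_at)
        moreover have "(\<lambda>n. u n - t *\<^sub>R (y $ i)) \<longlonglongrightarrow> x - t *\<^sub>R (y $ i)"
          by (intro tendsto_intros u)
        ultimately show "(\<lambda>n. F i (u n - t *\<^sub>R (y $ i))) \<longlonglongrightarrow> F i (x - t *\<^sub>R (y $ i))"
          using isCont_tendsto_compose by blast
      qed
      show "AE y in \<sigma>. norm (\<Prod>i\<in>UNIV. F i (u n - t *\<^sub>R (y $ i))) \<le> (\<Prod>i\<in>UNIV. M i)" for n
        by (intro AE_I2) (auto simp: prod_norm[symmetric] intro!: prod_mono M)
    qed measurable
  qed
  then have "continuous_on UNIV (\<lambda>x. ennreal (norm (g t x)))" for t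
    by (intro continuous_intros continuous_on_ennreal) (simp add: continuous_on_eq_continuous_at)
  then have op: "open {x. c < ennreal (norm (g t x))}" for c t
    by (intro open_Collect_less) auto
  show ?thesis
  proof (rule borel_measurableI_greater)
    fix c
    have "{x \<in> space borel. c < max_loc \<sigma> F x} = (\<Union>t\<in>{1<..<2}. {x. c < ennreal (norm (g t x))})"
      by (auto simp: max_loc_def g_def less_SUP_iff)
    also have "\<dots> \<in> sets borel"
      using op by (intro borel_open open_UN) auto
    finally show "{x \<in> space borel. c < max_loc \<sigma> F x} \<in> sets borel" .
  qed
qed

text \<open>The radius 3 on which it equals 1 is \<open>1 + 2 * 1\<close>: \<open>x\<close> within
  distance 1 of the centre, \<open>t < 2\<close>, and components of \<open>y\<close> of norm at most
  1. The support has radius 4.\<close>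

definition cutoff :: "'a::real_normed_vector \<Rightarrow> 'a \<Rightarrow> real" where
  "cutoff x0 v = max 0 (min 1 (4 - norm (v - x0)))"

lemma cutoff_bounds: "0 \<le> cutoff x0 v" "cutoff x0 v \<le> 1" "cutoff x0 v \<le> indicator (cball x0 4) v"
  by (auto simp: cutoff_def dist_norm norm_minus_commute indicator_def)

lemma cutoff_eq_1: "norm (v - x0) \<le> 3 \<Longrightarrow> cutoff x0 v = 1"
  by (simp add: cutoff_def)

lemma continuous_on_cutoff: "continuous_on S (cutoff x0)"
  unfolding cutoff_def[abs_def] by (intro continuous_intros)

lemma prod_mono_ennreal:
  fixes f g :: "'i \<Rightarrow> ennreal"
  assumes "\<And>i. i \<in> I \<Longrightarrow> f i \<le> g i"
  shows "(\<Prod>i\<in>I. f i) \<le> (\<Prod>i\<in>I. g i)"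
  using assms by (induction I rule: infinite_finite_induct) (auto intro: mult_mono)

text \<open>Compact support and continuity provide the integrability and boundedness that
  \<open>local_maximal_L2\<close> asks for, while Tonelli splits the squared norm into local masses
  of the single functions.\<close>

lemma cutoff_tensor:
  fixes F :: "'m::finite \<Rightarrow> 'a::euclidean_space \<Rightarrow> complex" and x0 :: 'a
  defines "G \<equiv> (\<lambda>z :: 'a ^ 'm. \<Prod>i\<in>UNIV. of_real (cutoff x0 (z $ i)) * F i (z $ i))"
  assumes cont: "\<And>i. continuous_on UNIV (F i)"
  shows "continuous_on UNIV G" (is ?c) "integrable lborel G" (is ?i) "\<exists>M. \<forall>z. norm (G z) \<le> M" (is ?b)
    "(\<integral>\<^sup>+z. ennreal ((norm (G z))\<^sup>2) \<partial>lborel) \<le> (\<Prod>i\<in>UNIV. \<integral>\<^sup>+v\<in>cball x0 4. ennreal ((norm (F i v))\<^sup>2) \<partial>lborel)" (is ?n)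
proof -
  define g where "g i v = of_real (cutoff x0 v) * F i v" for i v
  have G: "G = (\<lambda>z. \<Prod>i\<in>UNIV. g i (z $ i))"
    by (simp add: G_def g_def)
  have gc: "continuous_on UNIV (g i)" for i
    unfolding g_def by (intro continuous_on_mult continuous_on_of_real continuous_on_cutoff cont)
  have g_meas [measurable]: "g i \<in> borel_measurable borel" for i
    by (rule borel_measurable_continuous_onI[OF gc])
  have F_meas [measurable]: "F i \<in> borel_measurable borel" for i
    by (rule borel_measurable_continuous_onI[OF cont])
  have "\<forall>i. \<exists>M. 0 \<le> M \<and> (\<forall>v. norm (g i v) \<le> M * indicator (cball x0 4) v)"
  proof
    fix i
    have "compact (F i ` cball x0 4)"
      by (intro compact_continuous_image continuous_on_subset[OF cont]) auto
    then have "bounded (F i ` cball x0 4)"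
      by (rule compact_imp_bounded)
    then obtain M where "\<forall>y\<in>F i ` cball x0 4. norm y \<le> M"
      unfolding bounded_iff by (rule exE)
    then have M: "norm (F i v) \<le> M" if "v \<in> cball x0 4" for v
      using that by simp
    have "norm (g i v) \<le> max 0 M * indicator (cball x0 4) v" for v
    proof (cases "v \<in> cball x0 4")
      case True
      have "norm (g i v) = cutoff x0 v * norm (F i v)"
        using cutoff_bounds(1)[of x0 v] by (simp add: g_def norm_mult)
      also have "\<dots> \<le> 1 * max 0 M"
        using M[OF True] cutoff_bounds[of x0 v] by (intro mult_mono) auto
      finally show ?thesis using True by simp
    next
      case False
      then have "cutoff x0 v = 0" using cutoff_bounds[of x0 v] by simp
      then show ?thesis by (simp add: g_def)
    qed
    then show "\<exists>M. 0 \<le> M \<and> (\<forall>v. norm (g i v) \<le> M * indicator (cball x0 4) v)"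
      by (intro exI[of _ "max 0 M"]) auto
  qed
  from choice[OF this] obtain M where M: "\<And>i. 0 \<le> M i" "\<And>i v. norm (g i v) \<le> M i * indicator (cball x0 4) v"
    by auto
  have M1: "norm (g i v) \<le> M i" for i v
    using M(2)[of i v] M(1)[of i] by (auto simp: indicator_def split: if_splits intro: order_trans)
  show ?c
    unfolding G by (intro continuous_on_prod continuous_on_compose2[OF gc] continuous_intros) auto
  then have [measurable]: "G \<in> borel_measurable borel"
    by (rule borel_measurable_continuous_onI)
  show ?b
    unfolding G by (intro exI[of _ "\<Prod>i\<in>UNIV. M i"]) (auto simp: prod_norm[symmetric] intro!: prod_mono M1)
  show ?i
  proof -
    have gI: "integrable lborel (g i)" for i
    proof (rule Bochner_Integration.integrable_bound)
      show "integrable lborel (\<lambda>v. M i * indicator (cball x0 4) v)"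
        using emeasure_lborel_cball_finite[of x0 4] by (intro integrable_mult_right integrable_real_indicator) auto
    qed (use M in auto)
    have "(\<integral>\<^sup>+z. ennreal (norm (G z)) \<partial>lborel) = (\<integral>\<^sup>+z. (\<Prod>i\<in>UNIV. ennreal (norm (g i (z $ i)))) \<partial>lborel)"
      by (simp add: G prod_ennreal prod_norm[symmetric])
    also have "\<dots> = (\<Prod>i\<in>UNIV. \<integral>\<^sup>+v. ennreal (norm (g i v)) \<partial>lborel)"
      by (rule nn_integral_lborel_vec_prod) auto
    also have "\<dots> = (\<Prod>i\<in>UNIV. ennreal (\<integral>v. norm (g i v) \<partial>lborel))"
      by (intro prod.cong refl nn_integral_eq_integral integrable_norm gI) auto
    also have "\<dots> < \<infinity>"
      by (subst prod_ennreal) auto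
    finally show ?thesis by (simp add: integrable_iff_bounded)
  qed
  have "(\<integral>\<^sup>+z. ennreal ((norm (G z))\<^sup>2) \<partial>lborel) = (\<integral>\<^sup>+z. (\<Prod>i\<in>UNIV. ennreal ((norm (g i (z $ i)))\<^sup>2)) \<partial>lborel)"
    by (simp add: G prod_ennreal prod_norm[symmetric] prod_power_distrib)
  also have "\<dots> = (\<Prod>i\<in>UNIV. \<integral>\<^sup>+v. ennreal ((norm (g i v))\<^sup>2) \<partial>lborel)"
    by (rule nn_integral_lborel_vec_prod) auto
  also have "\<dots> \<le> (\<Prod>i\<in>UNIV. \<integral>\<^sup>+v\<in>cball x0 4. ennreal ((norm (F i v))\<^sup>2) \<partial>lborel)"
  proof (intro prod_mono_ennreal nn_integral_mono)
    fix i v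
    show "ennreal ((norm (g i v))\<^sup>2) \<le> ennreal ((norm (F i v))\<^sup>2) * indicator (cball x0 4) v"
    proof (cases "v \<in> cball x0 4")
      case True
      have "norm (g i v) \<le> 1 * norm (F i v)"
        unfolding g_def norm_mult using cutoff_bounds[of x0 v] by (intro mult_right_mono) auto
      then show ?thesis using True by (simp add: ennreal_leI)
    next
      case False
      then have "cutoff x0 v = 0" using cutoff_bounds[of x0 v] by simp
      then show ?thesis by (simp add: g_def)
    qed
  qed
  finally show ?n .
qed

text \<open>On the unit ball around \<open>x0\<close> the averages do not see the cutoff, so
  \<open>F\<close> may be replaced by the cut-off tensor product. The locality of the right side is
  what the passage to the whole space exploits.\<close>

lemma max_loc_local_L2:
  fixes \<sigma> :: "(real^'d^'m) measure" and s :: real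
  assumes m2: "CARD('m) \<ge> 2"
    and s_gt: "s > real ((CARD('m) - 1) * CARD('d)) / 2 + 1 / 2"
    and sets_\<sigma>: "sets \<sigma> = sets borel"
    and fin: "finite_measure \<sigma>"
    and supp: "emeasure \<sigma> (UNIV - cball 0 1) = 0"
    and decay: "\<And>\<xi>. norm (fourier_measure \<sigma> \<xi>) \<le> A * (1 + norm \<xi>) powr (- s)"
  shows "\<exists>C\<ge>0. \<forall>(F :: 'm \<Rightarrow> real^'d \<Rightarrow> complex) x0. (\<forall>i. continuous_on UNIV (F i)) \<longrightarrow>
    (\<integral>\<^sup>+x\<in>ball x0 1. (max_loc \<sigma> F x)\<^sup>2 \<partial>lborel) \<le> ennreal C * (\<Prod>i\<in>UNIV. \<integral>\<^sup>+v\<in>cball x0 4. ennreal ((norm (F i v))\<^sup>2) \<partial>lborel)"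
proof -
  define e where "e = s - (real ((CARD('m) - 1) * CARD('d)) / 2 + 1 / 2)"
  \<comment> \<open>The excess \<open>e\<close> of decay is divided in three: one \<kappa> raises
    \<open>a\<close> above the critical exponent, and two enter the decay hypothesis of the
    locale.\<close>
  define \<kappa> where "\<kappa> = min (e / 3) (1 / 2)"
  define a where "a = real ((CARD('m) - 1) * CARD('d)) / 2 + \<kappa>"
  have \<kappa>: "0 < \<kappa>" "\<kappa> \<le> 1 / 2" "3 * \<kappa> \<le> e"
  proof -
    have "e > 0" using s_gt by (simp add: e_def)
    then show "0 < \<kappa>" "\<kappa> \<le> 1 / 2" "3 * \<kappa> \<le> e"
      unfolding \<kappa>_def min_def by auto
  qed
  have "a > real ((CARD('m) - 1) * DIM(real^'d)) / 2"
    using \<kappa> by (simp add: a_def)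
  then obtain B where B: "0 \<le> B" "\<And>r \<eta>. 0 < r \<Longrightarrow>
     (\<integral>\<^sup>+z. ennreal (((1 + norm z) powr - a)\<^sup>2 * gauss_kernel r (\<eta> - (\<Sum>i\<in>UNIV. (z :: real^'d^'m) $ i))) \<partial>lborel) \<le> ennreal B"
    using fibre_integral_le[OF m2, of a, where 'a="real^'d"] by blast
  have A: "0 \<le> A"
    using order_trans[OF norm_ge_zero decay[of 0]] by simp
  interpret finite_measure \<sigma> by fact
  interpret decaying_average \<sigma> "\<lambda>x :: real^'d. \<chi> i. x" "\<lambda>\<xi>. \<Sum>i\<in>UNIV. \<xi> $ i" A a \<kappa> B
  proof
    show "norm (fourier_measure \<sigma> \<xi>) \<le> A * (1 + norm \<xi>) powr - (a + 1 / 2 + 2 * \<kappa>)" for \<xi>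
    proof -
      have "(1 + norm \<xi>) powr - s \<le> (1 + norm \<xi>) powr - (a + 1 / 2 + 2 * \<kappa>)"
        using \<kappa> by (intro powr_mono) (auto simp: a_def e_def)
      from mult_left_mono[OF this A] show ?thesis
        using decay[of \<xi>] by (rule order_trans[rotated])
    qed
    show "(\<chi> i. x) \<bullet> \<xi> = x \<bullet> (\<Sum>i\<in>UNIV. \<xi> $ i)" for x :: "real^'d" and \<xi> :: "real^'d^'m"
      by (simp add: inner_vec_def[of "\<chi> i. x" \<xi>] inner_sum_right)
    show "0 \<le> a" using \<kappa> by (simp add: a_def)
  qed (use sets_\<sigma> supp \<kappa> B in auto)
  obtain C where C: "0 \<le> C" "\<And>(G :: real^'d^'m \<Rightarrow> complex) x0 M. integrable lborel G \<Longrightarrow> (\<And>z. norm (G z) \<le> M) \<Longrightarrow> continuous_on UNIV G \<Longrightarrow>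
     (\<integral>\<^sup>+x\<in>ball x0 1. (SUP t\<in>{1<..<2}. ennreal (norm (\<integral>y. G ((\<chi> i. x) - t *\<^sub>R y) \<partial>\<sigma>)))\<^sup>2 \<partial>lborel)
       \<le> ennreal C * (\<integral>\<^sup>+z. ennreal ((norm (G z))\<^sup>2) \<partial>lborel)"
    using local_maximal_L2 by blast
  have "(\<integral>\<^sup>+x\<in>ball x0 1. (max_loc \<sigma> F x)\<^sup>2 \<partial>lborel) \<le> ennreal C * (\<Prod>i\<in>UNIV. \<integral>\<^sup>+v\<in>cball x0 4. ennreal ((norm (F i v))\<^sup>2) \<partial>lborel)"
    if cont: "\<And>i. continuous_on UNIV (F i)" for F :: "'m \<Rightarrow> real^'d \<Rightarrow> complex" and x0
  proof -
    define G where "G = (\<lambda>z :: real^'d^'m. \<Prod>i\<in>UNIV. of_real (cutoff x0 (z $ i)) * F i (z $ i))"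
    have G: "continuous_on UNIV G" "integrable lborel G" "\<exists>M. \<forall>z. norm (G z) \<le> M"
      "(\<integral>\<^sup>+z. ennreal ((norm (G z))\<^sup>2) \<partial>lborel) \<le> (\<Prod>i\<in>UNIV. \<integral>\<^sup>+v\<in>cball x0 4. ennreal ((norm (F i v))\<^sup>2) \<partial>lborel)"
      unfolding G_def by (rule cutoff_tensor[OF cont])+
    obtain M where M: "\<And>z. norm (G z) \<le> M" using G(3) by blast
    have F_meas [measurable]: "F i \<in> borel_measurable borel" for i
      by (rule borel_measurable_continuous_onI[OF cont])
    have G_meas [measurable]: "G \<in> borel_measurable borel"
      by (rule borel_measurable_continuous_onI[OF G(1)])
    \<comment> \<open>For \<sigma>-almost every \<open>y\<close> each argument
      \<open>x - t y_i\<close> lies within distance 3 of \<open>x0\<close>, where the cutoff is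
      1.\<close>
    have eq: "(\<integral>y. (\<Prod>i\<in>UNIV. F i (x - t *\<^sub>R (y $ i))) \<partial>\<sigma>) = (\<integral>y. G ((\<chi> i. x) - t *\<^sub>R y) \<partial>\<sigma>)"
      if x: "x \<in> ball x0 1" and t: "t \<in> {1<..<2}" for x t
    proof (rule integral_cong_AE)
      show "AE y in \<sigma>. (\<Prod>i\<in>UNIV. F i (x - t *\<^sub>R (y $ i))) = G ((\<chi> i. x) - t *\<^sub>R y)"
        using AE_norm_le_1
      proof eventually_elim
        case (elim y)
        have "cutoff x0 (x - t *\<^sub>R (y $ i)) = 1" for i
        proof (rule cutoff_eq_1)
          have "norm (y $ i) \<le> 1"
            using Finite_Cartesian_Product.norm_nth_le[of y i] elim by simp
          then have "t * norm (y $ i) \<le> 2 * 1"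
            using t by (intro mult_mono) auto
          moreover have "norm (x - t *\<^sub>R (y $ i) - x0) \<le> norm (x - x0) + t * norm (y $ i)"
            using norm_triangle_ineq4[of "x - x0" "t *\<^sub>R (y $ i)"] t by (simp add: algebra_simps)
          moreover have "norm (x - x0) < 1"
            using x by (simp add: dist_norm norm_minus_commute)
          ultimately show "norm (x - t *\<^sub>R (y $ i) - x0) \<le> 3" by simp
        qed
        then show ?case by (simp add: G_def)
      qed
    qed measurable
    have "(\<integral>\<^sup>+x\<in>ball x0 1. (max_loc \<sigma> F x)\<^sup>2 \<partial>lborel) =
      (\<integral>\<^sup>+x\<in>ball x0 1. (SUP t\<in>{1<..<2}. ennreal (norm (\<integral>y. G ((\<chi> i. x) - t *\<^sub>R y) \<partial>\<sigma>)))\<^sup>2 \<partial>lborel)"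
    proof (intro nn_integral_cong)
      fix x
      show "(max_loc \<sigma> F x)\<^sup>2 * indicator (ball x0 1) x = (SUP t\<in>{1<..<2}. ennreal (norm (\<integral>y. G ((\<chi> i. x) - t *\<^sub>R y) \<partial>\<sigma>)))\<^sup>2 * indicator (ball x0 1) x"
      proof (cases "x \<in> ball x0 1")
        case True
        then show ?thesis
          unfolding max_loc_def by (simp only: eq cong: SUP_cong)
      qed simp
    qed
    also have "\<dots> \<le> ennreal C * (\<integral>\<^sup>+z. ennreal ((norm (G z))\<^sup>2) \<partial>lborel)"
      by (rule C(2)[OF G(2) M G(1)])
    also have "\<dots> \<le> ennreal C * (\<Prod>i\<in>UNIV. \<integral>\<^sup>+v\<in>cball x0 4. ennreal ((norm (F i v))\<^sup>2) \<partial>lborel)"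
      by (intro mult_left_mono G(4)) auto
    finally show ?thesis .
  qed
  with C(1) show ?thesis by blast
qed

section \<open>Averaging over centres of balls, and the two final estimates\<close>

lemma nn_integral_cball_measurable [measurable]:
  fixes h :: "'a::euclidean_space \<Rightarrow> ennreal"
  assumes [measurable]: "h \<in> borel_measurable borel"
  shows "(\<lambda>x0. \<integral>\<^sup>+x\<in>cball x0 r. h x \<partial>lborel) \<in> borel_measurable borel"
proof -
  have c: "indicator (cball x0 r) x = (indicator {p. dist (fst p) (snd p) \<le> r} (x0, x) :: ennreal)" for x0 x :: 'a
    by (auto simp: indicator_def)
  have "closed {p :: 'a \<times> 'a. dist (fst p) (snd p) \<le> r}"
    by (intro closed_Collect_le continuous_intros)
  then have [measurable]: "{p :: 'a \<times> 'a. dist (fst p) (snd p) \<le> r} \<in> sets (borel \<Otimes>\<^sub>M borel)"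
    unfolding borel_prod by simp
  show ?thesis
    unfolding c by measurable
qed

text \<open>Tonelli and symmetry of the distance: a point \<open>x\<close> is counted by exactly
  those centres that lie in the ball of radius \<open>r\<close> around \<open>x\<close>.\<close>

lemma nn_integral_average_ball:
  fixes h :: "'a::euclidean_space \<Rightarrow> ennreal"
  assumes [measurable]: "h \<in> borel_measurable borel" and r: "0 \<le> r"
  shows "(\<integral>\<^sup>+x0. (\<integral>\<^sup>+x\<in>cball x0 r. h x \<partial>lborel) \<partial>lborel) = ennreal (unit_ball_vol (real DIM('a)) * r ^ DIM('a)) * (\<integral>\<^sup>+x. h x \<partial>lborel)"
    and "(\<integral>\<^sup>+x0. (\<integral>\<^sup>+x\<in>ball x0 r. h x \<partial>lborel) \<partial>lborel) = ennreal (unit_ball_vol (real DIM('a)) * r ^ DIM('a)) * (\<integral>\<^sup>+x. h x \<partial>lborel)"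
proof -
  have c: "indicator (cball x0 r) x = (indicator {p. dist (fst p) (snd p) \<le> r} (x0, x) :: ennreal)"
    "indicator (ball x0 r) x = (indicator {p. dist (fst p) (snd p) < r} (x0, x) :: ennreal)" for x0 x :: 'a
    by (auto simp: indicator_def)
  have "closed {p :: 'a \<times> 'a. dist (fst p) (snd p) \<le> r}" "open {p :: 'a \<times> 'a. dist (fst p) (snd p) < r}"
    by (intro closed_Collect_le open_Collect_less continuous_intros)+
  then have S [measurable]: "{p :: 'a \<times> 'a. dist (fst p) (snd p) \<le> r} \<in> sets (lborel \<Otimes>\<^sub>M lborel)"
    "{p :: 'a \<times> 'a. dist (fst p) (snd p) < r} \<in> sets (lborel \<Otimes>\<^sub>M lborel)"
    unfolding lborel_prod by auto
  have cm: "(\<lambda>(x, x0). h x * indicator (cball x0 r) x) \<in> borel_measurable (lborel \<Otimes>\<^sub>M lborel)"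
    "(\<lambda>(x, x0). h x * indicator (ball x0 r) x) \<in> borel_measurable (lborel \<Otimes>\<^sub>M lborel)"
    unfolding c by measurable
  have "(\<integral>\<^sup>+x0. (\<integral>\<^sup>+x\<in>cball x0 r. h x \<partial>lborel) \<partial>lborel) = (\<integral>\<^sup>+x. \<integral>\<^sup>+x0. h x * indicator (cball x0 r) x \<partial>lborel \<partial>lborel)"
    by (rule lborel_pair.Fubini'[OF cm(1)])
  also have "\<dots> = (\<integral>\<^sup>+x. h x * ennreal (unit_ball_vol (real DIM('a)) * r ^ DIM('a)) \<partial>lborel)"
  proof (intro nn_integral_cong)
    fix x
    have "(\<integral>\<^sup>+x0. h x * indicator (cball x0 r) x \<partial>lborel) = (\<integral>\<^sup>+x0. h x * indicator (cball x r) x0 \<partial>lborel)"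
      by (intro nn_integral_cong) (simp add: indicator_def dist_commute)
    also have "\<dots> = h x * emeasure lborel (cball x r)"
      by (rule nn_integral_cmult_indicator) simp
    finally show "(\<integral>\<^sup>+x0. h x * indicator (cball x0 r) x \<partial>lborel) = h x * ennreal (unit_ball_vol (real DIM('a)) * r ^ DIM('a))"
      using r by (simp add: emeasure_cball)
  qed
  finally show "(\<integral>\<^sup>+x0. (\<integral>\<^sup>+x\<in>cball x0 r. h x \<partial>lborel) \<partial>lborel) = ennreal (unit_ball_vol (real DIM('a)) * r ^ DIM('a)) * (\<integral>\<^sup>+x. h x \<partial>lborel)"
    by (simp add: nn_integral_multc mult.commute)
  have "(\<integral>\<^sup>+x0. (\<integral>\<^sup>+x\<in>ball x0 r. h x \<partial>lborel) \<partial>lborel) = (\<integral>\<^sup>+x. \<integral>\<^sup>+x0. h x * indicator (ball x0 r) x \<partial>lborel \<partial>lborel)"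
    by (rule lborel_pair.Fubini'[OF cm(2)])
  also have "\<dots> = (\<integral>\<^sup>+x. h x * ennreal (unit_ball_vol (real DIM('a)) * r ^ DIM('a)) \<partial>lborel)"
  proof (intro nn_integral_cong)
    fix x
    have "(\<integral>\<^sup>+x0. h x * indicator (ball x0 r) x \<partial>lborel) = (\<integral>\<^sup>+x0. h x * indicator (ball x r) x0 \<partial>lborel)"
      by (intro nn_integral_cong) (simp add: indicator_def dist_commute)
    also have "\<dots> = h x * emeasure lborel (ball x r)"
      by (rule nn_integral_cmult_indicator) simp
    finally show "(\<integral>\<^sup>+x0. h x * indicator (ball x0 r) x \<partial>lborel) = h x * ennreal (unit_ball_vol (real DIM('a)) * r ^ DIM('a))"
      using r by (simp add: emeasure_ball)
  qed
  finally show "(\<integral>\<^sup>+x0. (\<integral>\<^sup>+x\<in>ball x0 r. h x \<partial>lborel) \<partial>lborel) = ennreal (unit_ball_vol (real DIM('a)) * r ^ DIM('a)) * (\<integral>\<^sup>+x. h x \<partial>lborel)"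
    by (simp add: nn_integral_multc mult.commute)
qed

theorem theorem1p2:
  fixes \<sigma> :: "(real^'d^'m) measure" and s :: real
  assumes m2: "CARD('m) \<ge> 2"
    and s_gt: "s > real ((CARD('m) - 1) * CARD('d)) / 2 + 1 / 2"
    and sets_\<sigma>: "sets \<sigma> = sets borel"
    and fin: "finite_measure \<sigma>"
    and supp: "emeasure \<sigma> (UNIV - cball 0 1) = 0"
    and decay: "\<exists>A. \<forall>\<xi>. norm (fourier_measure \<sigma> \<xi>) \<le> A * (1 + norm \<xi>) powr (- s)"
  shows "\<exists>C. (\<forall>p \<in> {2 / real CARD('m) .. 2}. \<forall>F :: 'm \<Rightarrow> real^'d \<Rightarrow> complex.
             (\<forall>i. schwartz (F i)) \<longrightarrow>
             Lp_norm_on (ball 0 1) p (max_loc \<sigma> F) \<le> ennreal (C * (\<Prod>i\<in>UNIV. L2_norm_fun (F i))))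
          \<and> (\<forall>F :: 'm \<Rightarrow> real^'d \<Rightarrow> complex.
             (\<forall>i. schwartz (F i)) \<longrightarrow>
             Lp_norm_on UNIV (2 / real CARD('m)) (max_loc \<sigma> F) \<le> ennreal (C * (\<Prod>i\<in>UNIV. L2_norm_fun (F i))))"
proof -
  obtain A where A: "\<And>\<xi>. norm (fourier_measure \<sigma> \<xi>) \<le> A * (1 + norm \<xi>) powr (- s)"
    using decay by blast
  obtain C where C: "0 \<le> C" "\<And>(F :: 'm \<Rightarrow> real^'d \<Rightarrow> complex) x0. (\<And>i. continuous_on UNIV (F i)) \<Longrightarrow>
    (\<integral>\<^sup>+x\<in>ball x0 1. (max_loc \<sigma> F x)\<^sup>2 \<partial>lborel) \<le> ennreal C * (\<Prod>i\<in>UNIV. \<integral>\<^sup>+v\<in>cball x0 4. ennreal ((norm (F i v))\<^sup>2) \<partial>lborel)"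
    using max_loc_local_L2[OF m2 s_gt sets_\<sigma> fin supp A] by blast
  define m where "m = real CARD('m)"
  have m: "m \<ge> 2" using m2 by (simp add: m_def)
  define n where "n = DIM(real^'d)"
  define V where "V = unit_ball_vol (real n)"
  have V: "0 < V" by (simp add: V_def)
  \<comment> \<open>Uniform in \<open>p\<close>: the constant arises as
    \<open>(1 + V) powr (1 / p)\<close>, where the base is at least 1 and
    \<open>1 / p \<le> m / 2\<close>.\<close>
  define C1 where "C1 = (1 + V) powr (m / 2) * sqrt C"
  \<comment> \<open>The factor \<open>m\<close> counts the summands that replace a geometric mean,
    and \<open>4 ^ n\<close> is the ratio of the volumes of balls of radius 4 and 1.\<close>
  define C2 where "C2 = ((1 + V) * C powr (1 / m) * (m * 4 ^ n)) powr (m / 2)"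
  have C12: "0 \<le> C1" "0 \<le> C2" using C V by (auto simp: C1_def C2_def)
  have meas: "max_loc \<sigma> F \<in> borel_measurable borel" if F: "\<And>i. schwartz (F i)" for F :: "'m \<Rightarrow> real^'d \<Rightarrow> complex"
  proof (rule max_loc_measurable[OF fin sets_\<sigma> schwartz_continuous[OF F]])
    show "\<exists>M. \<forall>x. norm (F i x) \<le> M" for i
      using schwartz_decay[OF F[of i], of 0] by simp
  qed
  define \<beta> where "\<beta> f x0 = enn2real (\<integral>\<^sup>+v\<in>cball x0 4. ennreal ((norm (f v))\<^sup>2) \<partial>lborel)" for f :: "real^'d \<Rightarrow> complex" and x0
  have \<beta>: "(\<integral>\<^sup>+v\<in>cball x0 4. ennreal ((norm (f v))\<^sup>2) \<partial>lborel) = ennreal (\<beta> f x0)"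
    "0 \<le> \<beta> f x0" "\<beta> f x0 \<le> (L2_norm_fun f)\<^sup>2" if f: "schwartz f" for f :: "real^'d \<Rightarrow> complex" and x0
  proof -
    have le: "(\<integral>\<^sup>+v\<in>cball x0 4. ennreal ((norm (f v))\<^sup>2) \<partial>lborel) \<le> ennreal ((L2_norm_fun f)\<^sup>2)"
      unfolding schwartz_L2[OF f, symmetric] by (intro nn_integral_mono) (auto simp: indicator_def)
    then show "(\<integral>\<^sup>+v\<in>cball x0 4. ennreal ((norm (f v))\<^sup>2) \<partial>lborel) = ennreal (\<beta> f x0)"
      unfolding \<beta>_def by (intro ennreal_enn2real[symmetric]) (auto intro: le_less_trans)
    then show "\<beta> f x0 \<le> (L2_norm_fun f)\<^sup>2"
      using le by simp
  qed (simp add: \<beta>_def)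
  have local_Lp: "(\<integral>\<^sup>+x\<in>ball x0 1. enn_powr (max_loc \<sigma> F x) p \<partial>lborel) \<le> ennreal ((1 + V) * (C * (\<Prod>i\<in>UNIV. \<beta> (F i) x0)) powr (p / 2))"
    if F: "\<And>i. schwartz (F i)" and p: "0 < p" "p \<le> 2" for F :: "'m \<Rightarrow> real^'d \<Rightarrow> complex" and x0 p
    unfolding V_def n_def
  proof (rule nn_integral_ball_powr_le[OF meas[OF F] p])
    show "0 \<le> C * (\<Prod>i\<in>UNIV. \<beta> (F i) x0)"
      using C(1) \<beta>(2)[OF F] by (intro mult_nonneg_nonneg prod_nonneg) auto
    have "(\<integral>\<^sup>+x\<in>ball x0 1. (max_loc \<sigma> F x)\<^sup>2 \<partial>lborel) \<le> ennreal C * (\<Prod>i\<in>UNIV. ennreal (\<beta> (F i) x0))"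
      using C(2)[of F x0, OF schwartz_continuous[OF F]] by (simp only: \<beta>(1)[OF F])
    also have "\<dots> = ennreal (C * (\<Prod>i\<in>UNIV. \<beta> (F i) x0))"
      using C(1) \<beta>(2)[OF F] by (simp add: prod_ennreal ennreal_mult prod_nonneg)
    finally show "(\<integral>\<^sup>+x\<in>ball x0 1. (max_loc \<sigma> F x)\<^sup>2 \<partial>lborel) \<le> ennreal (C * (\<Prod>i\<in>UNIV. \<beta> (F i) x0))" .
  qed
  have part1: "Lp_norm_on (ball 0 1) p (max_loc \<sigma> F) \<le> ennreal (C1 * (\<Prod>i\<in>UNIV. L2_norm_fun (F i)))"
    if F: "\<And>i. schwartz (F i)" and p: "p \<in> {2 / m .. 2}" for F :: "'m \<Rightarrow> real^'d \<Rightarrow> complex" and p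
  proof -
    let ?N = "\<Prod>i\<in>UNIV. L2_norm_fun (F i)"
    have p0: "0 < p" "p \<le> 2" "1 / p \<le> m / 2"
    proof -
      have "0 < 2 / m" using m by simp
      then show "0 < p" using p unfolding atLeastAtMost_iff by linarith
      then show "p \<le> 2" using p by simp
      show "1 / p \<le> m / 2" using p m \<open>0 < p\<close> by (simp add: field_simps)
    qed
    have N: "0 \<le> ?N" by (simp add: prod_nonneg L2_norm_fun_nonneg)
    have "(\<Prod>i\<in>UNIV. \<beta> (F i) 0) \<le> (\<Prod>i\<in>UNIV. (L2_norm_fun (F i))\<^sup>2)"
      using \<beta>(2,3)[OF F] by (intro prod_mono) auto
    also have "\<dots> = ?N\<^sup>2" by (simp add: prod_power_distrib)
    finally have k: "C * (\<Prod>i\<in>UNIV. \<beta> (F i) 0) \<le> C * ?N\<^sup>2"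
      using C(1) by (rule mult_left_mono)
    have k0: "0 \<le> C * (\<Prod>i\<in>UNIV. \<beta> (F i) 0)"
      using C(1) \<beta>(2)[OF F] by (intro mult_nonneg_nonneg prod_nonneg) auto
    have "Lp_norm_on (ball 0 1) p (max_loc \<sigma> F) \<le> enn_powr (ennreal ((1 + V) * (C * (\<Prod>i\<in>UNIV. \<beta> (F i) 0)) powr (p / 2))) (1 / p)"
      unfolding Lp_norm_on_def using p0 by (intro enn_powr_mono local_Lp F) auto
    also have "\<dots> = ennreal (((1 + V) * (C * (\<Prod>i\<in>UNIV. \<beta> (F i) 0)) powr (p / 2)) powr (1 / p))"
      using V by (intro enn_powr_ennreal) auto
    also have "((1 + V) * (C * (\<Prod>i\<in>UNIV. \<beta> (F i) 0)) powr (p / 2)) powr (1 / p) =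
        (1 + V) powr (1 / p) * (C * (\<Prod>i\<in>UNIV. \<beta> (F i) 0)) powr (1 / 2)"
      using V p0 by (simp add: powr_mult powr_powr)
    also have "\<dots> \<le> (1 + V) powr (m / 2) * (C * ?N\<^sup>2) powr (1 / 2)"
      by (rule mult_mono[OF powr_mono powr_mono2[OF _ k0 k]]) (use V p0 in auto)
    also have "(C * ?N\<^sup>2) powr (1 / 2) = sqrt C * ?N"
      using C(1) N by (simp add: powr_half_sqrt real_sqrt_mult)
    finally show ?thesis
      by (simp add: C1_def mult.assoc ennreal_leI)
  qed
  have part2: "Lp_norm_on UNIV (2 / m) (max_loc \<sigma> F) \<le> ennreal (C2 * (\<Prod>i\<in>UNIV. L2_norm_fun (F i)))"
    if F: "\<And>i. schwartz (F i)" for F :: "'m \<Rightarrow> real^'d \<Rightarrow> complex"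
  proof -
    have [measurable]: "max_loc \<sigma> F \<in> borel_measurable borel"
      by (rule meas[OF F])
    have F_meas [measurable]: "F i \<in> borel_measurable borel" for i
      by (intro borel_measurable_continuous_onI schwartz_continuous F)
    define \<nu> where "\<nu> i = (L2_norm_fun (F i))\<^sup>2" for i
    have \<nu>: "0 \<le> \<nu> i" for i by (simp add: \<nu>_def)
    define P where "P = (\<Prod>i\<in>UNIV. \<nu> i powr (1 / m))"
    have P: "0 \<le> P" by (simp add: P_def prod_nonneg)
    define \<Theta> where "\<Theta> = (1 + V) * C powr (1 / m) * P"
    have \<Theta>: "0 \<le> \<Theta>" using V P by (simp add: \<Theta>_def)
    define h where "h x = enn_powr (max_loc \<sigma> F x) (2 / m)" for x
    have [measurable]: "h \<in> borel_measurable borel"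
      unfolding h_def by measurable
    \<comment> \<open>At \<open>p = 2 / m\<close> the local bound is a geometric mean of the local
      masses. Dividing each mass by its total \<open>\<nu> i\<close> before passing to a sum
      preserves the homogeneity in every \<open>F i\<close> and makes the integral over centres
      uniformly bounded.\<close>
    have pt: "(1 + V) * (C * (\<Prod>i\<in>UNIV. \<beta> (F i) x0)) powr (1 / m) \<le> \<Theta> * (\<Sum>i\<in>UNIV. \<beta> (F i) x0 / \<nu> i)" for x0
    proof -
      have b: "\<beta> (F i) x0 powr (1 / m) = \<nu> i powr (1 / m) * (\<beta> (F i) x0 / \<nu> i) powr (1 / m)" for i
      proof (cases "\<nu> i = 0")
        \<comment> \<open>A vanishing total mass forces the local mass to vanish, and
          \<open>x / 0 = 0\<close> keeps the identity valid.\<close>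
        case True
        then have "\<beta> (F i) x0 = 0" using \<beta>(2,3)[OF F[of i], of x0] by (simp add: \<nu>_def)
        with True show ?thesis by simp
      next
        case False
        then show ?thesis
          by (simp flip: powr_mult)
      qed
      have "(C * (\<Prod>i\<in>UNIV. \<beta> (F i) x0)) powr (1 / m) = C powr (1 / m) * (\<Prod>i\<in>UNIV. \<beta> (F i) x0 powr (1 / m))"
        by (simp add: powr_mult prod_powr_distrib \<beta>(2)[OF F])
      also have "\<dots> = C powr (1 / m) * (P * (\<Prod>i\<in>UNIV. (\<beta> (F i) x0 / \<nu> i) powr (1 / m)))"
        unfolding b prod.distrib P_def ..
      also have "\<dots> \<le> C powr (1 / m) * (P * (\<Sum>i\<in>UNIV. \<beta> (F i) x0 / \<nu> i))"
        unfolding m_def using P \<beta>(2)[OF F] \<nu>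
        by (intro mult_left_mono prod_powr_le_sum) auto
      finally have "(1 + V) * (C * (\<Prod>i\<in>UNIV. \<beta> (F i) x0)) powr (1 / m) \<le> (1 + V) * (C powr (1 / m) * (P * (\<Sum>i\<in>UNIV. \<beta> (F i) x0 / \<nu> i)))"
        using V by (intro mult_left_mono) auto
      then show ?thesis by (simp add: \<Theta>_def mult.assoc)
    qed
    have one: "(\<integral>\<^sup>+x0. ennreal (\<beta> (F i) x0 / \<nu> i) \<partial>lborel) \<le> ennreal (V * 4 ^ n)" for i
    proof (cases "\<nu> i = 0")
      case False
      with \<nu>[of i] have pos: "\<nu> i > 0" by simp
      have "(\<integral>\<^sup>+x0. ennreal (\<beta> (F i) x0 / \<nu> i) \<partial>lborel) = (\<integral>\<^sup>+x0. ennreal (1 / \<nu> i) * (\<integral>\<^sup>+v\<in>cball x0 4. ennreal ((norm (F i v))\<^sup>2) \<partial>lborel) \<partial>lborel)"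
        unfolding \<beta>(1)[OF F] using \<beta>(2)[OF F] pos by (intro nn_integral_cong) (simp flip: ennreal_mult)
      also have "\<dots> = (\<integral>\<^sup>+x0. (\<integral>\<^sup>+v\<in>cball x0 4. (ennreal (1 / \<nu> i) * ennreal ((norm (F i v))\<^sup>2)) \<partial>lborel) \<partial>lborel)"
        by (intro nn_integral_cong, subst nn_integral_cmult[symmetric]) (auto simp: mult.assoc intro!: borel_measurable_times_ennreal borel_measurable_indicator)
      also have "\<dots> = ennreal (V * 4 ^ n) * (\<integral>\<^sup>+v. ennreal (1 / \<nu> i) * ennreal ((norm (F i v))\<^sup>2) \<partial>lborel)"
        unfolding V_def n_def by (rule nn_integral_average_ball(1)) auto
      also have "(\<integral>\<^sup>+v. ennreal (1 / \<nu> i) * ennreal ((norm (F i v))\<^sup>2) \<partial>lborel) = ennreal (1 / \<nu> i) * ennreal (\<nu> i)"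
        by (subst nn_integral_cmult) (auto simp: schwartz_L2[OF F] \<nu>_def)
      also have "\<dots> = 1" using pos by (simp flip: ennreal_mult)
      finally show ?thesis by simp
    qed simp
    have \<beta>_meas: "(\<lambda>x0. ennreal (\<beta> (F i) x0 / \<nu> i)) \<in> borel_measurable borel" for i
      unfolding \<beta>_def by measurable
    \<comment> \<open>The factor \<open>V\<close> from averaging balls of radius 1 will cancel the
      one in \<open>one\<close> from balls of radius 4, up to \<open>4 ^ n\<close>.\<close>
    have "ennreal V * (\<integral>\<^sup>+x. h x \<partial>lborel) = (\<integral>\<^sup>+x0. (\<integral>\<^sup>+x\<in>ball x0 1. h x \<partial>lborel) \<partial>lborel)"
      using nn_integral_average_ball(2)[of h 1] by (simp add: V_def n_def)
    also have "\<dots> \<le> (\<integral>\<^sup>+x0. ennreal \<Theta> * (\<Sum>i\<in>UNIV. ennreal (\<beta> (F i) x0 / \<nu> i)) \<partial>lborel)"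
    proof (intro nn_integral_mono)
      fix x0
      have "(\<integral>\<^sup>+x\<in>ball x0 1. h x \<partial>lborel) \<le> ennreal ((1 + V) * (C * (\<Prod>i\<in>UNIV. \<beta> (F i) x0)) powr (2 / m / 2))"
        unfolding h_def using m by (intro local_Lp F) (auto simp: divide_le_eq)
      also have "\<dots> \<le> ennreal (\<Theta> * (\<Sum>i\<in>UNIV. \<beta> (F i) x0 / \<nu> i))"
        using pt[of x0] by (intro ennreal_leI) simp
      also have "\<dots> = ennreal \<Theta> * (\<Sum>i\<in>UNIV. ennreal (\<beta> (F i) x0 / \<nu> i))"
        using \<Theta> \<beta>(2)[OF F] \<nu> by (subst sum_ennreal) (auto simp: ennreal_mult sum_nonneg)
      finally show "(\<integral>\<^sup>+x\<in>ball x0 1. h x \<partial>lborel) \<le> ennreal \<Theta> * (\<Sum>i\<in>UNIV. ennreal (\<beta> (F i) x0 / \<nu> i))" .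
    qed
    also have "\<dots> = ennreal \<Theta> * (\<Sum>i\<in>UNIV. \<integral>\<^sup>+x0. ennreal (\<beta> (F i) x0 / \<nu> i) \<partial>lborel)"
      using \<beta>_meas by (simp add: nn_integral_cmult nn_integral_sum)
    also have "\<dots> \<le> ennreal \<Theta> * (\<Sum>i\<in>(UNIV :: 'm set). ennreal (V * 4 ^ n))"
      by (intro mult_left_mono sum_mono one) auto
    also have "\<dots> = ennreal (V * (\<Theta> * (m * 4 ^ n)))"
    proof -
      have "(\<Sum>i\<in>(UNIV :: 'm set). ennreal (V * 4 ^ n)) = ennreal (\<Sum>i\<in>(UNIV :: 'm set). V * 4 ^ n)"
        using V by (intro sum_ennreal) auto
      then show ?thesis
        using \<Theta> V m by (simp add: m_def mult_ac flip: ennreal_mult)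
    qed
    finally have "ennreal (1 / V) * (ennreal V * (\<integral>\<^sup>+x. h x \<partial>lborel)) \<le> ennreal (1 / V) * ennreal (V * (\<Theta> * (m * 4 ^ n)))"
      by (rule mult_left_mono) auto
    moreover have "ennreal (1 / V) * (ennreal V * c) = c" for c
      using V by (simp add: mult.assoc[symmetric] flip: ennreal_mult)
    moreover have "ennreal (1 / V) * ennreal (V * (\<Theta> * (m * 4 ^ n))) = ennreal (\<Theta> * (m * 4 ^ n))"
      using V \<Theta> m by (simp flip: ennreal_mult)
    ultimately have H: "(\<integral>\<^sup>+x. h x \<partial>lborel) \<le> ennreal (\<Theta> * (m * 4 ^ n))"
      by simp
    have "Lp_norm_on UNIV (2 / m) (max_loc \<sigma> F) = enn_powr (\<integral>\<^sup>+x. h x \<partial>lborel) (m / 2)"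
      by (simp add: Lp_norm_on_def h_def)
    also have "\<dots> \<le> enn_powr (ennreal (\<Theta> * (m * 4 ^ n))) (m / 2)"
      using m by (intro enn_powr_mono H) auto
    also have "\<dots> = ennreal ((\<Theta> * (m * 4 ^ n)) powr (m / 2))"
      using \<Theta> m by (intro enn_powr_ennreal) auto
    also have "(\<Theta> * (m * 4 ^ n)) powr (m / 2) = C2 * P powr (m / 2)"
    proof -
      have "\<Theta> * (m * 4 ^ n) = ((1 + V) * C powr (1 / m) * (m * 4 ^ n)) * P"
        by (simp add: \<Theta>_def)
      then show ?thesis unfolding C2_def by (simp only: powr_mult)
    qed
    also have "P powr (m / 2) = (\<Prod>i\<in>UNIV. L2_norm_fun (F i))"
    proof -
      have "P powr (m / 2) = (\<Prod>i\<in>UNIV. (\<nu> i powr (1 / m)) powr (m / 2))"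
        unfolding P_def by (simp add: prod_powr_distrib)
      also have "\<dots> = (\<Prod>i\<in>UNIV. \<nu> i powr (1 / 2))"
        using m by (simp add: powr_powr)
      also have "\<dots> = (\<Prod>i\<in>UNIV. L2_norm_fun (F i))"
        by (simp add: \<nu>_def powr_half_sqrt L2_norm_fun_nonneg)
      finally show ?thesis .
    qed
    finally show ?thesis .
  qed
  have le: "ennreal (c * (\<Prod>i\<in>UNIV. L2_norm_fun (F i))) \<le> ennreal ((C1 + C2) * (\<Prod>i\<in>UNIV. L2_norm_fun (F i)))"
    if "c \<le> C1 + C2" for c and F :: "'m \<Rightarrow> real^'d \<Rightarrow> complex"
    using that by (intro ennreal_leI mult_right_mono prod_nonneg) (auto simp: L2_norm_fun_nonneg)
  show ?thesis
  proof (intro exI[of _ "C1 + C2"] conjI ballI allI impI)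
    fix p and F :: "'m \<Rightarrow> real^'d \<Rightarrow> complex"
    assume "p \<in> {2 / real CARD('m)..2}" "\<forall>i. schwartz (F i)"
    then show "Lp_norm_on (ball 0 1) p (max_loc \<sigma> F) \<le> ennreal ((C1 + C2) * (\<Prod>i\<in>UNIV. L2_norm_fun (F i)))"
      using C12 by (intro order_trans[OF part1 le]) (auto simp: m_def)
  next
    fix F :: "'m \<Rightarrow> real^'d \<Rightarrow> complex"
    assume "\<forall>i. schwartz (F i)"
    then show "Lp_norm_on UNIV (2 / real CARD('m)) (max_loc \<sigma> F) \<le> ennreal ((C1 + C2) * (\<Prod>i\<in>UNIV. L2_norm_fun (F i)))"
      unfolding m_def[symmetric] using C12 by (intro order_trans[OF part2 le]) auto
  qed
qed

end
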